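(* Let $N\equiv 0\pmod{24}$ be an arbitrary integer. Suppose that $m$ and $k$ are positive integers with $$1^k+2^k+\cdots+(m-1)^k=m^k,\qquad k\ge 2,\qquad N\mid k,\qquad m<10^{10^{11}}.$$ Then $m+2$ has a prime divisor $p>3$ such that: 1) $\gcd(\mathrm{ord}_2(p),N)=2$; 2) $k\equiv \frac{\mathrm{ord}_2(p)}{2}-1 \pmod{\mathrm{ord}_2(p)}$. In case $m\equiv 2\pmod 3$, the same conclusion holds with the hypothesis $m<10^{10^{11}}$ replaced by $m<10^{10^{16}}$. In case $N=N_2$, we have $p\ge 2\,099$ for such a prime $p$.
   Context: For an odd prime $p$, $\mathrm{ord}_2(p)$ denotes the multiplicative order of $2$ modulo $p$, i.e. the smallest positive integer $t$ such that $2^t\equiv 1\pmod p$. The integer $N_2$ is $$N_2=2^8\cdot 3^5\cdot 5^4\cdot 7^3\cdot 11^2\cdot 13^2\cdot 17^2\cdot 19^2\cdot 23\cdots 997,$$ where the final factors $23\cdots 997$ stand for the product of all primes $q$ with $23\le q\le 997$ (each to the first power). *)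

theory Defs
  imports "HOL-Number_Theory.Number_Theory"
begin

definition erdos_moser_solution :: "nat \<Rightarrow> nat \<Rightarrow> bool" where
  "erdos_moser_solution m k \<longleftrightarrow> (\<Sum>j = 1..<m. j ^ k) = m ^ k"

definition N2 :: int where
  "N2 = 2^8 * 3^5 * 5^4 * 7^3 * 11^2 * 13^2 * 17^2 * 19^2
        * int (\<Prod>q | prime q \<and> 23 \<le> q \<and> q \<le> 997. q)"

text \<open>
  Here \<open>ord p 2\<close> is the multiplicative order of \<open>2\<close> modulo \<open>p\<close>; the modulus is the first argument.
  The gcd condition makes it even, so the \<open>div\<close> below is exact. The congruence is stated over
  \<open>int\<close> to avoid truncated subtraction.
\<close>

definition special_prime_divisor :: "int \<Rightarrow> nat \<Rightarrow> nat \<Rightarrow> nat \<Rightarrow> bool" where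
  "special_prime_divisor N m k p \<longleftrightarrow>
     prime p \<and> p > 3 \<and> p dvd m + 2 \<and>
     gcd (int (ord p 2)) N = 2 \<and>
     [int k = int (ord p 2) div 2 - 1] (mod int (ord p 2))"

end

theory Submission
  imports Defs "HOL-Analysis.Henstock_Kurzweil_Integration" "HOL-Analysis.Harmonic_Numbers"
begin

text \<open>
  Write \<open>S\<^sub>k(n)\<close> for the sum of \<open>j ^ k\<close> over \<open>j < n\<close>; a solution satisfies \<open>S\<^sub>k(m) = m ^ k\<close>, and
  \<open>24\<close> divides \<open>k\<close>.

  The arithmetic input is due to von Staudt: if \<open>p - 1\<close> divides the even number \<open>k\<close>, then
  \<open>S\<^sub>k(n)\<close> is congruent to \<open>- n / p\<close> modulo the exact power of \<open>p\<close> in \<open>n\<close>, and otherwise \<open>p\<close> divides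
  \<open>S\<^sub>k(n)\<close> for every multiple \<open>n\<close> of \<open>p\<close>.  For \<open>n\<close> among \<open>m - 1\<close>, \<open>m + 1\<close>, \<open>2 m - 1\<close>, \<open>2 m + 1\<close> the residue of
  \<open>S\<^sub>k(n)\<close> is known from the equation, which forces \<open>p - 1\<close> to divide \<open>k\<close> for every prime \<open>p\<close> in \<open>n\<close>.
  Gluing the local congruences shows, as Moser observed, that the sum of \<open>1 / p\<close> over the primes
  \<open>p\<close> in \<open>n\<close>, plus a small fraction \<open>c / n\<close>, is an integer (\<open>moser_integrality\<close>), hence at least \<open>1\<close>.

  For \<open>n = m + 2\<close> one has \<open>S\<^sub>k(n) = 2 m ^ k + (m + 1) ^ k\<close>, which is congruent to \<open>2 ^ (k + 1) + 1\<close>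
  modulo \<open>n\<close>.  A prime \<open>p > 3\<close> in \<open>m + 2\<close> for which \<open>p - 1\<close> does not divide \<open>k\<close> therefore
  satisfies \<open>2 ^ (k + 1) = -1\<close> modulo \<open>p\<close>, and since \<open>N\<close> divides \<open>k\<close>, this implies all that is
  claimed about \<open>p\<close> (\<open>special_prime_divisorI\<close>).  If there is no such \<open>p\<close>, then \<open>m + 2\<close> joins the other four numbers.
  Only \<open>2\<close>, \<open>3\<close> and \<open>5\<close> can divide more than one of the five numbers, so the reciprocals of the
  primes dividing their product \<open>X\<close> add up to at least about \<open>5 - 1/2 - 2/3 - 1/5\<close>, and even
  \<open>5 - 1/2 - 1/3 - 1/5\<close> if \<open>m\<close> is \<open>2\<close> modulo \<open>3\<close>.  But the logarithms of these primes add up to at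
  most \<open>ln X\<close>, about \<open>5 ln m\<close>.

  The two facts are incompatible for \<open>m\<close> below the stated bounds because of an explicit form of
  Mertens' theorem, \<open>sum_inverse_primes_le\<close>: if the logarithms of a finite set of primes add up to
  at most \<open>n\<close>, then their reciprocals add up to at most \<open>ln (ln n) + 0.2785\<close> plus small terms; the
  limiting constant is \<open>0.2614...\<close>, so little is lost.  The proof bounds the logarithmic
  average of the sums of \<open>\<Lambda>(d) / d\<close> with the harmonic numbers in place of the floor function.  This
  smoothing has the correct main terms up to a bounded error, and a table up to \<open>1024\<close> then
  suffices for the remaining constant.

  For \<open>N = N2\<close> the order of \<open>2\<close> modulo \<open>p\<close> has, apart from one factor \<open>2\<close>, only prime factors beyond
  \<open>997\<close>.  Below \<open>2099\<close> this leaves only \<open>p = 2027\<close>, where \<open>k\<close> is \<open>-1\<close> modulo \<open>1013\<close>.  As \<open>6\<close> divides \<open>k\<close>,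
  the residue of \<open>k\<close> modulo \<open>6078\<close> is then \<open>5064\<close>, and the equation has no solution modulo the
  prime \<open>6079\<close> except possibly with \<open>6079\<close> dividing \<open>m\<close>.  The latter case is excluded by a
  congruence for half sums of powers, which every odd prime divisor \<open>p\<close> of \<open>m\<close> satisfies
  (\<open>prime_dvd_solution\<close>) and which fails for \<open>6079\<close>.
\<close>

section \<open>Sums of powers modulo prime powers\<close>

definition power_sum :: "nat \<Rightarrow> nat \<Rightarrow> int" where
  "power_sum k n = (\<Sum>j<n. int j ^ k)"

lemma power_sum_Suc: "power_sum k (Suc n) = power_sum k n + int n ^ k"
  by (simp add: power_sum_def)

lemma sum_blocks: "(\<Sum>j<q * w. f j) = (\<Sum>i<w. \<Sum>j<q. f (i * q + j))"
  for f :: "nat \<Rightarrow> 'a :: comm_monoid_add"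
proof -
  have "(\<Sum>j<q * w. f j) = (\<Sum>i<w. sum f {i * q..<i * q + q})"
    by (subst sum.nat_group) (simp add: mult.commute)
  also have "\<dots> = (\<Sum>i<w. \<Sum>j<q. f (i * q + j))"
  proof (rule sum.cong)
    fix i
    show "sum f {i * q..<i * q + q} = (\<Sum>j<q. f (i * q + j))"
      using sum.shift_bounds_nat_ivl[of f 0 "i * q" q] by (simp add: lessThan_atLeast0 add.commute)
  qed simp
  finally show ?thesis .
qed

lemma power_sum_mult_cong: "[power_sum k (q * w) = int w * power_sum k q] (mod int q)"
proof -
  have "[(\<Sum>i<w. \<Sum>j<q. int (i * q + j) ^ k) = (\<Sum>i<w. \<Sum>j<q. int j ^ k)] (mod int q)"
  proof (intro cong_sum cong_pow)
    fix i j :: nat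
    show "[int (i * q + j) = int j] (mod int q)"
      by (simp add: cong_iff_dvd_diff)
  qed
  thus ?thesis by (simp add: power_sum_def sum_blocks)
qed

text \<open>
  Second order in \<open>q\<close>: writing \<open>j = i q + r\<close>, the linear term of \<open>(i q + r) ^ k\<close> is kept because it
  decides the induction on the exponent of a prime power \<open>q\<close>.
\<close>

lemma power_sum_mult_cong_square:
  "[power_sum k (q * w) = int w * power_sum k q + int k * int q * (\<Sum>i<w. int i) * power_sum (k - 1) q]
     (mod (int q)\<^sup>2)"
proof -
  have binomial: "[(x * y + z) ^ k = z ^ k + int k * x * y * z ^ (k - 1)] (mod y\<^sup>2)" for x y z :: int
  proof (induction k)
    case (Suc k)
    have "[(x * y + z) ^ Suc k = (x * y + z) * (z ^ k + int k * x * y * z ^ (k - 1))] (mod y\<^sup>2)"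
      using Suc by (simp add: cong_scalar_left)
    also have "(x * y + z) * (z ^ k + int k * x * y * z ^ (k - 1)) =
        z ^ Suc k + int (Suc k) * x * y * z ^ (Suc k - 1) + y\<^sup>2 * (int k * x\<^sup>2 * z ^ (k - 1))"
      by (cases k) (simp_all add: algebra_simps power2_eq_square)
    also have "[\<dots> = z ^ Suc k + int (Suc k) * x * y * z ^ (Suc k - 1)] (mod y\<^sup>2)"
      by (simp add: cong_iff_dvd_diff)
    finally show ?case .
  qed auto
  have "[(\<Sum>i<w. \<Sum>j<q. int (i * q + j) ^ k) =
         (\<Sum>i<w. \<Sum>j<q. int j ^ k + int k * int i * int q * int j ^ (k - 1))] (mod (int q)\<^sup>2)"
    using binomial by (intro cong_sum) simp
  also have "(\<Sum>i<w. \<Sum>j<q. int j ^ k + int k * int i * int q * int j ^ (k - 1)) =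
      int w * power_sum k q + int k * int q * (\<Sum>i<w. int i) * power_sum (k - 1) q"
    by (simp add: sum.distrib power_sum_def sum_distrib_left sum_distrib_right mult_ac)
  finally show ?thesis by (simp add: power_sum_def sum_blocks)
qed

lemma power_eq_1_mod_prime:
  assumes "prime p" "(p - 1) dvd k" "\<not>int p dvd x"
  shows "[x ^ k = 1] (mod int p)"
proof -
  obtain c where c: "k = (p - 1) * c" using assms(2) by auto
  have "[x ^ (p - 1) = 1] (mod int p)"
  proof -
    have "\<not>p dvd nat (x mod int p)"
    proof
      assume "p dvd nat (x mod int p)"
      hence "int p dvd int (nat (x mod int p))" by (simp only: int_dvd_int_iff)
      hence "int p dvd x mod int p" using assms prime_gt_0_nat[of p] by simp
      thus False using assms(3) by (simp add: dvd_mod_iff)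
    qed
    hence "[nat (x mod int p) ^ (p - 1) = 1] (mod p)"
      using assms by (intro fermat_theorem) auto
    hence "[(x mod int p) ^ (p - 1) = 1] (mod int p)"
      using assms prime_gt_0_nat[of p] by (simp add: cong_int_iff [symmetric])
    moreover have "[x ^ (p - 1) = (x mod int p) ^ (p - 1)] (mod int p)"
      by (intro cong_pow) (simp add: unique_euclidean_semiring_class.cong_def)
    ultimately show ?thesis using cong_trans by blast
  qed
  hence "[(x ^ (p - 1)) ^ c = 1 ^ c] (mod int p)" by (rule cong_pow)
  thus ?thesis by (simp add: c power_mult)
qed

lemma power_sum_prime_dvd:
  assumes "prime p" "(p - 1) dvd k" "k > 0"
  shows "[power_sum k p = -1] (mod int p)"
proof -
  have p: "p > 1" using assms prime_gt_1_nat by blast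
  have "power_sum k p = (\<Sum>j\<in>{1..<p}. int j ^ k)"
    unfolding power_sum_def using assms(3) p
    by (intro sum.mono_neutral_cong_right) (auto simp: Suc_le_eq)
  also have "[\<dots> = (\<Sum>j\<in>{1..<p}. 1)] (mod int p)"
    using assms by (intro cong_sum power_eq_1_mod_prime) (auto dest: dvd_imp_le)
  also have "(\<Sum>j\<in>{1..<p}. 1 :: int) = int p - 1" using p by (simp add: of_nat_diff)
  also have "[\<dots> = -1] (mod int p)" by (simp add: cong_iff_dvd_diff)
  finally show ?thesis .
qed

text \<open>
  Multiplication by a primitive root \<open>g\<close> permutes the residues, so \<open>(g ^ k - 1) * power_sum k p\<close>
  vanishes modulo \<open>p\<close> while \<open>g ^ k\<close> is not \<open>1\<close>.
\<close>

lemma power_sum_prime_not_dvd: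
  assumes "prime p" "\<not>(p - 1) dvd k"
  shows "int p dvd power_sum k p"
proof -
  have p: "p > 1" using assms prime_gt_1_nat by blast
  obtain g where g: "residue_primroot p g"
    using prime_primitive_root_exists[of p] assms p by auto
  have cop: "coprime p g" and ordg: "ord p g = p - 1"
    using g assms by (auto simp: residue_primroot_def totient_prime)
  have "inj_on (\<lambda>j. g * j mod p) {..<p}"
  proof (rule inj_onI)
    fix x y assume "x \<in> {..<p}" "y \<in> {..<p}" "g * x mod p = g * y mod p"
    hence "[x = y] (mod p)" using cop by (metis unique_euclidean_semiring_class.cong_def cong_mult_lcancel_nat coprime_commute)
    thus "x = y" using \<open>x \<in> {..<p}\<close> \<open>y \<in> {..<p}\<close> by (simp add: unique_euclidean_semiring_class.cong_def)
  qed
  moreover have "(\<lambda>j. g * j mod p) ` {..<p} \<subseteq> {..<p}" using p by auto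
  ultimately have bij: "bij_betw (\<lambda>j. g * j mod p) {..<p} {..<p}"
    by (simp add: bij_betw_def endo_inj_surj)
  have "power_sum k p = (\<Sum>j<p. int (g * j mod p) ^ k)"
    unfolding power_sum_def by (rule sum.reindex_bij_betw[OF bij, symmetric])
  also have "[\<dots> = (\<Sum>j<p. int (g * j) ^ k)] (mod int p)"
    by (intro cong_sum cong_pow) (simp add: unique_euclidean_semiring_class.cong_def zmod_int)
  also have "(\<Sum>j<p. int (g * j) ^ k) = int g ^ k * power_sum k p"
    by (simp add: power_sum_def sum_distrib_left power_mult_distrib)
  finally have "int p dvd power_sum k p * (1 - int g ^ k)"
    by (simp add: cong_iff_dvd_diff algebra_simps)
  moreover have "\<not>int p dvd 1 - int g ^ k"
  proof
    assume "int p dvd 1 - int g ^ k"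
    hence "[int (g ^ k) = int 1] (mod int p)" by (simp add: cong_iff_dvd_diff dvd_diff_commute)
    hence "[g ^ k = 1] (mod p)" by (simp only: cong_int_iff)
    hence "ord p g dvd k" by (simp only: ord_divides)
    thus False using assms ordg by simp
  qed
  ultimately show ?thesis using assms by (simp add: prime_dvd_mult_iff)
qed

text \<open>
  Passing from \<open>p ^ a\<close> to \<open>p ^ (a + 1)\<close> multiplies the sum by \<open>p\<close>, up to the linear term of
  \<open>power_sum_mult_cong_square\<close>.  That term vanishes modulo \<open>p ^ (a + 1)\<close> since \<open>p\<close> divides
  \<open>0 + 1 + \<dots> + (p - 1)\<close> if \<open>p\<close> is odd, and \<open>k\<close> is even if \<open>p = 2\<close>.
\<close>

lemma power_sum_prime_power:
  assumes "prime p" "(p - 1) dvd k" "even k" "k > 0"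
  shows "[power_sum k (p ^ Suc a) = - (int p ^ a)] (mod int p ^ Suc a)"
proof (induction a)
  case 0
  thus ?case using power_sum_prime_dvd[OF assms(1,2,4)] by simp
next
  case (Suc a)
  let ?q = "p ^ Suc a"
  have "int p ^ Suc (Suc a) dvd (int ?q)\<^sup>2"
    unfolding of_nat_power power_mult [symmetric] by (rule le_imp_power_dvd) simp
  hence "[power_sum k (?q * p) = int p * power_sum k ?q + int k * int ?q * (\<Sum>i<p. int i) * power_sum (k - 1) ?q]
     (mod int p ^ Suc (Suc a))"
    using power_sum_mult_cong_square cong_dvd_modulus by blast
  also have "[int p * power_sum k ?q + int k * int ?q * (\<Sum>i<p. int i) * power_sum (k - 1) ?q =
      int p * power_sum k ?q + 0] (mod int p ^ Suc (Suc a))"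
  proof (intro cong_add cong_refl)
    have "int p dvd int k * (\<Sum>i<p. int i)"
    proof (cases "p = 2")
      case False
      hence "odd p" using assms(1) prime_odd_nat[of p] prime_ge_2_nat[of p] by linarith
      have "2 * (\<Sum>i<p. int i) = int p * (int p - 1)"
        by (induction p) (auto simp: algebra_simps)
      hence "int p dvd 2 * (\<Sum>i<p. int i)" by simp
      moreover have "coprime (int p) 2" using \<open>odd p\<close> by simp
      ultimately show ?thesis by (simp add: coprime_dvd_mult_right_iff)
    qed (use assms(3) in auto)
    hence "int p ^ Suc (Suc a) dvd int ?q * (int k * (\<Sum>i<p. int i))"
      by (simp add: mult_dvd_mono)
    hence "int p ^ Suc (Suc a) dvd int ?q * (int k * (\<Sum>i<p. int i)) * power_sum (k - 1) ?q"
      by (rule dvd_mult2)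
    thus "[int k * int ?q * (\<Sum>i<p. int i) * power_sum (k - 1) ?q = 0] (mod int p ^ Suc (Suc a))"
      by (simp add: cong_0_iff mult_ac)
  qed
  also have "[int p * power_sum k ?q + 0 = int p * (- (int p ^ a))] (mod int p ^ Suc (Suc a))"
  proof -
    have "int p * int p ^ Suc a dvd int p * (power_sum k ?q - (- (int p ^ a)))"
      using Suc.IH by (intro mult_dvd_mono) (auto simp: cong_iff_dvd_diff)
    thus ?thesis by (simp add: cong_iff_dvd_diff algebra_simps)
  qed
  finally show ?case by (simp add: mult.commute)
qed

text \<open>
  The theorem of von Staudt for power sums, in the form that glues well: the right-hand side
  \<open>- (n div p)\<close> does not mention the exponent of \<open>p\<close>, and \<open>n div q\<close> vanishes modulo the same
  prime power for every other prime \<open>q\<close>.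
\<close>

lemma power_sum_cong_neg_div_prime:
  assumes "prime p" "(p - 1) dvd k" "even k" "k > 0" "n > 0" "p dvd n"
  shows "[power_sum k n = - int (n div p)] (mod int p ^ multiplicity p n)"
proof -
  obtain a where a: "multiplicity p n = Suc a"
    using assms prime_multiplicity_gt_zero_iff[of p n] by (cases "multiplicity p n") auto
  obtain b where b: "n = p ^ Suc a * b" by (metis a multiplicity_dvd dvdE)
  have "[power_sum k (p ^ Suc a * b) = int b * power_sum k (p ^ Suc a)] (mod int p ^ Suc a)"
    using power_sum_mult_cong[of k "p ^ Suc a" b] by simp
  also have "[int b * power_sum k (p ^ Suc a) = int b * (- (int p ^ a))] (mod int p ^ Suc a)"
    using power_sum_prime_power[OF assms(1-4)] by (rule cong_scalar_left)
  also have "int b * (- (int p ^ a)) = - int (n div p)"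
  proof -
    have "n div p = p ^ a * b"
      using b assms(1) prime_gt_0_nat[of p] by (simp add: mult.assoc)
    thus ?thesis by simp
  qed
  finally show ?thesis unfolding a b [symmetric] by simp
qed

lemma int_dvd_if_prime_powers_dvd:
  assumes "n > 0" "\<And>p. prime p \<Longrightarrow> p dvd n \<Longrightarrow> int p ^ multiplicity p n dvd A"
  shows "int n dvd A"
proof -
  have "n dvd nat \<bar>A\<bar>"
  proof (cases "A = 0")
    case False
    show ?thesis
    proof (rule multiplicity_le_imp_dvd)
      fix p :: nat assume p: "prime p"
      show "multiplicity p n \<le> multiplicity p (nat \<bar>A\<bar>)"
      proof (cases "p dvd n")
        case True
        hence "int (p ^ multiplicity p n) dvd A" using assms p by simp
        hence "p ^ multiplicity p n dvd nat \<bar>A\<bar>" by (simp only: int_dvd_int_iff [symmetric] nat_abs_int_diff abs_of_nonneg int_nat_eq abs_ge_zero if_True dvd_abs_iff)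
        thus ?thesis using p False by (intro multiplicity_geI) (auto simp: prime_gt_1_nat)
      qed (simp add: not_dvd_imp_multiplicity_0)
    qed (use assms in auto)
  qed auto
  hence "int n dvd int (nat \<bar>A\<bar>)" by (simp only: int_dvd_int_iff)
  thus ?thesis by simp
qed

text \<open>
  Modulo the exact power of \<open>p\<close> in \<open>n\<close>, the sum of \<open>n div q\<close> over all primes \<open>q\<close> in \<open>n\<close> reduces to
  \<open>n div p\<close>, which is \<open>- c\<close> by von Staudt.  Hence \<open>n\<close> divides this sum plus \<open>c\<close>.
\<close>

lemma moser_integrality:
  assumes "n > 0" "even k" "k > 0"
    and "\<And>p. prime p \<Longrightarrow> p dvd n \<Longrightarrow>
           (p - 1) dvd k \<and> [power_sum k n = c] (mod int p ^ multiplicity p n)"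
  shows "(\<Sum>p\<in>prime_factors n. 1 / real p) + real_of_int c / real n \<in> \<int>"
proof -
  define A where "A = (\<Sum>q\<in>prime_factors n. int (n div q)) + c"
  have "int n dvd A"
  proof (rule int_dvd_if_prime_powers_dvd)
    fix p assume p: "prime p" "p dvd n"
    let ?P = "int p ^ multiplicity p n"
    have pf: "p \<in> prime_factors n" using p assms(1) by (simp add: prime_factors_dvd)
    have "?P dvd (\<Sum>q\<in>prime_factors n - {p}. int (n div q))"
    proof (rule dvd_sum)
      fix q assume q: "q \<in> prime_factors n - {p}"
      hence q': "prime q" "q dvd n" "q \<noteq> p" by (auto simp: in_prime_factors_iff)
      have "coprime (p ^ multiplicity p n) q"
        using q' p by (simp add: primes_coprime coprime_power_left_iff)
      moreover have "p ^ multiplicity p n dvd (n div q) * q"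
        using q' by (simp add: multiplicity_dvd)
      ultimately have "p ^ multiplicity p n dvd n div q"
        by (simp add: coprime_dvd_mult_left_iff)
      thus "?P dvd int (n div q)" by (metis int_dvd_int_iff of_nat_power)
    qed
    moreover have "?P dvd int (n div p) + c"
    proof -
      have "[- int (n div p) = c] (mod ?P)"
        using power_sum_cong_neg_div_prime[of p k n] assms p by (meson cong_sym cong_trans)
      thus ?thesis by (metis cong_iff_dvd_diff cong_sym diff_minus_eq_add add.commute)
    qed
    ultimately have "?P dvd (\<Sum>q\<in>prime_factors n - {p}. int (n div q)) + (int (n div p) + c)"
      by (rule dvd_add)
    also have "\<dots> = A"
      unfolding A_def using pf by (subst sum.remove[of _ p]) auto
    finally show "?P dvd A" .
  qed fact
  then obtain z where z: "A = int n * z" by auto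
  have "(\<Sum>p\<in>prime_factors n. 1 / real p) + real_of_int c / real n = real_of_int A / real n"
  proof -
    have "(\<Sum>q\<in>prime_factors n. real (n div q)) / real n = (\<Sum>q\<in>prime_factors n. 1 / real q)"
      unfolding sum_divide_distrib
    proof (intro sum.cong refl)
      fix q assume "q \<in> prime_factors n"
      hence "q dvd n" "q > 0" by (auto simp: in_prime_factors_iff prime_gt_0_nat)
      thus "real (n div q) / real n = 1 / real q"
        using assms(1) by (auto simp: real_of_nat_div)
    qed
    thus ?thesis by (simp add: A_def add_divide_distrib)
  qed
  also have "\<dots> = real_of_int z" using z assms(1) by simp
  finally show ?thesis by simp
qed

section \<open>Solutions of the equation and Moser's integrality\<close>

lemma solution_power_sum:
  assumes "erdos_moser_solution m k" "k > 0"
  shows "power_sum k m = int m ^ k"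
proof -
  have "power_sum k m = (\<Sum>j = 1..<m. int j ^ k)"
    unfolding power_sum_def using assms(2)
    by (intro sum.mono_neutral_cong_right) (auto simp: Suc_le_eq)
  also have "\<dots> = int (\<Sum>j = 1..<m. j ^ k)" by simp
  also have "\<dots> = int m ^ k"
    using assms(1) by (simp add: erdos_moser_solution_def)
  finally show ?thesis .
qed

text \<open>
  As long as \<open>n \<le> k\<close>, Bernoulli's inequality gives \<open>2 * n ^ k \<le> (n + 1) ^ k\<close>, so the powers grow so
  fast that each exceeds the sum of the previous ones.  A solution thus has \<open>m > k + 1\<close>.
\<close>

lemma power_sum_less:
  assumes "k > 0" "1 \<le> n" "n \<le> k + 1"
  shows "power_sum k n < int n ^ k"
  using assms(2,3)
proof (induction n rule: dec_induct)
  case base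
  thus ?case using assms(1) by (simp add: power_sum_def zero_power)
next
  case (step n)
  have "power_sum k (Suc n) < 2 * int n ^ k"
    using step by (simp add: power_sum_Suc)
  also have "2 * int n ^ k \<le> int (Suc n) ^ k"
  proof -
    define x where "x = 1 / real n"
    have n: "real n > 0" using step by simp
    have "2 \<le> 1 + real k * x" using step by (simp add: x_def field_simps)
    also have "\<dots> \<le> (1 + x) ^ k"
      using n by (intro Bernoulli_inequality) (simp add: x_def field_simps)
    finally have "2 * real n ^ k \<le> (1 + x) ^ k * real n ^ k"
      by (rule mult_right_mono) simp
    also have "\<dots> = ((1 + x) * real n) ^ k" by (rule power_mult_distrib [symmetric])
    also have "(1 + x) * real n = real (Suc n)" using n by (simp add: x_def field_simps)
    finally have "2 * real n ^ k \<le> real (Suc n) ^ k" .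
    hence "real_of_int (2 * int n ^ k) \<le> real_of_int (int (Suc n) ^ k)" by simp
    thus ?thesis by (simp only: of_int_le_iff)
  qed
  finally show ?case .
qed

text \<open>
  For even \<open>k\<close> the terms \<open>j\<close> and \<open>2 h + 1 - j\<close> agree modulo \<open>2 h + 1\<close>.  With \<open>h = m - 1\<close> and \<open>h = m\<close> this
  computes the power sums at \<open>2 m - 1\<close> and \<open>2 m + 1\<close>.
\<close>

lemma power_sum_reflect:
  assumes "even k" "k > 0"
  shows "[power_sum k (2 * h + 1) = 2 * power_sum k (h + 1)] (mod int (2 * h + 1))"
proof -
  have "power_sum k (2 * h + 1) = power_sum k (h + 1) + (\<Sum>j\<in>{h + 1..<2 * h + 1}. int j ^ k)"
    unfolding power_sum_def lessThan_atLeast0 by (subst sum.atLeastLessThan_concat) auto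
  also have "(\<Sum>j\<in>{h + 1..<2 * h + 1}. int j ^ k) = (\<Sum>j\<in>{1..<h + 1}. int (2 * h + 1 - j) ^ k)"
    by (intro sum.reindex_bij_witness[of _ "\<lambda>j. 2 * h + 1 - j" "\<lambda>j. 2 * h + 1 - j"]) auto
  also have "[power_sum k (h + 1) + \<dots> = power_sum k (h + 1) + (\<Sum>j\<in>{1..<h + 1}. int j ^ k)] (mod int (2 * h + 1))"
  proof (intro cong_add cong_refl cong_sum)
    fix j assume "j \<in> {1..<h + 1}"
    hence "[int (2 * h + 1 - j) = - int j] (mod int (2 * h + 1))"
      by (simp add: cong_iff_dvd_diff of_nat_diff)
    hence "[int (2 * h + 1 - j) ^ k = (- int j) ^ k] (mod int (2 * h + 1))"
      by (rule cong_pow)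
    thus "[int (2 * h + 1 - j) ^ k = int j ^ k] (mod int (2 * h + 1))"
      using assms(1) by simp
  qed
  also have "(\<Sum>j\<in>{1..<h + 1}. int j ^ k) = power_sum k (h + 1)"
    unfolding power_sum_def using assms(2)
    by (intro sum.mono_neutral_cong_left) (auto simp: Suc_le_eq)
  finally show ?thesis by simp
qed

lemma prime_minus_1_dvd_exponent:
  assumes "prime p" "p dvd n" "\<not>int p dvd power_sum k n"
  shows "(p - 1) dvd k"
proof (rule ccontr)
  assume "\<not>(p - 1) dvd k"
  hence "int p dvd power_sum k p" using power_sum_prime_not_dvd[OF assms(1)] by blast
  moreover obtain w where "n = p * w" using assms(2) by auto
  ultimately have "int p dvd power_sum k n"
    using power_sum_mult_cong[of k p w] by (simp add: cong_dvd_iff)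
  thus False using assms(3) by contradiction
qed

text \<open>
  If \<open>p ^ 2\<close> divided \<open>n\<close>, then \<open>p\<close> would divide \<open>n div p\<close> and hence, by von Staudt, the power sum.
\<close>

lemma multiplicity_eq_1_if_not_dvd_power_sum:
  assumes "prime p" "p dvd n" "n > 0" "even k" "k > 0" "\<not>int p dvd power_sum k n"
  shows "multiplicity p n = 1"
proof (rule ccontr)
  assume "multiplicity p n \<noteq> 1"
  moreover have "multiplicity p n > 0"
    using assms by (simp add: prime_multiplicity_gt_zero_iff)
  ultimately have "multiplicity p n \<ge> 2" by linarith
  hence "p ^ 2 dvd n" using multiplicity_dvd'[of 2 p n] by simp
  then obtain c where "n = p ^ 2 * c" by (elim dvdE)
  hence c: "n = p * (p * c)" by (simp add: power2_eq_square mult.assoc)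
  have "int p dvd - int (n div p)"
    using c assms(1) prime_gt_0_nat[of p] by simp
  moreover have "[power_sum k n = - int (n div p)] (mod int p)"
    using power_sum_cong_neg_div_prime[of p k n] prime_minus_1_dvd_exponent[OF assms(1,2,6)] assms
      cong_dvd_modulus[of _ _ "int p ^ multiplicity p n" "int p"] \<open>multiplicity p n > 0\<close>
    by (meson dvd_power)
  ultimately show False using assms(6) by (simp add: cong_dvd_iff)
qed

lemma moser_integrality_squarefree:
  assumes "n > 0" "even k" "k > 0"
    and "\<And>p. prime p \<Longrightarrow> p dvd n \<Longrightarrow> (p - 1) dvd k \<Longrightarrow> [power_sum k n = c] (mod int p)"
    and "\<And>p. prime p \<Longrightarrow> p dvd n \<Longrightarrow> \<not>int p dvd power_sum k n"
  shows "(\<Sum>p\<in>prime_factors n. 1 / real p) + real_of_int c / real n \<in> \<int>"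
proof (rule moser_integrality[OF assms(1-3)])
  fix p assume p: "prime p" "p dvd n"
  have "multiplicity p n = 1"
    using p assms by (intro multiplicity_eq_1_if_not_dvd_power_sum[of p n k]) auto
  thus "(p - 1) dvd k \<and> [power_sum k n = c] (mod int p ^ multiplicity p n)"
    using prime_minus_1_dvd_exponent[of p n k] p assms by simp
qed

text \<open>
  Here \<open>p\<close> divides the power sum at \<open>m + 2\<close>, so \<open>2 ^ (k + 1)\<close> is \<open>-1\<close> modulo \<open>p\<close>.  The order of \<open>2\<close> is
  therefore \<open>2 u\<close> with \<open>k + 1\<close> an odd multiple of \<open>u\<close>, which is the congruence for \<open>k\<close>; and \<open>u\<close>,
  being a divisor of \<open>k + 1\<close>, is coprime to \<open>N\<close>, which divides \<open>k\<close>.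
\<close>

lemma special_prime_divisorI:
  assumes k: "power_sum k m = int m ^ k" "even k" "N dvd int k" "even N"
    and p: "prime p" "p > 3" "p dvd m + 2" "\<not>(p - 1) dvd k"
  shows "special_prime_divisor N m k p"
proof -
  obtain w where w: "m + 2 = p * w" using p by auto
  have "int p dvd power_sum k (m + 2)"
    using power_sum_mult_cong[of k p w] power_sum_prime_not_dvd[OF p(1,4)] w by (simp add: cong_dvd_iff)
  hence "int p dvd 2 * int m ^ k + (int m + 1) ^ k"
    using k by (simp add: power_sum_Suc numeral_2_eq_2 add.commute)
  also have "int p dvd 2 * int m ^ k + (int m + 1) ^ k \<longleftrightarrow> int p dvd 2 * (-2) ^ k + (-1) ^ k"
  proof (intro cong_dvd_iff cong_add cong_scalar_left cong_pow)
    have "int p dvd int (m + 2)" using p(3) by (simp only: int_dvd_int_iff)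
    thus "[int m = - 2] (mod int p)" "[int m + 1 = - 1] (mod int p)"
      by (simp_all add: cong_iff_dvd_diff add.commute)
  qed
  finally have dvd: "int p dvd 2 ^ (k + 1) + 1" using k(2) by simp
  have cop: "odd p" using p prime_odd_nat[of p] by simp
  define t where "t = ord p 2"
  have "int p dvd (2 ^ (k + 1) + 1) * (2 ^ (k + 1) - 1)" using dvd by (rule dvd_mult2)
  hence "int p dvd 2 ^ (2 * (k + 1)) - 1"
    by (simp add: algebra_simps power_add power2_eq_square power_mult)
  hence "[int (2 ^ (2 * (k + 1))) = int 1] (mod int p)" by (simp add: cong_iff_dvd_diff)
  hence t1: "t dvd 2 * (k + 1)" unfolding t_def ord_divides [symmetric] by (simp only: cong_int_iff)
  have t2: "\<not>t dvd k + 1"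
  proof
    assume "t dvd k + 1"
    hence "[2 ^ (k + 1) = 1] (mod p)" by (simp only: t_def ord_divides)
    hence "[int (2 ^ (k + 1)) = int 1] (mod int p)" by (simp only: cong_int_iff)
    hence "int p dvd 2 ^ (k + 1) - 1" by (simp add: cong_iff_dvd_diff)
    hence "int p dvd (2 ^ (k + 1) + 1) - (2 ^ (k + 1) - 1)" using dvd by (rule dvd_diff[rotated])
    hence "p dvd 2" by (metis add_diff_cancel_left' diff_diff_eq2 int_dvd_int_iff of_nat_numeral one_add_one add.commute add_diff_eq)
    thus False using p by (auto dest: dvd_imp_le)
  qed
  have "even t" using t1 t2 by (metis coprime_dvd_mult_right_iff coprime_right_2_iff_odd)
  then obtain u where u: "t = 2 * u" by auto
  hence "2 * u dvd 2 * (k + 1)" using t1 by (simp only:)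
  hence "u dvd k + 1" by (metis nat_mult_dvd_cancel1 zero_less_numeral)
  then obtain v where v: "k + 1 = u * v" by auto
  have "odd v" using t2 u v by auto
  then obtain x where x: "v = 2 * x + 1" by (auto elim: oddE)
  have uodd: "odd u" using v k(2) by (metis even_mult_iff even_plus_one_iff)
  have kc: "int k = int t * int x + (int u - 1)"
  proof -
    have "int (k + 1) = int (u * v)" using v by (simp only:)
    thus ?thesis using x u by (simp add: algebra_simps)
  qed
  have "coprime (int u) N"
  proof (rule coprimeI)
    fix c assume "c dvd int u" "c dvd N"
    hence "c dvd int (k + 1)" "c dvd int k" using v k(3) by (auto intro: dvd_trans simp del: of_nat_add)
    hence "c dvd int (k + 1) - int k" by (rule dvd_diff)
    thus "is_unit c" by simp
  qed
  hence "gcd (int t) N = gcd 2 N" using u by (simp add: gcd_mult_left_right_cancel coprime_commute)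
  also have "\<dots> = 2" using k(4) by (simp add: gcd_proj1_iff)
  finally show ?thesis
    using p kc u by (simp add: special_prime_divisor_def t_def [symmetric] cong_iff_dvd_diff)
qed

text \<open>
  If \<open>m\<close> were even, von Staudt at \<open>p = 2\<close> would make \<open>m / 2\<close> congruent to \<open>- m ^ k\<close>, that is to \<open>0\<close>,
  modulo the exact power of \<open>2\<close> in \<open>m\<close>.
\<close>

lemma odd_solution:
  assumes k: "power_sum k m = int m ^ k" "even k" "k > 0" and m: "m > 0"
  shows "odd m"
proof
  assume "even m"
  define a where "a = multiplicity 2 m"
  have "[power_sum k m = - int (m div 2)] (mod int 2 ^ a)"
    unfolding a_def using k m \<open>even m\<close> power_sum_cong_neg_div_prime[of 2 k m] by simp
  moreover have "2 ^ a dvd m" by (simp add: a_def multiplicity_dvd)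
  hence "2 ^ a dvd m ^ k" using k(3) by (auto intro: dvd_trans dvd_power)
  hence "int (2 ^ a) dvd int (m ^ k)" by (simp only: int_dvd_int_iff)
  hence "[power_sum k m = 0] (mod int 2 ^ a)"
    using k(1) by (simp add: cong_0_iff)
  hence "[0 = power_sum k m] (mod int 2 ^ a)" by (rule cong_sym)
  ultimately have "[0 = - int (m div 2)] (mod int 2 ^ a)" by (rule cong_trans[rotated])
  hence "int 2 ^ a dvd - int (m div 2)" by (meson cong_0_iff cong_sym)
  hence "int (2 ^ a) dvd int (m div 2)" by simp
  hence "2 ^ a dvd m div 2" by (simp only: int_dvd_int_iff)
  hence "2 ^ Suc a dvd m" using \<open>even m\<close> by (auto elim!: evenE)
  hence "Suc a \<le> a" unfolding a_def using m by (intro multiplicity_geI) auto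
  thus False by simp
qed

text \<open>
  The numerators are the residues of the power sums modulo the primes in the five numbers, obtained
  from the equation; for \<open>2 m - 1\<close> and \<open>2 m + 1\<close> they are \<open>2 m ^ k\<close> and \<open>4 m ^ k\<close>, and \<open>m ^ k\<close> is \<open>1\<close> by
  Fermat.  In \<open>m + 2\<close> the prime \<open>3\<close> can occur, and then exactly to the second power,
  because \<open>6\<close> divides \<open>k\<close> and so \<open>2 ^ (k + 1) + 1\<close> is \<open>3\<close> modulo \<open>9\<close>.
\<close>

lemma solution_integrality:
  assumes k: "power_sum k m = int m ^ k" "6 dvd k" "k > 0" and m: "m > 2"
    and special: "\<And>p. prime p \<Longrightarrow> p > 3 \<Longrightarrow> p dvd m + 2 \<Longrightarrow> (p - 1) dvd k"
  shows "(\<Sum>p\<in>prime_factors (m - 1). 1 / real p) + real_of_int 1 / real (m - 1) \<in> \<int>"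
    and "(\<Sum>p\<in>prime_factors (m + 1). 1 / real p) + real_of_int 2 / real (m + 1) \<in> \<int>"
    and "(\<Sum>p\<in>prime_factors (2 * m - 1). 1 / real p) + real_of_int 2 / real (2 * m - 1) \<in> \<int>"
    and "(\<Sum>p\<in>prime_factors (2 * m + 1). 1 / real p) + real_of_int 4 / real (2 * m + 1) \<in> \<int>"
    and "(\<Sum>p\<in>prime_factors (m + 2). 1 / real p) + real_of_int 3 / real (m + 2) \<in> \<int>"
proof -
  have ev: "even k" using k(2) by (auto intro: dvd_trans)
  have odd: "odd m" using odd_solution[of k m] k ev m by simp
  have S1: "power_sum k (m + 1) = 2 * int m ^ k" using k(1) by (simp add: power_sum_Suc)
  have S2: "power_sum k (m + 2) = 2 * int m ^ k + (int m + 1) ^ k"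
    using k(1) by (simp add: power_sum_Suc numeral_2_eq_2 add.commute)
  have not_dvd: "\<not>int p dvd x" if "prime p" "odd p" "[x = 2 ^ e] (mod int p)" for p e and x :: int
  proof
    assume "int p dvd x"
    hence "int p dvd int (2 ^ e)" using that(3) by (simp add: cong_dvd_iff)
    hence "p dvd 2 ^ e" by (simp only: int_dvd_int_iff)
    hence "p dvd 2" using that(1) prime_dvd_power by blast
    hence "p \<le> 2" by (rule dvd_imp_le) simp
    thus False using that prime_ge_2_nat[of p] by simp
  qed

  show "(\<Sum>p\<in>prime_factors (m - 1). 1 / real p) + real_of_int 1 / real (m - 1) \<in> \<int>"
  proof (rule moser_integrality)
    fix p assume p: "prime p" "p dvd m - 1"
    have "power_sum k m = power_sum k (m - 1) + int (m - 1) ^ k"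
      using m power_sum_Suc[of k "m - 1"] by simp
    hence "power_sum k (m - 1) = int m ^ k - int (m - 1) ^ k" using k(1) by simp
    also have "[\<dots> = 1 ^ k - 0 ^ k] (mod int (m - 1))"
      using m by (intro cong_diff cong_pow) (auto simp: cong_iff_dvd_diff of_nat_diff)
    finally have c: "[power_sum k (m - 1) = 1] (mod int (m - 1))" using k by (simp add: zero_power)
    have "int p ^ multiplicity p (m - 1) dvd int (m - 1)"
      by (metis int_dvd_int_iff multiplicity_dvd of_nat_power)
    hence "[power_sum k (m - 1) = 1] (mod int p ^ multiplicity p (m - 1))"
      using c cong_dvd_modulus by blast
    moreover have "[power_sum k (m - 1) = 1] (mod int p)"
      using c p cong_dvd_modulus int_dvd_int_iff by blast
    hence "\<not>int p dvd power_sum k (m - 1)"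
      using p prime_gt_1_nat[of p] by (simp add: cong_dvd_iff)
    hence "(p - 1) dvd k" using p by (intro prime_minus_1_dvd_exponent[of p "m - 1"])
    ultimately show "(p - 1) dvd k \<and> [power_sum k (m - 1) = 1] (mod int p ^ multiplicity p (m - 1))"
      by blast
  qed (use m ev k in auto)

  show "(\<Sum>p\<in>prime_factors (m + 1). 1 / real p) + real_of_int 2 / real (m + 1) \<in> \<int>"
  proof (rule moser_integrality)
    fix p assume p: "prime p" "p dvd m + 1"
    have "[2 * int m ^ k = 2 * (-1) ^ k] (mod int (m + 1))"
      by (intro cong_scalar_left cong_pow) (simp add: cong_iff_dvd_diff add.commute)
    hence c: "[power_sum k (m + 1) = 2] (mod int (m + 1))" using S1 ev by simp
    have "int p ^ multiplicity p (m + 1) dvd int (m + 1)"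
      by (metis int_dvd_int_iff multiplicity_dvd of_nat_power)
    hence "[power_sum k (m + 1) = 2] (mod int p ^ multiplicity p (m + 1))"
      using c cong_dvd_modulus by blast
    moreover have "(p - 1) dvd k"
    proof (cases "p = 2")
      case False
      have "[power_sum k (m + 1) = 2] (mod int p)"
        using c p cong_dvd_modulus int_dvd_int_iff by blast
      hence "\<not>int p dvd power_sum k (m + 1)"
        using p False prime_odd_nat[of p] prime_ge_2_nat[of p] not_dvd[of p _ 1] by simp
      thus ?thesis using p by (intro prime_minus_1_dvd_exponent[of p "m + 1"])
    qed auto
    ultimately show "(p - 1) dvd k \<and> [power_sum k (m + 1) = 2] (mod int p ^ multiplicity p (m + 1))"
      by blast
  qed (use m ev k in auto)

  (* common part of the cases 2 m - 1 and 2 m + 1, where the power sum is 2 m ^ k c modulo n *)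
  have half: "[power_sum k n = 2 * int m ^ k * c] (mod int p) \<Longrightarrow> c \<in> {1, 2} \<Longrightarrow> prime p \<Longrightarrow> p dvd n \<Longrightarrow> odd n \<Longrightarrow>
      coprime m n \<Longrightarrow> \<not>int p dvd power_sum k n \<and> ((p - 1) dvd k \<longrightarrow> [power_sum k n = 2 * c] (mod int p))"
    for n p and c :: int
  proof -
    assume c: "[power_sum k n = 2 * int m ^ k * c] (mod int p)" "c \<in> {1, 2}"
      and p: "prime p" "p dvd n" "odd n" "coprime m n"
    have podd: "odd p" using p by auto
    have pm: "\<not>p dvd m" using p by (metis coprime_common_divisor not_prime_unit)
    have pm': "\<not>int p dvd int m" using pm by (simp only: int_dvd_int_iff) simp
    have "\<not>int p dvd 2 * int m ^ k * c"
    proof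
      assume "int p dvd 2 * int m ^ k * c"
      hence "int p dvd int m ^ k \<or> int p dvd 2 * c"
        using p(1) by (auto simp: prime_dvd_mult_iff)
      moreover have "\<not>int p dvd 2 * c"
        using c(2) not_dvd[OF p(1) podd, of 2 1] not_dvd[OF p(1) podd, of 4 2] by auto
      ultimately show False using pm' p(1) by (auto dest: prime_dvd_power[rotated])
    qed
    hence 1: "\<not>int p dvd power_sum k n" using c(1) by (simp add: cong_dvd_iff)
    have 2: "[power_sum k n = 2 * c] (mod int p)" if "(p - 1) dvd k"
    proof -
      have "[2 * int m ^ k * c = 2 * 1 * c] (mod int p)"
        using power_eq_1_mod_prime[OF p(1) that pm'] by (intro cong_mult cong_refl)
      thus ?thesis using c(1) cong_trans by fastforce
    qed
    from 1 2 show ?thesis by blast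
  qed

  show "(\<Sum>p\<in>prime_factors (2 * m - 1). 1 / real p) + real_of_int 2 / real (2 * m - 1) \<in> \<int>"
  proof -
    define n where "n = 2 * (m - 1) + 1"
    have n: "2 * m - 1 = n" "odd n" using m by (simp_all add: n_def)
    have "coprime m n"
    proof (rule coprimeI)
      fix c assume "c dvd m" "c dvd n"
      hence "c dvd 2 * m - n" by simp
      thus "is_unit c" using m by (simp add: n_def diff_mult_distrib2)
    qed
    moreover have "[power_sum k n = 2 * int m ^ k * 1] (mod int p)" if "p dvd n" for p
    proof -
      have "[power_sum k n = 2 * power_sum k (m - 1 + 1)] (mod int n)"
        unfolding n_def using ev k(3) by (rule power_sum_reflect)
      moreover have "int p dvd int n" using that by (simp only: int_dvd_int_iff)
      ultimately show ?thesis using k(1) m by (auto intro: cong_dvd_modulus)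
    qed
    ultimately show ?thesis
      unfolding n(1) using half[of n 1] n(2) ev k m by (intro moser_integrality_squarefree) (auto simp: n_def)
  qed

  show "(\<Sum>p\<in>prime_factors (2 * m + 1). 1 / real p) + real_of_int 4 / real (2 * m + 1) \<in> \<int>"
  proof -
    define n where "n = 2 * m + 1"
    have n: "odd n" by (simp add: n_def)
    have "coprime m n"
    proof (rule coprimeI)
      fix c assume "c dvd m" "c dvd n"
      hence "c dvd n - 2 * m" by simp
      thus "is_unit c" by (simp add: n_def)
    qed
    moreover have "[power_sum k n = 2 * int m ^ k * 2] (mod int p)" if "p dvd n" for p
    proof -
      have "[power_sum k n = 2 * power_sum k (m + 1)] (mod int n)"
        unfolding n_def using ev k(3) by (rule power_sum_reflect)
      moreover have "int p dvd int n" using that by (simp only: int_dvd_int_iff)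
      ultimately show ?thesis using S1 by (auto intro: cong_dvd_modulus simp: mult.commute)
    qed
    ultimately show ?thesis
      unfolding n_def [symmetric] using half[of n 2] n ev k m
      by (intro moser_integrality_squarefree[of n k 4]) (auto simp: n_def)
  qed

  show "(\<Sum>p\<in>prime_factors (m + 2). 1 / real p) + real_of_int 3 / real (m + 2) \<in> \<int>"
  proof (rule moser_integrality)
    fix p assume p: "prime p" "p dvd m + 2"
    have "odd p" using p odd by (metis dvd_trans even_add even_numeral)
    hence "p \<noteq> 2" by auto
    hence p3: "p \<ge> 3" using prime_ge_2_nat[OF p(1)] by linarith
    have dvd: "(p - 1) dvd k"
    proof (cases "p = 3")
      case True
      thus ?thesis using ev by simp
    next
      case False
      thus ?thesis using special p p3 by simp
    qed
    have c: "[power_sum k (m + 2) = 2 * (-2) ^ k + (-1) ^ k] (mod int (m + 2))"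
      unfolding S2 by (intro cong_add cong_scalar_left cong_pow) (auto simp: cong_iff_dvd_diff add.commute)
    have c': "[power_sum k (m + 2) = 2 * 2 ^ k + 1] (mod x)" if "x dvd int (m + 2)" for x
      using c that ev cong_dvd_modulus by fastforce
    have "int p dvd int (m + 2)" using p(2) by (simp only: int_dvd_int_iff)
    show "(p - 1) dvd k \<and> [power_sum k (m + 2) = 3] (mod int p ^ multiplicity p (m + 2))"
    proof (cases "p = 3")
      case False
      have "\<not>int p dvd int 2"
        using p3 False by (simp only: int_dvd_int_iff) (auto dest: dvd_imp_le)
      hence "[2 ^ k = 1] (mod int p)" using power_eq_1_mod_prime[OF p(1) dvd, of 2] by simp
      hence "[2 * 2 ^ k + 1 = 2 * 1 + 1] (mod int p)" by (intro cong_add cong_scalar_left cong_refl)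
      hence 3: "[power_sum k (m + 2) = 3] (mod int p)"
        using c'[OF \<open>int p dvd int (m + 2)\<close>] cong_trans by fastforce
      have "\<not>int p dvd int 3" using p3 False by (simp only: int_dvd_int_iff) (auto dest: dvd_imp_le)
      hence "multiplicity p (m + 2) = 1"
        using p ev k 3 by (intro multiplicity_eq_1_if_not_dvd_power_sum[of p "m + 2" k]) (auto simp: cong_dvd_iff)
      thus ?thesis using dvd 3 by simp
    next
      case True
      define a where "a = multiplicity 3 (m + 2)"
      have a0: "a > 0" using p True by (simp add: a_def prime_multiplicity_gt_zero_iff)
      have neg: "[power_sum k (m + 2) = - int ((m + 2) div 3)] (mod 3 ^ a)"
        using power_sum_cong_neg_div_prime[of 3 k "m + 2"] p True ev k by (simp add: a_def)
      have div3: "multiplicity 3 ((m + 2) div 3) = a - 1"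
      proof -
        obtain w where w: "m + 2 = 3 * w" using p(2) True by (auto elim: dvdE)
        hence "multiplicity 3 (3 * w) = Suc (multiplicity 3 w)"
          by (intro multiplicity_times_same) auto
        thus ?thesis unfolding a_def w by simp
      qed
      have two: "[2 * 2 ^ k + 1 = (3 :: int)] (mod 9)"
      proof -
        obtain j where "k = 6 * j" using k(2) by auto
        moreover have "[(2 ^ 6) ^ j = (1 :: int) ^ j] (mod 9)" by (intro cong_pow) (simp add: unique_euclidean_semiring_class.cong_def)
        ultimately have "[2 ^ k = (1 :: int)] (mod 9)" by (simp add: power_mult)
        hence "[2 * 2 ^ k + 1 = 2 * (1 :: int) + 1] (mod 9)" by (intro cong_add cong_scalar_left cong_refl)
        thus ?thesis by simp
      qed
      have "a = 2"
      proof (rule ccontr)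
        assume "a \<noteq> 2"
        then consider "a = 1" | "a \<ge> 3" using a0 by linarith
        thus False
        proof cases
          case 1
          have "[power_sum k (m + 2) = 2 * 2 ^ k + 1] (mod 3)"
            using c'[of 3] True \<open>int p dvd int (m + 2)\<close> by simp
          moreover have "[2 * 2 ^ k + 1 = (3 :: int)] (mod 3)"
            using two by (rule cong_dvd_modulus) simp
          ultimately have "3 dvd power_sum k (m + 2)" using cong_trans cong_dvd_iff by (metis dvd_refl)
          hence "int 3 dvd int ((m + 2) div 3)" using neg 1 by (simp add: cong_dvd_iff)
          hence "3 dvd (m + 2) div 3" by (simp only: int_dvd_int_iff)
          hence "multiplicity 3 ((m + 2) div 3) > 0"
            using m by (subst prime_multiplicity_gt_zero_iff) auto
          thus False using div3 1 by simp
        next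
          case 2
          have "3 ^ 2 dvd (3::nat) ^ a" using 2 by (intro le_imp_power_dvd) auto
          hence "3 ^ 2 dvd m + 2" using multiplicity_dvd[of 3 "m + 2"] by (auto simp: a_def intro: dvd_trans)
          hence "int 9 dvd int (m + 2)" by (simp only: int_dvd_int_iff) simp
          hence "[power_sum k (m + 2) = 2 * 2 ^ k + 1] (mod 9)" using c'[of 9] by simp
          hence "[power_sum k (m + 2) = 3] (mod 9)" using two by (rule cong_trans)
          moreover have "[power_sum k (m + 2) = - int ((m + 2) div 3)] (mod 9)"
            by (rule cong_dvd_modulus[OF neg]) (use le_imp_power_dvd[of 2 a "3::int"] 2 in simp)
          moreover have "3 ^ 2 dvd (m + 2) div 3"
            using multiplicity_dvd'[of 2 3 "(m + 2) div 3"] div3 2 by simp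
          hence "int 9 dvd int ((m + 2) div 3)" by (simp only: int_dvd_int_iff) simp
          ultimately have "(9::int) dvd 3" by (metis cong_dvd_iff dvd_minus_iff of_nat_numeral)
          thus False by simp
        qed
      qed
      have "3 ^ 2 dvd m + 2" using multiplicity_dvd[of 3 "m + 2"] \<open>a = 2\<close> by (simp add: a_def)
      hence "int 9 dvd int (m + 2)" by (simp only: int_dvd_int_iff) simp
      hence "[power_sum k (m + 2) = 2 * 2 ^ k + 1] (mod 9)" using c'[of 9] by simp
      hence "[power_sum k (m + 2) = 3] (mod 9)" using two by (rule cong_trans)
      thus ?thesis using dvd True \<open>a = 2\<close> by (simp add: a_def)
    qed
  qed (use m ev k in auto)
qed

section \<open>Logarithmic averages of the von Mangoldt function\<close>

text \<open>
  The identity \<open>ln j = (\<Sum>d | d dvd j. \<Lambda>(d))\<close> summed with arbitrary weights.  Weight \<open>1\<close> gives the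
  factorial and the floor function, weight \<open>1 / j\<close> the harmonic numbers.
\<close>

lemma sum_weighted_ln_eq_sum_mangoldt:
  fixes g :: "nat \<Rightarrow> real"
  shows "(\<Sum>j = 1..n. g j * ln (real j)) =
         (\<Sum>d = 1..n. mangoldt d * (\<Sum>i = 1..n div d. g (d * i)))"
proof -
  have "(\<Sum>j = 1..n. g j * ln (real j)) = (\<Sum>j = 1..n. \<Sum>d | d dvd j. mangoldt d * g j)"
  proof (intro sum.cong refl)
    fix j assume "j \<in> {1..n}"
    hence "ln (real j) = (\<Sum>d | d dvd j. mangoldt d)"
      using mangoldt_sum[of j, where 'a = real] by simp
    thus "g j * ln (real j) = (\<Sum>d | d dvd j. mangoldt d * g j)"
      by (simp add: sum_distrib_left mult.commute)
  qed
  also have "\<dots> = (\<Sum>(j, d) \<in> (SIGMA j:{1..n}. {d. d dvd j}). mangoldt d * g j)"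
    by (subst sum.Sigma) auto
  also have "\<dots> = (\<Sum>(d, i) \<in> (SIGMA d:{1..n}. {1..n div d}). mangoldt d * g (d * i))"
  proof (rule sum.reindex_bij_witness[of _ "\<lambda>(d, i). (d * i, d)" "\<lambda>(j, d). (d, j div d)"], goal_cases)
    case (4 b)
    then obtain d i where b: "b = (d, i)" and d: "1 \<le> d" "d \<le> n" "1 \<le> i" "i \<le> n div d"
      by auto
    hence "d * i \<le> n"
      by (simp add: less_eq_div_iff_mult_less_eq mult.commute)
    thus ?case using b d by auto
  next
    case (2 a)
    then obtain d i where a: "a = (d * i, d)" and d: "1 \<le> d" "1 \<le> i" "d * i \<le> n"
      by (auto elim!: dvdE)
    have "d * 1 \<le> d * i" using d by (intro mult_left_mono) auto
    hence "d \<le> n" using d(3) by linarith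
    moreover have "i \<le> n div d"
      using d by (simp add: less_eq_div_iff_mult_less_eq mult.commute)
    ultimately show ?case using a d by auto
  qed auto
  also have "\<dots> = (\<Sum>d = 1..n. mangoldt d * (\<Sum>i = 1..n div d. g (d * i)))"
    by (subst sum.Sigma [symmetric]) (auto simp: sum_distrib_left)
  finally show ?thesis .
qed

lemma ln_fact_eq_sum_mangoldt:
  "ln (fact n) = (\<Sum>d = 1..n. mangoldt d * real (n div d))"
proof -
  have "ln (fact n :: real) = (\<Sum>j = 1..n. ln (real j))"
    unfolding fact_prod by (subst of_nat_prod, subst ln_prod) auto
  thus ?thesis
    using sum_weighted_ln_eq_sum_mangoldt[of "\<lambda>_. 1" n] by simp
qed

lemma sum_ln_over_eq_sum_mangoldt:
  "(\<Sum>j = 1..n. ln (real j) / real j) = (\<Sum>d = 1..n. mangoldt d / real d * harm (n div d))"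
  using sum_weighted_ln_eq_sum_mangoldt[of "\<lambda>j. 1 / real j" n]
  by (simp add: harm_def sum_distrib_left field_simps)

lemma ln_2_le: "ln (2::real) \<le> 69315 / 100000" and ln_2_ge: "ln (2::real) \<ge> 6931 / 10000"
  using ln_approx_bounds[of 2 4] by (simp_all add: eval_nat_numeral)
lemma ln_3_le: "ln (3::real) \<le> 109863 / 100000" and ln_3_ge: "ln (3::real) \<ge> 10986 / 10000"
  using ln_approx_bounds[of 3 7] by (simp_all add: eval_nat_numeral)
lemma ln_5_le: "ln (5::real) \<le> 16095 / 10000" and ln_5_ge: "ln (5::real) \<ge> 16094 / 10000"
  using ln_approx_bounds[of 5 10] by (simp_all add: eval_nat_numeral)
lemma ln_7_le: "ln (7::real) \<le> 1946 / 1000"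
  using ln_approx_bounds[of 7 10] by (simp_all add: eval_nat_numeral)

text \<open>
  The constant \<open>23/40\<close> approximates Euler's constant \<open>\<gamma> = 0.5772...\<close> from below.  For \<open>n \<ge> 7\<close> the claim
  follows from \<open>harm n - ln (n + 1) \<ge> \<gamma> - 1 / (2 n)\<close>, and the remaining cases are numerical.
\<close>

lemma harm_minus_ln_ge:
  assumes "n \<ge> 1"
  shows "ln (real (n + 1)) \<le> harm n - 23 / 40 * n / (n + 1)"
proof (cases "n \<ge> 7")
  case True
  have "23 / 40 < (euler_mascheroni :: real)"
    using euler_mascheroni_gt_19_over_33 by simp
  also have "\<dots> \<le> harm n - ln (real (n + 1)) + 1 / (2 * n)"
    using euler_mascheroni_upper[of "n - 1"] assms by (simp add: add.commute)
  finally have "ln (real (n + 1)) \<le> harm n + 1 / (2 * n) - 23 / 40" by simp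
  moreover have "1 / (2 * real n) - 23 / 40 \<le> - (23 / 40 * n / (n + 1))"
    using True by (simp add: field_simps)
  ultimately show ?thesis by (simp only: of_nat_add of_nat_1 of_nat_mult of_nat_numeral)
next
  case False
  have ln4: "ln (4::real) = 2 * ln 2" and ln6: "ln (6::real) = ln 2 + ln 3"
    using ln_mult[of "2::real" 2] ln_mult[of "2::real" 3] by simp_all
  from False assms have "n \<in> {1,2,3,4,5,6}" by auto
  thus ?thesis
    using ln_2_le ln_3_le ln_5_le ln_7_le ln4 ln6 by (auto simp: harm_expand)
qed

text \<open>
  The pointwise majorant behind the whole estimate: with \<open>n\<close> the integer part of \<open>u\<close>, the function
  \<open>harm n - \<gamma> * n / u\<close> lies above \<open>ln u\<close> and differs from it by \<open>O(1 / u)\<close>; here \<open>23/40\<close> stands for \<open>\<gamma>\<close>.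
  Between integers the difference decreases, so the right end points decide.
\<close>

lemma ln_le_harm_minus:
  fixes u :: real
  assumes "n \<ge> 1" "real n \<le> u" "u \<le> real n + 1"
  shows "ln u \<le> harm n - 23 / 40 * n / u"
proof -
  define \<phi> where "\<phi> = (\<lambda>u. harm n - 23 / 40 * n / u - ln u)"
  have "\<phi> (real n + 1) \<le> \<phi> u"
  proof (rule DERIV_nonpos_imp_nonincreasing[OF assms(3)])
    fix x assume x: "u \<le> x" "x \<le> real n + 1"
    hence "x > 0" using assms by linarith
    hence "(\<phi> has_real_derivative (23 / 40 * n - x) / x\<^sup>2) (at x)"
      unfolding \<phi>_def by (auto intro!: derivative_eq_intros simp: field_simps power2_eq_square)
    moreover have "(23 / 40 * n - x) / x\<^sup>2 \<le> 0"
      using x assms by (intro divide_nonpos_nonneg) auto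
    ultimately show "\<exists>y. (\<phi> has_real_derivative y) (at x) \<and> y \<le> 0" by blast
  qed
  moreover have "\<phi> (real n + 1) \<ge> 0"
    using harm_minus_ln_ge[OF assms(1)] by (simp add: \<phi>_def add.commute)
  ultimately show ?thesis by (simp add: \<phi>_def)
qed

text \<open>
  Both terms on the right are sums over \<open>d\<close> of \<open>\<Lambda>(d)\<close> with harmonic or floor weights, so the claim
  is \<open>ln_le_harm_minus\<close> at \<open>u = x / d\<close>, summed against \<open>\<Lambda>(d) / d\<close>.
\<close>

lemma sum_mangoldt_ln_le:
  fixes x :: real
  assumes "x \<ge> 1" and n: "n = nat \<lfloor>x\<rfloor>"
  shows "(\<Sum>d = 1..n. mangoldt d / d * ln (x / d)) \<le>
         (\<Sum>j = 1..n. ln (real j) / real j) - 23 / 40 * ln (fact n) / x"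
proof -
  have "(\<Sum>d = 1..n. mangoldt d / d * ln (x / d)) \<le>
        (\<Sum>d = 1..n. mangoldt d / d * harm (n div d) - 23 / 40 / x * (mangoldt d * real (n div d)))"
  proof (rule sum_mono)
    fix d assume d: "d \<in> {1..n}"
    have fl: "nat \<lfloor>x / d\<rfloor> = n div d"
      unfolding n using assms floor_divide_real_eq_div[of "int d" x]
      by (simp add: nat_div_distrib)
    have "ln (x / d) \<le> harm (n div d) - 23 / 40 * (n div d) / (x / d)"
    proof (rule ln_le_harm_minus)
      show "n div d \<ge> 1" using d by (simp add: Suc_le_eq div_greater_zero_iff)
      show "real (n div d) \<le> x / d"
        unfolding fl [symmetric] using assms by simp
      show "x / d \<le> real (n div d) + 1"
        unfolding fl [symmetric] using assms by (simp; linarith)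
    qed
    hence "mangoldt d / d * ln (x / d) \<le> mangoldt d / d * (harm (n div d) - 23 / 40 * (n div d) / (x / d))"
      by (intro mult_left_mono) (auto simp: mangoldt_nonneg)
    also have "\<dots> = mangoldt d / d * harm (n div d) - 23 / 40 / x * (mangoldt d * real (n div d))"
      using d assms by (simp add: field_simps)
    finally show "mangoldt d / d * ln (x / d) \<le> \<dots>" .
  qed
  also have "\<dots> = (\<Sum>j = 1..n. ln (real j) / real j) - 23 / 40 * ln (fact n) / x"
    unfolding sum_subtractf sum_ln_over_eq_sum_mangoldt ln_fact_eq_sum_mangoldt
      sum_distrib_left [symmetric] by simp
  finally show ?thesis .
qed

lemma ln_le_minus_one_over:
  assumes "n \<ge> 2"
  shows "1 / real n \<le> ln (real n) - ln (real (n - 1))"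
proof -
  have "ln (real (n - 1)) - ln (real n) = ln (1 - 1 / real n)"
    using assms ln_div[of "real (n - 1)" "real n"] by (simp add: field_simps of_nat_diff)
  also have "\<dots> \<le> - 1 / real n"
    using ln_le_minus_one[of "1 - 1 / real n"] assms by simp
  finally show ?thesis by simp
qed

lemma ln_over_antimono:
  fixes x y :: real
  assumes "exp 1 \<le> x" "x \<le> y"
  shows "ln y / y \<le> ln x / x"
proof (rule DERIV_nonpos_imp_nonincreasing[OF assms(2)])
  fix z assume z: "x \<le> z" "z \<le> y"
  have pos: "z > 0" using z assms exp_gt_zero[of "1::real"] by linarith
  have "((\<lambda>z. ln z / z) has_real_derivative (1 - ln z) / z\<^sup>2) (at z)"
    using pos by (auto intro!: derivative_eq_intros simp: field_simps power2_eq_square)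
  moreover have "ln z \<ge> ln (exp 1)"
    using z assms pos by (subst ln_le_cancel_iff) auto
  hence "(1 - ln z) / z\<^sup>2 \<le> 0" by (intro divide_nonpos_nonneg) auto
  ultimately show "\<exists>w. ((\<lambda>z. ln z / z) has_real_derivative w) (at z) \<and> w \<le> 0" by blast
qed

text \<open>
  The derivative of \<open>(ln x)\<^sup>2 / 2\<close> is \<open>ln x / x\<close>, which decreases from \<open>e\<close> on.  The constant is the value
  of the difference at \<open>n = 3\<close>, rounded up.
\<close>

lemma sum_ln_over_le:
  assumes "n \<ge> 3"
  shows "(\<Sum>j = 1..n. ln (real j) / real j) \<le> (ln n)\<^sup>2 / 2 + 1094 / 10000"
  using assms
proof (induction n rule: dec_induct)
  case base
  have "10986 / 10000 * (10986 / 10000) \<le> (ln (3::real))\<^sup>2"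
    unfolding power2_eq_square using ln_3_ge by (intro mult_mono) auto
  moreover have "(\<Sum>j = 1..3. ln (real j) / real j) = ln 2 / 2 + ln 3 / 3"
    by (simp add: eval_nat_numeral)
  ultimately show ?case using ln_2_le ln_3_le by simp
next
  case (step n)
  have n: "n \<ge> 3" by fact
  obtain z where z: "real n < z" "z < real (Suc n)"
    and diff: "(ln (real (Suc n)))\<^sup>2 / 2 - (ln (real n))\<^sup>2 / 2 = ln z / z"
  proof -
    have "\<exists>z. real n < z \<and> z < real (Suc n) \<and>
        (ln (real (Suc n)))\<^sup>2 / 2 - (ln (real n))\<^sup>2 / 2 = (real (Suc n) - real n) * (ln z / z)"
      using n by (intro MVT2) (auto intro!: derivative_eq_intros simp: field_simps)
    thus ?thesis using that by auto
  qed
  have "ln (real (Suc n)) / real (Suc n) \<le> ln z / z"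
    using z n exp_le by (intro ln_over_antimono) auto
  thus ?case using step.IH diff by simp
qed

lemma ln_fact_le:
  assumes "n \<ge> 1"
  shows "ln (fact n :: real) \<le> n * ln n - n + ln n + 1"
  using assms
proof (induction n rule: dec_induct)
  case base
  thus ?case by simp
next
  case (step n)
  have "1 / real (Suc n) \<le> ln (real (Suc n)) - ln (real n)"
    using ln_le_minus_one_over[of "Suc n"] step by simp
  hence "1 \<le> real (Suc n) * (ln (real (Suc n)) - ln (real n))"
    by (simp add: field_simps)
  moreover have "ln (fact (Suc n) :: real) = ln (real (Suc n)) + ln (fact n)"
    by (simp add: ln_mult del: of_nat_Suc)
  ultimately show ?case using step.IH
    by (simp add: algebra_simps)
qed

lemma ln_fact_ge: "n * ln (n + 1) - n \<le> ln (fact n :: real)"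
proof (induction n)
  case (Suc n)
  have "ln (real n + 2) - ln (real n + 1) = ln (1 + 1 / (real n + 1))"
    using ln_div[of "real n + 2" "real n + 1"] by (simp add: field_simps)
  also have "\<dots> \<le> 1 / (real n + 1)"
    by (rule ln_add_one_self_le_self) simp
  finally have "(real n + 1) * (ln (real n + 2) - ln (real n + 1)) \<le> 1"
    by (simp add: field_simps)
  moreover have "ln (fact (Suc n) :: real) = ln (real n + 1) + ln (fact n)"
    by (simp add: ln_mult add.commute)
  ultimately show ?case using Suc.IH
    by (simp add: algebra_simps)
qed auto

text \<open>
  The slack \<open>ln x\<close> pays for the passage from \<open>x\<close> to its integer part.
\<close>

lemma ln_fact_floor_ge:
  fixes x :: real
  assumes "x \<ge> 2" and n: "n = nat \<lfloor>x\<rfloor>"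
  shows "x * ln x - x - ln x \<le> ln (fact n)"
proof -
  define g where "g = (\<lambda>x::real. x * ln x - x - ln x)"
  have "g x \<le> g (real n + 1)"
  proof (rule DERIV_nonneg_imp_nondecreasing[where f = g])
    show "x \<le> real n + 1" using assms by linarith
    fix y assume y: "x \<le> y" "y \<le> real n + 1"
    hence "y \<ge> 2" using assms by linarith
    hence "(g has_real_derivative (ln y - 1 / y)) (at y)"
      unfolding g_def by (auto intro!: derivative_eq_intros simp: field_simps)
    moreover have "ln y \<ge> ln 2" "1 / y \<le> 1 / 2" using \<open>y \<ge> 2\<close> by (auto simp: field_simps)
    hence "ln y - 1 / y \<ge> 0" using ln_2_ge by linarith
    ultimately show "\<exists>z. (g has_real_derivative z) (at y) \<and> z \<ge> 0" by blast
  qed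
  also have "g (real n + 1) = n * ln (n + 1) - n - 1"
    by (simp add: g_def algebra_simps)
  also have "\<dots> \<le> ln (fact n)" using ln_fact_ge[of n] by (simp add: add.commute)
  finally show ?thesis by (simp add: g_def)
qed

text \<open>
  The left-hand side is the integral of the sums of \<open>\<Lambda>(d) / d\<close> against \<open>dt / t\<close> up to \<open>x\<close>.  Its
  expansion begins with \<open>(ln x)\<^sup>2 / 2 - \<gamma> ln x\<close>, so that this upper bound is sharp up to the
  approximation of \<open>\<gamma>\<close> and the constant term.
\<close>

lemma sum_mangoldt_ln_le_quadratic:
  fixes x :: real
  assumes "x \<ge> 1024" and n: "n = nat \<lfloor>x\<rfloor>"
  shows "(\<Sum>d = 1..n. mangoldt d / d * ln (x / d)) \<le> (ln x)\<^sup>2 / 2 - 23 / 40 * ln x + 689 / 1000"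
proof -
  have n3: "n \<ge> 3" and nx: "real n \<le> x" using assms by linarith+
  have "ln x / x \<le> ln 1024 / 1024"
    using assms exp_le by (intro ln_over_antimono) auto
  moreover have "ln (1024::real) = 10 * ln 2"
    using ln_realpow[of 2 10] by simp
  ultimately have lx: "ln x / x \<le> 68 / 10000" using ln_2_le by simp
  have "(\<Sum>d = 1..n. mangoldt d / d * ln (x / d)) \<le>
         (\<Sum>j = 1..n. ln (real j) / real j) - 23 / 40 * ln (fact n) / x"
    using assms by (intro sum_mangoldt_ln_le) auto
  moreover have "(\<Sum>j = 1..n. ln (real j) / real j) \<le> (ln n)\<^sup>2 / 2 + 1094 / 10000"
    using n3 by (rule sum_ln_over_le)
  moreover have "(ln n)\<^sup>2 \<le> (ln x)\<^sup>2"
    using n3 nx by (intro power_mono) auto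
  moreover have "23 / 40 * (x * ln x - x - ln x) / x \<le> 23 / 40 * ln (fact n) / x"
    using assms by (intro divide_right_mono mult_left_mono ln_fact_floor_ge) auto
  moreover have "23 / 40 * (x * ln x - x - ln x) / x = 23 / 40 * ln x - 23 / 40 - 23 / 40 * (ln x / x)"
    using assms by (simp add: field_simps)
  ultimately show ?thesis using lx by linarith
qed

text \<open>
  This follows from \<open>n / d \<le> n div d + 1\<close>.  The term with the sum of \<open>\<Lambda>\<close> is kept, because
  it later cancels against the cost of the constraint on the logarithms.
\<close>

lemma sum_mangoldt_over_le:
  assumes "n \<ge> 1"
  shows "(\<Sum>d = 1..n. mangoldt d / d) \<le> ln n - 1 + (ln n + 1) / n + (\<Sum>d = 1..n. mangoldt d) / n"
proof -
  have "(\<Sum>d = 1..n. mangoldt d / d) \<le> (\<Sum>d = 1..n. mangoldt d * real (n div d) / n + mangoldt d / n)"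
  proof (rule sum_mono)
    fix d assume d: "d \<in> {1..n}"
    have "real n / d \<le> real (n div d) + 1"
      using floor_divide_of_nat_eq[of n d, where ?'a = real] by linarith
    hence "mangoldt d / n * (real n / d) \<le> mangoldt d / n * (real (n div d) + 1)"
      by (intro mult_left_mono) (auto simp: mangoldt_nonneg)
    thus "mangoldt d / d \<le> mangoldt d * real (n div d) / n + mangoldt d / n"
      using d by (simp add: field_simps)
  qed
  also have "\<dots> = ln (fact n) / n + (\<Sum>d = 1..n. mangoldt d) / n"
    by (simp add: sum.distrib ln_fact_eq_sum_mangoldt sum_divide_distrib)
  also have "ln (fact n) / n \<le> (n * ln n - n + ln n + 1) / n"
    using assms by (intro divide_right_mono ln_fact_le) auto
  also have "\<dots> = ln n - 1 + (ln n + 1) / n"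
    using assms by (simp add: field_simps)
  finally show ?thesis by simp
qed

text \<open>
  Taylor's formula for \<open>1 / s\<close>: the reciprocal at \<open>l\<close> is its first-order expansion at the upper end
  \<open>S\<close> plus the integral of the kinks \<open>max 0 (s - l)\<close> against the second derivative \<open>2 / s ^ 3\<close>.  For
  \<open>l\<close> below the lower end \<open>s\<^sub>0\<close> one obtains the tangent of \<open>1 / s\<close> at \<open>s\<^sub>0\<close> instead.
\<close>

lemma has_integral_kink:
  fixes l s\<^sub>0 S :: real
  assumes "0 < s\<^sub>0" "s\<^sub>0 \<le> S" "0 \<le> l" "l \<le> S"
  shows "((\<lambda>s. max 0 (s - l) * (2 / s ^ 3)) has_integral
           (if l \<le> s\<^sub>0 then 2 / s\<^sub>0 - l / s\<^sub>0\<^sup>2 else 1 / l) - (2 / S - l / S\<^sup>2)) {s\<^sub>0..S}"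
proof -
  define F where "F = (\<lambda>s::real. l / s\<^sup>2 - 2 / s)"
  have F: "((\<lambda>s. (s - l) * (2 / s ^ 3)) has_integral F S - F a) {a..S}" if "0 < a" "a \<le> S" for a
  proof (rule fundamental_theorem_of_calculus[OF that(2)])
    fix s assume "s \<in> {a..S}"
    hence "s > 0" using that by auto
    hence "(F has_real_derivative (s - l) * (2 / s ^ 3)) (at s within {a..S})"
      unfolding F_def by (auto intro!: derivative_eq_intros simp: field_simps power2_eq_square power3_eq_cube)
    thus "(F has_vector_derivative (s - l) * (2 / s ^ 3)) (at s within {a..S})"
      by (simp add: has_real_derivative_iff_has_vector_derivative)
  qed
  show ?thesis
  proof (cases "l \<le> s\<^sub>0")
    case True
    have "((\<lambda>s. max 0 (s - l) * (2 / s ^ 3)) has_integral F S - F s\<^sub>0) {s\<^sub>0..S}"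
      by (rule has_integral_eq[OF _ F]) (use assms True in auto)
    moreover have "F S - F s\<^sub>0 = 2 / s\<^sub>0 - l / s\<^sub>0\<^sup>2 - (2 / S - l / S\<^sup>2)"
      by (simp add: F_def)
    ultimately show ?thesis using True by simp
  next
    case False
    have "((\<lambda>s. max 0 (s - l) * (2 / s ^ 3)) has_integral F S - F l) {l..S}"
      by (rule has_integral_eq[OF _ F]) (use assms False in auto)
    moreover have "((\<lambda>s. max 0 (s - l) * (2 / s ^ 3)) has_integral 0) {s\<^sub>0..l}"
      by (rule has_integral_is_0) auto
    ultimately have "((\<lambda>s. max 0 (s - l) * (2 / s ^ 3)) has_integral 0 + (F S - F l)) {s\<^sub>0..S}"
      using assms False by (intro has_integral_combine[where c = l]) auto
    moreover have "0 + (F S - F l) = 1 / l - (2 / S - l / S\<^sup>2)"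
      using assms False by (simp add: F_def power2_eq_square field_simps)
    ultimately show ?thesis using False by simp
  qed
qed

text \<open>
  The weights are integrals of kinks at \<open>ln d\<close> by \<open>has_integral_kink\<close>, so the sum is the integral of
  the logarithmic averages of \<open>\<Lambda>(d) / d\<close>, which are bounded by
  \<open>sum_mangoldt_ln_le_quadratic\<close>.
\<close>

lemma sum_mangoldt_kernel_le:
  fixes n N :: nat and s\<^sub>0 S :: real
  assumes "1024 \<le> N" "N \<le> n"
  defines "s\<^sub>0 \<equiv> ln (real N)" and "S \<equiv> ln (real n)"
  shows "(\<Sum>d = 1..n. mangoldt d / d * ((if d \<le> N then 2 / s\<^sub>0 - ln d / s\<^sub>0\<^sup>2 else 1 / ln d)
            - (2 / S - ln d / S\<^sup>2)))
         \<le> ln S - ln s\<^sub>0 - 23 / 20 * (1 / s\<^sub>0 - 1 / S) + 689 / 1000 * (1 / s\<^sub>0\<^sup>2 - 1 / S\<^sup>2)"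
proof (rule has_integral_le)
  have s0: "0 < s\<^sub>0" and S: "s\<^sub>0 \<le> S"
    using assms by (auto simp: s\<^sub>0_def S_def)
  show "((\<lambda>s. \<Sum>d = 1..n. mangoldt d / d * (max 0 (s - ln d) * (2 / s ^ 3))) has_integral
          (\<Sum>d = 1..n. mangoldt d / d * ((if d \<le> N then 2 / s\<^sub>0 - ln d / s\<^sub>0\<^sup>2 else 1 / ln d)
            - (2 / S - ln d / S\<^sup>2)))) {s\<^sub>0..S}"
  proof (intro has_integral_sum has_integral_mult_right)
    fix d assume d: "d \<in> {1..n}"
    have "((\<lambda>s. max 0 (s - ln d) * (2 / s ^ 3)) has_integral
            (if ln d \<le> s\<^sub>0 then 2 / s\<^sub>0 - ln d / s\<^sub>0\<^sup>2 else 1 / ln d) - (2 / S - ln d / S\<^sup>2)) {s\<^sub>0..S}"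
      using d s0 S by (intro has_integral_kink) (auto simp: S_def)
    moreover have "ln (real d) \<le> s\<^sub>0 \<longleftrightarrow> d \<le> N"
      using d assms by (simp add: s\<^sub>0_def)
    ultimately show "((\<lambda>s. max 0 (s - ln d) * (2 / s ^ 3)) has_integral
            (if d \<le> N then 2 / s\<^sub>0 - ln d / s\<^sub>0\<^sup>2 else 1 / ln d) - (2 / S - ln d / S\<^sup>2)) {s\<^sub>0..S}"
      by simp
  qed auto
  define F where "F = (\<lambda>s::real. ln s + 23 / 20 / s - 689 / 1000 / s\<^sup>2)"
  have "((\<lambda>s. (s\<^sup>2 / 2 - 23 / 40 * s + 689 / 1000) * (2 / s ^ 3)) has_integral (F S - F s\<^sub>0)) {s\<^sub>0..S}"
  proof (rule fundamental_theorem_of_calculus[OF S])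
    fix s assume "s \<in> {s\<^sub>0..S}"
    hence "s > 0" using s0 by auto
    hence "(F has_real_derivative (s\<^sup>2 / 2 - 23 / 40 * s + 689 / 1000) * (2 / s ^ 3)) (at s within {s\<^sub>0..S})"
      unfolding F_def by (auto intro!: derivative_eq_intros simp: field_simps power2_eq_square power3_eq_cube)
    thus "(F has_vector_derivative (s\<^sup>2 / 2 - 23 / 40 * s + 689 / 1000) * (2 / s ^ 3)) (at s within {s\<^sub>0..S})"
      by (simp add: has_real_derivative_iff_has_vector_derivative)
  qed
  also have "F S - F s\<^sub>0 = ln S - ln s\<^sub>0 - 23 / 20 * (1 / s\<^sub>0 - 1 / S) + 689 / 1000 * (1 / s\<^sub>0\<^sup>2 - 1 / S\<^sup>2)"
    by (simp add: F_def right_diff_distrib)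
  finally show "((\<lambda>s. (s\<^sup>2 / 2 - 23 / 40 * s + 689 / 1000) * (2 / s ^ 3)) has_integral
     ln S - ln s\<^sub>0 - 23 / 20 * (1 / s\<^sub>0 - 1 / S) + 689 / 1000 * (1 / s\<^sub>0\<^sup>2 - 1 / S\<^sup>2)) {s\<^sub>0..S}" .
  fix s assume s: "s \<in> {s\<^sub>0..S}"
  define m where "m = nat \<lfloor>exp s\<rfloor>"
  have es: "real N \<le> exp s" "exp s \<le> real n"
  proof -
    have "exp s\<^sub>0 \<le> exp s" "exp s \<le> exp S" using s by auto
    thus "real N \<le> exp s" "exp s \<le> real n" using assms by (auto simp: s\<^sub>0_def S_def)
  qed
  have mn: "m \<le> n" using es(2) unfolding m_def by linarith
  have "(\<Sum>d = 1..n. mangoldt d / d * max 0 (s - ln d)) = (\<Sum>d = 1..m. mangoldt d / d * ln (exp s / d))"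
  proof (rule sum.mono_neutral_cong_right)
    show "\<forall>d\<in>{1..n} - {1..m}. mangoldt d / real d * max 0 (s - ln (real d)) = 0"
    proof
      fix d assume d: "d \<in> {1..n} - {1..m}"
      hence "exp s < real d" unfolding m_def by (auto; linarith)
      hence "s < ln (real d)" using d by (metis DiffD1 atLeastAtMost_iff exp_less_cancel_iff exp_ln of_nat_0_less_iff zero_less_one order_less_le_trans)
      thus "mangoldt d / real d * max 0 (s - ln (real d)) = 0" by simp
    qed
    fix d assume d: "d \<in> {1..m}"
    hence "real d \<le> exp s" unfolding m_def by (auto; linarith)
    hence "ln (real d) \<le> s" using d by (metis atLeastAtMost_iff exp_le_cancel_iff exp_ln of_nat_0_less_iff zero_less_one order_less_le_trans)
    thus "mangoldt d / real d * max 0 (s - ln (real d)) = mangoldt d / d * ln (exp s / d)"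
      using d by (simp add: ln_div)
  qed (use mn in auto)
  also have "\<dots> \<le> (ln (exp s))\<^sup>2 / 2 - 23 / 40 * ln (exp s) + 689 / 1000"
    using assms es by (intro sum_mangoldt_ln_le_quadratic) (auto simp: m_def)
  finally have "(\<Sum>d = 1..n. mangoldt d / d * max 0 (s - ln d)) \<le> s\<^sup>2 / 2 - 23 / 40 * s + 689 / 1000"
    by simp
  moreover have "2 / s ^ 3 \<ge> 0" using s s0 by simp
  ultimately have "(\<Sum>d = 1..n. mangoldt d / d * max 0 (s - ln d)) * (2 / s ^ 3) \<le>
      (s\<^sup>2 / 2 - 23 / 40 * s + 689 / 1000) * (2 / s ^ 3)"
    by (rule mult_right_mono)
  thus "(\<Sum>d = 1..n. mangoldt d / d * (max 0 (s - ln d) * (2 / s ^ 3))) \<le>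
      (s\<^sup>2 / 2 - 23 / 40 * s + 689 / 1000) * (2 / s ^ 3)"
    by (simp only: sum_distrib_right mult.assoc)
qed

lemma sum_mangoldt_over_ln_le:
  fixes n N :: nat and s\<^sub>0 S :: real
  assumes "1024 \<le> N" "N \<le> n"
  defines "s\<^sub>0 \<equiv> ln (real N)" and "S \<equiv> ln (real n)"
  shows "(\<Sum>d = 1..n. mangoldt d / d * (if d \<le> N then 2 / s\<^sub>0 - ln d / s\<^sub>0\<^sup>2 else 1 / ln d))
         \<le> ln S - ln s\<^sub>0 + 3 / 2 - 23 / 20 / s\<^sub>0 + 689 / 1000 / s\<^sub>0\<^sup>2 - 17 / 40 / S
             + (S + 1) / (n * S) + (\<Sum>d = 1..n. mangoldt d) / (n * S)"
proof -
  have S: "S > 0" using assms by (auto simp: S_def)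
  let ?w = "\<lambda>d. if d \<le> N then 2 / s\<^sub>0 - ln (real d) / s\<^sub>0\<^sup>2 else 1 / ln (real d)"
  have "(\<Sum>d = 1..n. mangoldt d / d * ?w d) =
        (\<Sum>d = 1..n. mangoldt d / d * (?w d - (2 / S - ln d / S\<^sup>2)))
        + (\<Sum>d = 1..n. mangoldt d / d) / S + (\<Sum>d = 1..n. mangoldt d / d * ln (n / d)) / S\<^sup>2"
    unfolding sum_divide_distrib sum.distrib [symmetric]
  proof (intro sum.cong refl)
    fix d assume d: "d \<in> {1..n}"
    hence "ln (real n / d) = S - ln d" by (simp add: ln_div S_def)
    moreover have "2 / S - ln d / S\<^sup>2 = 1 / S + (S - ln d) / S\<^sup>2"
      using S by (simp add: field_simps power2_eq_square)
    ultimately have eq: "2 / S - ln d / S\<^sup>2 = 1 / S + ln (real n / d) / S\<^sup>2" by simp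
    have "a * w = a * (w - (1 / S + b / S\<^sup>2)) + a / S + a * b / S\<^sup>2" for a b w :: real
      by (simp add: algebra_simps)
    thus "mangoldt d / d * ?w d = mangoldt d / d * (?w d - (2 / S - ln d / S\<^sup>2))
        + mangoldt d / d / S + mangoldt d / d * ln (n / d) / S\<^sup>2"
      unfolding eq by blast
  qed
  also have "(\<Sum>d = 1..n. mangoldt d / d * (?w d - (2 / S - ln d / S\<^sup>2))) \<le>
      ln S - ln s\<^sub>0 - 23 / 20 * (1 / s\<^sub>0 - 1 / S) + 689 / 1000 * (1 / s\<^sub>0\<^sup>2 - 1 / S\<^sup>2)"
    unfolding S_def s\<^sub>0_def using assms by (intro sum_mangoldt_kernel_le) auto
  also have "(\<Sum>d = 1..n. mangoldt d / d) / S \<le>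
      (S - 1 + (S + 1) / n + (\<Sum>d = 1..n. mangoldt d) / n) / S"
    using S assms sum_mangoldt_over_le[of n] by (intro divide_right_mono) (auto simp: S_def)
  also have "(\<Sum>d = 1..n. mangoldt d / d * ln (n / d)) / S\<^sup>2 \<le> (S\<^sup>2 / 2 - 23 / 40 * S + 689 / 1000) / S\<^sup>2"
    using assms sum_mangoldt_ln_le_quadratic[of "real n" n] by (intro divide_right_mono) (auto simp: S_def)
  also have "(S\<^sup>2 / 2 - 23 / 40 * S + 689 / 1000) / S\<^sup>2 = 1 / 2 - 23 / 40 / S + 689 / 1000 / S\<^sup>2"
    using S by (simp add: field_simps power2_eq_square)
  also have "(S - 1 + (S + 1) / n + (\<Sum>d = 1..n. mangoldt d) / n) / S =
      1 - 1 / S + (S + 1) / (n * S) + (\<Sum>d = 1..n. mangoldt d) / (n * S)"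
    using S assms by (simp add: field_simps)
  finally show ?thesis by (simp add: algebra_simps diff_divide_distrib)
qed

text \<open>
  A linear programming bound.  With the multiplier \<open>\<mu> = 1 / (n ln n)\<close>, the quantity
  \<open>1 / p - \<mu> ln p\<close> is positive exactly for \<open>p < n\<close>; hence the reciprocals over \<open>U\<close> are at most
  \<open>\<mu> n = 1 / ln n\<close> plus the sum of \<open>1 / p - \<mu> ln p\<close> over all primes up to \<open>n\<close>.  Replacing primes by
  prime powers and \<open>ln p\<close> by \<open>\<Lambda>\<close> gives the sum bounded in \<open>sum_mangoldt_over_ln_le\<close>, whose term with
  the sum of \<open>\<Lambda>\<close> is cancelled by \<open>\<mu>\<close>.  Up to \<open>N\<close> the weights are tangents of \<open>1 / s\<close>, and for a prime the
  difference from \<open>1 / ln d\<close> is a square; the proper prime powers up to \<open>N\<close>, added in passing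
  from \<open>ln p\<close> to \<open>\<Lambda>\<close>, are subtracted again.
\<close>

lemma sum_inverse_primes_le_table:
  fixes U :: "nat set" and n N :: nat and s\<^sub>0 S :: real
  assumes U: "finite U" "\<And>p. p \<in> U \<Longrightarrow> prime p"
    and le: "(\<Sum>p\<in>U. ln (real p)) \<le> real n"
    and N: "1024 \<le> N" "N \<le> n"
  defines "s\<^sub>0 \<equiv> ln (real N)" and "S \<equiv> ln (real n)"
  shows "(\<Sum>p\<in>U. 1 / real p) \<le> ln S - ln s\<^sub>0 + 3 / 2 - 23 / 20 / s\<^sub>0 + 689 / 1000 / s\<^sub>0\<^sup>2 + 23 / 40 / S
           + (S + 1 + N * s\<^sub>0) / (n * S)
           + (\<Sum>d = 1..N. if prime d then (1 - ln d / s\<^sub>0)\<^sup>2 / d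
                          else - (mangoldt d / d * (2 / s\<^sub>0 - ln d / s\<^sub>0\<^sup>2)))"
    (is "_ \<le> ?bound + (\<Sum>d = 1..N. ?t d)")
proof -
  define \<mu> where "\<mu> = 1 / (real n * S)"
  have s0: "s\<^sub>0 > 0" and S: "S > 0" and n: "n > 0" using N by (auto simp: s\<^sub>0_def S_def)
  have \<mu>: "\<mu> > 0" using S n by (simp add: \<mu>_def)
  let ?w = "\<lambda>d. if d \<le> N then 2 / s\<^sub>0 - ln (real d) / s\<^sub>0\<^sup>2 else 1 / ln (real d)"
  let ?h = "\<lambda>d. if prime d then 1 / real d - \<mu> * ln (real d) else 0"
  have below: "\<mu> * ln (real d) \<le> 1 / real d" if "1 \<le> d" "d \<le> n" for d
  proof -
    have "real d * ln (real d) \<le> real n * S"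
      unfolding S_def using that by (intro mult_mono) auto
    thus ?thesis using that n S by (simp add: \<mu>_def field_simps)
  qed
  have above: "1 / real d \<le> \<mu> * ln (real d)" if "d > n" for d
  proof -
    have "real n * S \<le> real d * ln (real d)"
      unfolding S_def using that n by (intro mult_mono) auto
    thus ?thesis using that n S by (simp add: \<mu>_def field_simps)
  qed
  have "(\<Sum>p\<in>U. 1 / real p) = \<mu> * (\<Sum>p\<in>U. ln (real p)) + (\<Sum>p\<in>U. ?h p)"
    using U by (simp add: sum_distrib_left sum_subtractf)
  also have "\<mu> * (\<Sum>p\<in>U. ln (real p)) \<le> \<mu> * real n"
    using le \<mu> by (intro mult_left_mono) auto
  also have "\<mu> * real n = 1 / S" using n by (simp add: \<mu>_def)
  also have "(\<Sum>p\<in>U. ?h p) \<le> (\<Sum>p\<in>U \<inter> {1..n}. ?h p)"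
  proof -
    have "(\<Sum>p\<in>U. ?h p) = (\<Sum>p\<in>U \<inter> {1..n}. ?h p) + (\<Sum>p\<in>U - {1..n}. ?h p)"
      using U by (subst sum.Int_Diff[of U _ "{1..n}"]) auto
    moreover have "(\<Sum>p\<in>U - {1..n}. ?h p) \<le> 0"
      using U above by (intro sum_nonpos) (auto simp: Suc_le_eq prime_gt_0_nat)
    ultimately show ?thesis by simp
  qed
  also have "\<dots> \<le> (\<Sum>d = 1..n. ?h d)"
    using below by (intro sum_mono2) auto
  also have "\<dots> = (\<Sum>d = 1..n. mangoldt d / d * ?w d) - \<mu> * (\<Sum>d = 1..n. mangoldt d)
                 + (\<Sum>d = 1..n. ?h d - mangoldt d / d * ?w d + \<mu> * mangoldt d)"
    by (simp add: sum.distrib sum_subtractf sum_distrib_left)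
  also have "(\<Sum>d = 1..n. ?h d - mangoldt d / d * ?w d + \<mu> * mangoldt d) \<le>
             (\<Sum>d = 1..n. if d \<le> N then ?t d + \<mu> * s\<^sub>0 else 0)"
  proof (rule sum_mono)
    fix d assume d: "d \<in> {1..n}"
    consider "prime d" "d \<le> N" | "prime d" "d > N" | "\<not>prime d" "d \<le> N" | "\<not>prime d" "d > N"
      by linarith
    thus "?h d - mangoldt d / d * ?w d + \<mu> * mangoldt d \<le> (if d \<le> N then ?t d + \<mu> * s\<^sub>0 else 0)"
    proof cases
      case 1
      have "1 / d - ln d / d * (2 / s\<^sub>0 - ln d / s\<^sub>0\<^sup>2) = (1 - ln d / s\<^sub>0)\<^sup>2 / d"
        using s0 d by (simp add: field_simps power2_eq_square)
      moreover have "\<mu> * s\<^sub>0 \<ge> 0" using \<mu> s0 by simp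
      ultimately show ?thesis using 1 by simp
    next
      (* beyond N the weight of a prime is exactly 1 / ln d *)
      case 2
      hence "ln (real d) > 0" using prime_gt_1_nat[of d] by simp
      thus ?thesis using 2 by simp
    next
      case 3
      have "mangoldt d \<le> s\<^sub>0"
        using mangoldt_le[of d] d 3 N by (auto simp: s\<^sub>0_def intro: order.trans)
      thus ?thesis using 3 \<mu> by simp
    next
      case 4
      (* proper prime powers beyond N contribute negatively and are dropped *)
      hence pos: "ln (real d) > 0" using N by simp
      have "\<mu> \<le> 1 / d / ln d"
        using below[of d] d pos by (simp add: field_simps)
      hence "mangoldt d * \<mu> \<le> mangoldt d * (1 / d / ln d)"
        by (intro mult_left_mono) (auto simp: mangoldt_nonneg)
      thus ?thesis using 4 by (simp add: mult.commute)
    qed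
  qed
  also have "(\<Sum>d = 1..n. if d \<le> N then ?t d + \<mu> * s\<^sub>0 else 0) = (\<Sum>d = 1..N. ?t d + \<mu> * s\<^sub>0)"
    using N by (intro sum.mono_neutral_cong_right) auto
  also have "\<dots> = (\<Sum>d = 1..N. ?t d) + N * s\<^sub>0 / (n * S)"
    by (simp add: sum.distrib \<mu>_def)
  also have "(\<Sum>d = 1..n. mangoldt d / d * ?w d) \<le>
      ln S - ln s\<^sub>0 + 3 / 2 - 23 / 20 / s\<^sub>0 + 689 / 1000 / s\<^sub>0\<^sup>2 - 17 / 40 / S
             + (S + 1) / (n * S) + (\<Sum>d = 1..n. mangoldt d) / (n * S)"
    unfolding s\<^sub>0_def S_def using N by (intro sum_mangoldt_over_ln_le) auto
  also have "\<mu> * (\<Sum>d = 1..n. mangoldt d) = (\<Sum>d = 1..n. mangoldt d) / (n * S)"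
    by (simp add: \<mu>_def)
  finally show ?thesis
    by (simp add: add_divide_distrib)
qed

section \<open>The finite part of the Mertens constant\<close>

lemma log_increment_ge:
  fixes m n :: real
  assumes "0 < m" "m < n"
  shows "2 * ((n - m) / (n + m)) + 2 / 3 * ((n - m) / (n + m)) ^ 3 \<le> ln n - ln m"
proof -
  have "(n / m - 1) / (n / m + 1) = (n - m) / (n + m)"
  proof -
    have "n / m - 1 = (n - m) / m" "n / m + 1 = (n + m) / m"
      using assms by (simp_all add: field_simps)
    thus ?thesis using assms by simp
  qed
  hence "(\<Sum>k<2. 2 * ((n - m) / (n + m)) ^ (2 * k + 1) / real (2 * k + 1)) \<le> ln (n / m)"
    using ln_approx_bounds[of "n / m" 2] assms by simp
  moreover have "(\<Sum>k<2. 2 * y ^ (2 * k + 1) / real (2 * k + 1)) = 2 * y + 2 / 3 * y ^ 3" for y :: real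
    by (simp add: eval_nat_numeral)
  moreover have "ln (n / m) = ln n - ln m"
    using assms by (simp add: ln_div)
  ultimately show ?thesis by (simp only:)
qed

lemma ln_1024_le: "ln (1024 :: real) \<le> 69314719 / 10 ^ 7"
proof -
  have "ln (1024::real) = 10 * ln 2"
    using ln_realpow[of 2 10] by simp
  moreover have "ln (2::real) \<le> 69314719 / 10 ^ 8"
    using ln_approx_bounds[of 2 8] by (simp add: eval_nat_numeral)
  ultimately show ?thesis by simp
qed

text \<open>
  A lower bound, in units of \<open>10 ^ (-7)\<close>, for \<open>ln n - ln m\<close>: two terms of the expansion of the
  logarithm in \<open>(n - m) / (n + m)\<close>.
\<close>

definition log_step :: "int \<Rightarrow> int \<Rightarrow> int" where
  "log_step m n = (10 ^ 7 * (6 * (n - m) * (n + m)\<^sup>2 + 2 * (n - m) ^ 3)) div (3 * (n + m) ^ 3)"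

text \<open>
  An upper bound for a term of the table when \<open>l\<close> is a lower bound for \<open>10 ^ 7 * ln n\<close>.  The
  constant \<open>69314719\<close> is \<open>10 ^ 7 * ln 1024\<close> rounded up, and the unit is the inverse of its square.
  The entry \<open>n\<close> is treated as a prime if \<open>a = 1\<close>, and as the \<open>a\<close>-th power of a prime otherwise.
\<close>

definition entry_bound :: "int \<Rightarrow> int \<Rightarrow> int \<Rightarrow> int" where
  "entry_bound n a l =
     (if a = 1 then (69314719 - l)\<^sup>2 div n + 1 else - (l * (2 * 69314719 - l) div (a * n)))"

definition has_small_factor :: "int \<Rightarrow> bool" where
  "has_small_factor d \<longleftrightarrow> list_ex (\<lambda>p. d mod p = 0 \<and> p < d) [2, 3, 5, 7, 11, 13, 17, 19, 23, 29, 31]"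

text \<open>
  One pass along an increasing list of pairs \<open>(n, a)\<close>.  It carries the last entry \<open>m\<close>, a lower bound
  \<open>l\<close> for its logarithm and the accumulated sum, and it verifies that every number skipped is
  composite.  The second function only forces its argument \<open>l\<close> to be evaluated once.
\<close>

fun table_bound :: "int \<Rightarrow> int \<Rightarrow> int \<Rightarrow> (int \<times> int) list \<Rightarrow> int option"
and table_bound' :: "int \<Rightarrow> int \<Rightarrow> int \<Rightarrow> int \<Rightarrow> (int \<times> int) list \<Rightarrow> int option" where
  "table_bound m l acc [] = (if m = 1024 then Some acc else None)"
| "table_bound m l acc ((n, a) # xs) =
     (if m < n \<and> n \<le> 1024 \<and> list_all has_small_factor [m + 1..n - 1]
      then table_bound' n a (l + log_step m n) acc xs else None)"
| "table_bound' n a l acc xs =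
     (if l \<le> 69314719 then table_bound n l (acc + entry_bound n a l) xs else None)"

definition prime_powers_1024 :: "(int \<times> int) list" where
  "prime_powers_1024 =
    [(2, 1), (3, 1), (4, 2), (5, 1), (7, 1), (8, 3), (9, 2), (11, 1), (13, 1), (16, 4), (17, 1),
     (19, 1), (23, 1), (25, 2), (27, 3), (29, 1), (31, 1), (32, 5), (37, 1), (41, 1), (43, 1),
     (47, 1), (49, 2), (53, 1), (59, 1), (61, 1), (64, 6), (67, 1), (71, 1), (73, 1), (79, 1),
     (81, 4), (83, 1), (89, 1), (97, 1), (101, 1), (103, 1), (107, 1), (109, 1), (113, 1), (121,
     2), (125, 3), (127, 1), (128, 7), (131, 1), (137, 1), (139, 1), (149, 1), (151, 1), (157,
     1), (163, 1), (167, 1), (169, 2), (173, 1), (179, 1), (181, 1), (191, 1), (193, 1), (197,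
     1), (199, 1), (211, 1), (223, 1), (227, 1), (229, 1), (233, 1), (239, 1), (241, 1), (243,
     5), (251, 1), (256, 8), (257, 1), (263, 1), (269, 1), (271, 1), (277, 1), (281, 1), (283,
     1), (289, 2), (293, 1), (307, 1), (311, 1), (313, 1), (317, 1), (331, 1), (337, 1), (343,
     3), (347, 1), (349, 1), (353, 1), (359, 1), (361, 2), (367, 1), (373, 1), (379, 1), (383,
     1), (389, 1), (397, 1), (401, 1), (409, 1), (419, 1), (421, 1), (431, 1), (433, 1), (439,
     1), (443, 1), (449, 1), (457, 1), (461, 1), (463, 1), (467, 1), (479, 1), (487, 1), (491,
     1), (499, 1), (503, 1), (509, 1), (512, 9), (521, 1), (523, 1), (529, 2), (541, 1), (547,
     1), (557, 1), (563, 1), (569, 1), (571, 1), (577, 1), (587, 1), (593, 1), (599, 1), (601,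
     1), (607, 1), (613, 1), (617, 1), (619, 1), (625, 4), (631, 1), (641, 1), (643, 1), (647,
     1), (653, 1), (659, 1), (661, 1), (673, 1), (677, 1), (683, 1), (691, 1), (701, 1), (709,
     1), (719, 1), (727, 1), (729, 6), (733, 1), (739, 1), (743, 1), (751, 1), (757, 1), (761,
     1), (769, 1), (773, 1), (787, 1), (797, 1), (809, 1), (811, 1), (821, 1), (823, 1), (827,
     1), (829, 1), (839, 1), (841, 2), (853, 1), (857, 1), (859, 1), (863, 1), (877, 1), (881,
     1), (883, 1), (887, 1), (907, 1), (911, 1), (919, 1), (929, 1), (937, 1), (941, 1), (947,
     1), (953, 1), (961, 2), (967, 1), (971, 1), (977, 1), (983, 1), (991, 1), (997, 1), (1009,
     1), (1013, 1), (1019, 1), (1021, 1), (1024, 10)]"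

lemma table_bound_prime_powers_1024:
  "table_bound 1 0 0 prime_powers_1024 = Some 4156915191967217"
  by code_simp

lemma log_step_nonneg: "1 \<le> m \<Longrightarrow> m < n \<Longrightarrow> 0 \<le> log_step m n"
  unfolding log_step_def by (intro pos_imp_zdiv_nonneg_iff[THEN iffD2]) auto

lemma log_step_le:
  assumes "1 \<le> m" "m < n"
  shows "real_of_int (log_step m n) \<le> 10 ^ 7 * (ln n - ln m)"
proof -
  have "real_of_int (log_step m n) \<le>
      real_of_int (10 ^ 7 * (6 * (n - m) * (n + m)\<^sup>2 + 2 * (n - m) ^ 3)) / real_of_int (3 * (n + m) ^ 3)"
    unfolding log_step_def by (rule real_of_int_div4)
  also have "\<dots> = 10 ^ 7 * (2 * ((real_of_int n - m) / (real_of_int n + m))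
                        + 2 / 3 * ((real_of_int n - m) / (real_of_int n + m)) ^ 3)"
  proof -
    have "10 ^ 7 * (6 * D * H\<^sup>2 + 2 * D ^ 3) / (3 * H ^ 3) =
          10 ^ 7 * (2 * (D / H) + 2 / 3 * (D / H) ^ 3)" if "H > 0" for D H :: real
      using that by (simp add: field_simps power2_eq_square power3_eq_cube)
    from this[of "real_of_int n + m" "real_of_int n - m"] show ?thesis using assms by simp
  qed
  also have "\<dots> \<le> 10 ^ 7 * (ln n - ln m)"
    using assms by (intro mult_left_mono log_increment_ge) auto
  finally show ?thesis .
qed

text \<open>
  The weight of \<open>d\<close> in \<open>sum_inverse_primes_le_table\<close> for \<open>N = 1024\<close>.
\<close>

definition mertens_term :: "nat \<Rightarrow> real" where
  "mertens_term d = (if prime d then (1 - ln d / ln 1024)\<^sup>2 / d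
                     else - (mangoldt d / d * (2 / ln 1024 - ln d / (ln 1024)\<^sup>2)))"

lemma mertens_term_nonprime:
  assumes "\<not>prime d" "1 \<le> d" "d \<le> 1024"
  shows "mertens_term d = - (mangoldt d / d * (ln d / ln 1024) * (2 - ln d / ln 1024) / ln d)"
    and "mertens_term d \<le> 0"
proof -
  have "ln (real d) / ln 1024 \<le> 1" using assms by (simp add: divide_le_eq)
  hence le: "ln (real d) / ln 1024 \<le> 2" by linarith
  have eq: "2 / ln 1024 - ln d / (ln 1024)\<^sup>2 = (2 - ln d / ln 1024) / ln (1024 :: real)"
    by (simp add: power2_eq_square field_simps)
  show "mertens_term d \<le> 0"
    unfolding mertens_term_def eq using assms le mangoldt_nonneg[of d]
    by (auto intro!: mult_nonneg_nonneg divide_nonneg_nonneg)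
  show "mertens_term d = - (mangoldt d / d * (ln d / ln 1024) * (2 - ln d / ln 1024) / ln d)"
  proof (cases "d = 1")
    case False
    hence "ln (real d) \<noteq> 0" using assms by simp
    thus ?thesis unfolding mertens_term_def eq using assms by simp
  qed (simp add: mertens_term_def)
qed

text \<open>
  With \<open>z = ln n / ln 1024\<close> the term is \<open>(1 - z)\<^sup>2 / n\<close> for a prime and \<open>- z (2 - z) / (a n)\<close> for an
  \<open>a\<close>-th power.  Both decrease in \<open>z\<close>, so a lower bound for the logarithm suffices.  For
  \<open>a = 1\<close> the bound is nonnegative, so it also covers composite \<open>n\<close>, whose term is at most \<open>0\<close>.
\<close>

lemma mertens_term_le_entry_bound:
  assumes "1 < n" "n \<le> 1024" "0 \<le> l" "l \<le> 69314719" "l \<le> 10 ^ 7 * ln n"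
    and a: "0 < a" "a \<noteq> 1 \<Longrightarrow> mangoldt (nat n) = ln n / a"
  shows "mertens_term (nat n) \<le> entry_bound n a l / 69314719\<^sup>2"
proof -
  define z where "z = ln (real_of_int n) / ln 1024"
  define \<zeta> where "\<zeta> = real_of_int l / 69314719"
  have lnn: "ln (real_of_int n) > 0" using assms by simp
  have n: "real (nat n) = real_of_int n" using assms by simp
  have z1: "z \<le> 1" unfolding z_def using assms by (simp add: divide_le_eq)
  have "\<zeta> = (l / 10 ^ 7) / (69314719 / 10 ^ 7)" by (simp add: \<zeta>_def)
  also have "\<dots> \<le> z"
    unfolding z_def using assms ln_1024_le lnn by (intro frac_le) auto
  finally have \<zeta>z: "\<zeta> \<le> z" .
  have \<zeta>0: "0 \<le> \<zeta>" using assms by (simp add: \<zeta>_def)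
  consider "prime (nat n)" "a = 1" | "\<not>prime (nat n)" "a = 1" | "a \<noteq> 1" by blast
  thus ?thesis
  proof cases
    case 1
    have "mertens_term (nat n) = (1 - z)\<^sup>2 / n"
      using 1 n by (simp add: mertens_term_def z_def)
    also have "\<dots> \<le> (1 - \<zeta>)\<^sup>2 / n"
      using z1 \<zeta>z assms by (intro divide_right_mono power_mono) auto
    also have "\<dots> = real_of_int ((69314719 - l)\<^sup>2) / n / 69314719\<^sup>2"
      by (simp add: \<zeta>_def field_simps power2_eq_square)
    also have "real_of_int ((69314719 - l)\<^sup>2) / n \<le> real_of_int ((69314719 - l)\<^sup>2 div n + 1)"
      using real_of_int_div3[of "(69314719 - l)\<^sup>2" n] by simp
    finally show ?thesis using 1 by (simp add: entry_bound_def divide_right_mono)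
  next
    case 2
    have "mertens_term (nat n) \<le> 0"
      using 2 assms by (intro mertens_term_nonprime) auto
    moreover have "0 \<le> (69314719 - l)\<^sup>2 div n" using assms by (simp add: pos_imp_zdiv_nonneg_iff)
    hence "0 \<le> real_of_int (entry_bound n a l)" using 2 by (simp add: entry_bound_def)
    moreover have "0 \<le> real_of_int (entry_bound n a l) / 69314719\<^sup>2"
      using calculation by (intro divide_nonneg_nonneg) auto
    ultimately show ?thesis by linarith
  next
    case 3
    have np: "\<not>prime (nat n)"
    proof
      assume "prime (nat n)"
      hence "ln (real_of_int n) = ln n / a" using a 3 n by simp
      thus False using lnn a 3 by (simp add: field_simps)
    qed
    have "mertens_term (nat n) = - (z * (2 - z) / (a * n))"
      using mertens_term_nonprime(1)[OF np] assms 3 n lnn by (simp add: z_def)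
    also have "\<zeta> * (2 - \<zeta>) \<le> z * (2 - z)"
    proof -
      have "0 \<le> (z - \<zeta>) * (2 - z - \<zeta>)" using z1 \<zeta>z by (intro mult_nonneg_nonneg) auto
      thus ?thesis by (simp add: algebra_simps)
    qed
    hence "- (z * (2 - z) / (a * n)) \<le> - (\<zeta> * (2 - \<zeta>) / (a * n))"
      using assms by (simp add: divide_right_mono)
    also have "\<dots> = - (real_of_int (l * (2 * 69314719 - l)) / real_of_int (a * n)) / 69314719\<^sup>2"
      by (simp add: \<zeta>_def field_simps power2_eq_square)
    also have "- (real_of_int (l * (2 * 69314719 - l)) / real_of_int (a * n)) \<le>
               - real_of_int (l * (2 * 69314719 - l) div (a * n))"
      using real_of_int_div4[of "l * (2 * 69314719 - l)" "a * n"] by simp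
    finally show ?thesis using 3 by (simp add: entry_bound_def divide_right_mono)
  qed
qed

lemma has_small_factor_imp_not_prime:
  assumes "has_small_factor d"
  shows "\<not>prime (nat d)"
proof
  assume pr: "prime (nat d)"
  from assms obtain p where p: "p \<in> {2, 3, 5, 7, 11, 13, 17, 19, 23, 29, 31}" "p dvd d" "p < d"
    unfolding has_small_factor_def list_ex_iff by (auto simp: mod_eq_0_iff_dvd)
  hence "nat p dvd nat d" by (subst nat_dvd_iff) auto
  with pr have "nat p = 1 \<or> nat p = nat d" by (simp add: prime_nat_iff)
  thus False using p by auto
qed

lemma sum_mertens_term_le_table_bound:
  "table_bound m l acc xs = Some r \<Longrightarrow> 1 \<le> m \<Longrightarrow> 0 \<le> l \<Longrightarrow> l \<le> 10 ^ 7 * ln m \<Longrightarrow>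
     (\<forall>(n, a) \<in> set xs. 0 < a \<and> (a \<noteq> 1 \<longrightarrow> mangoldt (nat n) = ln n / a)) \<Longrightarrow>
     (\<Sum>d\<in>{nat m<..1024}. mertens_term d) \<le> (real_of_int r - real_of_int acc) / 69314719\<^sup>2"
  "table_bound' n a l acc xs = Some r \<Longrightarrow> 1 < n \<Longrightarrow> n \<le> 1024 \<Longrightarrow> 0 \<le> l \<Longrightarrow> l \<le> 10 ^ 7 * ln n \<Longrightarrow>
     (\<forall>(n, a) \<in> set ((n, a) # xs). 0 < a \<and> (a \<noteq> 1 \<longrightarrow> mangoldt (nat n) = ln n / a)) \<Longrightarrow>
     (\<Sum>d\<in>{nat n..1024}. mertens_term d) \<le> (real_of_int r - real_of_int acc) / 69314719\<^sup>2"
proof (induction m l acc xs and n a l acc xs rule: table_bound_table_bound'.induct)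
  case (1 m l acc)
  thus ?case by (simp split: if_splits)
next
  case (2 m l acc n a xs)
  have mn: "m < n" "n \<le> 1024" "\<forall>d\<in>{m + 1..n - 1}. has_small_factor d"
    and tb: "table_bound' n a (l + log_step m n) acc xs = Some r"
    using 2(2) by (auto split: if_splits simp: list_all_iff)
  have IH: "(\<Sum>d\<in>{nat n..1024}. mertens_term d) \<le> (real_of_int r - real_of_int acc) / 69314719\<^sup>2"
  proof (rule "2.IH")
    show "0 \<le> l + log_step m n" using 2 mn log_step_nonneg[of m n] by simp
    show "real_of_int (l + log_step m n) \<le> 10 ^ 7 * ln n"
      using 2 mn log_step_le[of m n] by (simp add: algebra_simps)
  qed (use 2 mn tb in \<open>auto simp: list_all_iff\<close>)
  have "(\<Sum>d\<in>{nat m<..1024}. mertens_term d) =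
        (\<Sum>d\<in>{nat m<..<nat n}. mertens_term d) + (\<Sum>d\<in>{nat n..1024}. mertens_term d)"
    using mn 2 by (subst sum.union_disjoint [symmetric]) (auto intro!: sum.cong)
  also have "(\<Sum>d\<in>{nat m<..<nat n}. mertens_term d) \<le> 0"
  proof (intro sum_nonpos mertens_term_nonprime)
    fix d assume d: "d \<in> {nat m<..<nat n}"
    hence "int d \<in> {m + 1..n - 1}" using 2(3) by auto
    hence "has_small_factor (int d)" using mn(3) by blast
    thus "\<not>prime d" using has_small_factor_imp_not_prime[of "int d"] by simp
    show "1 \<le> d" "d \<le> 1024" using d mn by auto
  qed
  finally show ?case using IH by simp
next
  case (3 n a l acc xs)
  have l: "l \<le> 69314719" and tb: "table_bound n l (acc + entry_bound n a l) xs = Some r"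
    using 3(2) by (auto split: if_splits)
  have "(\<Sum>d\<in>{nat n<..1024}. mertens_term d) \<le> (real_of_int r - real_of_int (acc + entry_bound n a l)) / 69314719\<^sup>2"
    using 3 l tb by (intro "3.IH") auto
  moreover have "mertens_term (nat n) \<le> entry_bound n a l / 69314719\<^sup>2"
    using 3 l by (intro mertens_term_le_entry_bound) auto
  moreover have "(\<Sum>d\<in>{nat n..1024}. mertens_term d) =
      mertens_term (nat n) + (\<Sum>d\<in>{nat n<..1024}. mertens_term d)"
    using 3 sum.atLeast_Suc_atMost[of "nat n" 1024 mertens_term]
    by (simp add: atLeastSucAtMost_greaterThanAtMost)
  ultimately show ?case by (simp add: diff_divide_distrib add_divide_distrib)
qed

lemma prime_powers_1024_are_prime_powers:
  "list_all (\<lambda>(n, a). a = 1 \<or> 1 < a \<and> list_ex (\<lambda>p. p ^ nat a = n) [2, 3, 5, 7, 11, 13, 17, 19, 23, 29, 31])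
     prime_powers_1024"
  by code_simp

lemma prime_powers_1024_mangoldt:
  "\<forall>(n, a) \<in> set prime_powers_1024. 0 < a \<and> (a \<noteq> 1 \<longrightarrow> mangoldt (nat n) = ln (real_of_int n) / real_of_int a)"
proof safe
  fix n a assume na: "(n, a) \<in> set prime_powers_1024"
  show "0 < a" using na prime_powers_1024_are_prime_powers by (force simp: list_all_iff)
  assume "a \<noteq> 1"
  then obtain p :: int where p: "p \<in> {2, 3, 5, 7, 11, 13, 17, 19, 23, 29, 31}" "n = p ^ nat a" "1 < a"
    using na prime_powers_1024_are_prime_powers by (fastforce simp: list_all_iff list_ex_iff)
  hence "prime (nat p)" by auto
  moreover have "nat n = nat p ^ nat a" using p by (auto simp: nat_power_eq)
  moreover have "real_of_int n = real (nat p) ^ nat a" using p by auto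
  ultimately show "mangoldt (nat n) = ln (real_of_int n) / real_of_int a"
    using p(3) prime_gt_0_nat[of "nat p"] by (simp add: ln_realpow)
qed

lemma sum_mertens_term_le: "(\<Sum>d = 1..1024. mertens_term d) \<le> 8653 / 10000"
proof -
  have "(\<Sum>d\<in>{nat 1<..1024}. mertens_term d) \<le> (real_of_int 4156915191967217 - real_of_int 0) / 69314719\<^sup>2"
    by (rule sum_mertens_term_le_table_bound(1)[OF table_bound_prime_powers_1024])
       (use prime_powers_1024_mangoldt in auto)
  moreover have "(\<Sum>d = 1..1024. mertens_term d) = mertens_term 1 + (\<Sum>d\<in>{nat 1<..1024}. mertens_term d)"
    using sum.atLeast_Suc_atMost[of 1 1024 mertens_term]
    by (simp add: atLeastSucAtMost_greaterThanAtMost)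
  moreover have "mertens_term 1 = 0" by (simp add: mertens_term_def)
  ultimately show ?thesis by simp
qed

section \<open>Numerical bounds for sums of reciprocals of primes\<close>

text \<open>
  An explicit form of Mertens' second theorem under a constraint on the product of the primes.  It
  combines \<open>sum_inverse_primes_le_table\<close> at \<open>N = 1024\<close> with the numerical value of the table.
\<close>

theorem sum_inverse_primes_le:
  fixes U :: "nat set" and n :: nat
  assumes U: "finite U" "\<And>p. p \<in> U \<Longrightarrow> prime p"
    and le: "(\<Sum>p\<in>U. ln (real p)) \<le> real n"
    and n: "1024 \<le> n"
  shows "(\<Sum>p\<in>U. 1 / real p) \<le> ln (ln n) + 2785 / 10000 + 23 / 40 / ln n + 8000 / n"
proof -
  define s\<^sub>0 S where "s\<^sub>0 = ln (1024::real)" and "S = ln (real n)"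
  have s0: "s\<^sub>0 \<le> 69314719 / 10 ^ 7" "s\<^sub>0 \<ge> 6931 / 1000"
    using ln_1024_le ln_2_ge ln_realpow[of 2 10] by (auto simp: s\<^sub>0_def)
  have S: "S \<ge> s\<^sub>0" using n by (simp add: S_def s\<^sub>0_def)
  have "(\<Sum>p\<in>U. 1 / real p) \<le> ln S - ln s\<^sub>0 + 3 / 2 - 23 / 20 / s\<^sub>0 + 689 / 1000 / s\<^sub>0\<^sup>2 + 23 / 40 / S
           + (S + 1 + 1024 * s\<^sub>0) / (n * S) + (\<Sum>d = 1..1024. mertens_term d)"
    using sum_inverse_primes_le_table[OF U le, of 1024, unfolded of_nat_numeral] n
    by (simp add: s\<^sub>0_def S_def mertens_term_def)
  moreover have "ln s\<^sub>0 \<ge> 19359 / 10000"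
  proof -
    (* 7 is close to ln 1024 = 6.93... *)
    have "ln (s\<^sub>0 / 7) \<ge> 1 - 7 / s\<^sub>0"
      using ln_le_minus_one[of "7 / s\<^sub>0"] s0 by (simp add: ln_div)
    moreover have "7 / s\<^sub>0 \<le> 7 / (6931 / 1000)" using s0 by (intro divide_left_mono) auto
    moreover have "ln (7::real) \<ge> 19459 / 10000"
      using ln_approx_bounds[of 7 16] by (simp add: eval_nat_numeral)
    ultimately show ?thesis using s0 by (simp add: ln_div)
  qed
  moreover have "23 / 20 / s\<^sub>0 \<ge> 23 / 20 / (69314719 / 10 ^ 7)"
    using s0 by (intro divide_left_mono) auto
  moreover have "689 / 1000 / s\<^sub>0\<^sup>2 \<le> 689 / 1000 / (6931 / 1000)\<^sup>2"
    using s0 by (intro divide_left_mono power_mono) auto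
  moreover have "(S + 1 + 1024 * s\<^sub>0) / (n * S) \<le> 8000 / n"
  proof -
    have "S + 1 + 1024 * s\<^sub>0 \<le> 8000 * S" using S s0 by simp
    hence "(S + 1 + 1024 * s\<^sub>0) / (n * S) \<le> 8000 * S / (n * S)"
      using S s0 by (intro divide_right_mono) auto
    thus ?thesis using S s0 by simp
  qed
  moreover note sum_mertens_term_le
  ultimately have "(\<Sum>p\<in>U. 1 / real p) \<le> ln S + 2785 / 10000 + 23 / 40 / S + 8000 / n"
    by (simp add: power2_eq_square)
  thus ?thesis by (simp add: S_def)
qed

lemma ln_10_le: "ln (10::real) \<le> 23027 / 10000"
  using ln_2_le ln_5_le ln_mult[of "2::real" 5] by simp

lemma ln_over_le:
  fixes S c :: real
  assumes "0 < S" "0 < c"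
  shows "ln S \<le> ln c + (S / c - 1)"
  using ln_le_minus_one[of "S / c"] assms by (simp add: ln_div)

text \<open>
  The first two hypotheses hold for the primes in a number of size \<open>8 * m ^ 5\<close> with \<open>m\<close> below
  \<open>10 ^ (10 ^ 16)\<close> and \<open>10 ^ (10 ^ 11)\<close>, since \<open>5 * ln 10 = 11.51...\<close> leaves room below \<open>12\<close>.  The third
  is for small \<open>m\<close>.
\<close>

lemma sum_inverse_primes_numeric_bounds:
  fixes U :: "nat set"
  assumes U: "finite U" "\<And>p. p \<in> U \<Longrightarrow> prime p"
  shows "(\<Sum>p\<in>U. ln (real p)) \<le> 12 * 10 ^ 16 \<Longrightarrow> (\<Sum>p\<in>U. 1 / real p) < 39657 / 10000"
    and "(\<Sum>p\<in>U. ln (real p)) \<le> 12 * 10 ^ 11 \<Longrightarrow> (\<Sum>p\<in>U. 1 / real p) < 3629 / 1000"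
    and "(\<Sum>p\<in>U. ln (real p)) \<le> 10 ^ 6 \<Longrightarrow> (\<Sum>p\<in>U. 1 / real p) < 3"
proof -
  have ln_eq: "ln (real (12 * 10 ^ a)) = real (a + 2) * ln 2 + ln 3 + a * ln 5" for a :: nat
  proof -
    have "real (12 * 10 ^ a) = 2 ^ (a + 2) * (3 * 5 ^ a)"
      by (simp add: power_mult_distrib [symmetric] power_add)
    also have "ln \<dots> = ln (2 ^ (a + 2)) + (ln 3 + ln (5 ^ a))"
      by (subst ln_mult; (subst ln_mult)?) auto
    also have "\<dots> = real (a + 2) * ln 2 + (ln 3 + a * ln 5)"
      using ln_realpow[of "2::real" "a + 2"] ln_realpow[of "5::real" a] by (simp only: zero_less_numeral simp_thms True_implies_equals)
    finally show ?thesis by simp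
  qed
  have general: "(\<Sum>p\<in>U. 1 / real p) \<le> ln c + (Smax / c - 1) + 2785 / 10000 + 23 / 40 / Smin + 8000 / n"
    if "(\<Sum>p\<in>U. ln (real p)) \<le> real n" "n \<ge> 1024" "ln (real n) \<le> Smax" "Smin \<le> ln (real n)" "c > 0" "Smin > 0"
    for n :: nat and c Smin Smax :: real
  proof -
    have "ln (ln (real n)) \<le> ln c + (ln (real n) / c - 1)"
      using that by (intro ln_over_le) auto
    moreover have "ln (real n) / c \<le> Smax / c" using that by (simp add: divide_right_mono)
    moreover have "23 / 40 / ln (real n) \<le> 23 / 40 / Smin" using that by (intro divide_left_mono) auto
    moreover note sum_inverse_primes_le[OF U that(1,2)]
    ultimately show ?thesis by linarith
  qed
  (* 40, 28 and 14 are smooth numbers just above ln n in the three cases *)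
  have ln40: "ln (40::real) = 3 * ln 2 + ln 5" and ln28: "ln (28::real) = 2 * ln 2 + ln 7"
    and ln14: "ln (14::real) = ln 2 + ln 7"
    using ln_mult[of "8::real" 5] ln_mult[of "4::real" 7] ln_mult[of "2::real" 7]
      ln_realpow[of 2 3] ln_realpow[of 2 2] by simp_all
  {
    assume "(\<Sum>p\<in>U. ln (real p)) \<le> 12 * 10 ^ 16"
    hence "(\<Sum>p\<in>U. 1 / real p) \<le> ln 40 + ((393274 / 10000) / 40 - 1) + 2785 / 10000
             + 23 / 40 / 39 + 8000 / real (12 * 10 ^ 16)"
      using ln_eq[of 16] ln_2_le ln_3_le ln_5_le ln_2_ge ln_3_ge ln_5_ge
      by (intro general) auto
    thus "(\<Sum>p\<in>U. 1 / real p) < 39657 / 10000"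
      using ln40 ln_2_le ln_5_le by simp
  }
  {
    assume "(\<Sum>p\<in>U. ln (real p)) \<le> 12 * 10 ^ 11"
    hence "(\<Sum>p\<in>U. 1 / real p) \<le> ln 28 + ((27815 / 1000) / 28 - 1) + 2785 / 10000
             + 23 / 40 / 27 + 8000 / real (12 * 10 ^ 11)"
      using ln_eq[of 11] ln_2_le ln_3_le ln_5_le ln_2_ge ln_3_ge ln_5_ge
      by (intro general) auto
    thus "(\<Sum>p\<in>U. 1 / real p) < 3629 / 1000"
      using ln28 ln_2_le ln_7_le by simp
  }
  {
    assume "(\<Sum>p\<in>U. ln (real p)) \<le> 10 ^ 6"
    moreover have "ln (real (10 ^ 6)) = 6 * (ln 2 + ln 5)"
      using ln_realpow[of "10::real" 6] ln_mult[of "2::real" 5] by simp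
    ultimately have "(\<Sum>p\<in>U. 1 / real p) \<le> ln 14 + (14 / 14 - 1) + 2785 / 10000
             + 23 / 40 / 13 + 8000 / real (10 ^ 6)"
      using ln_2_le ln_5_le ln_2_ge ln_5_ge by (intro general) auto
    thus "(\<Sum>p\<in>U. 1 / real p) < 3"
      using ln14 ln_2_le ln_7_le by simp
  }
qed

section \<open>Existence of a special prime divisor\<close>

lemma integral_reciprocal_sum_ge_1:
  assumes "(\<Sum>p\<in>prime_factors n. 1 / real p) + real_of_int c / real n \<in> \<int>" "n > 0" "c > 0"
  shows "(\<Sum>p\<in>prime_factors n. 1 / real p) \<ge> 1 - real_of_int c / real n"
proof -
  obtain z where z: "(\<Sum>p\<in>prime_factors n. 1 / real p) + real_of_int c / real n = of_int z"
    using assms(1) by (elim Ints_cases)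
  have "real_of_int c / real n > 0" using assms by simp
  moreover have "(\<Sum>p\<in>prime_factors n. 1 / real p) \<ge> 0" by (intro sum_nonneg) auto
  ultimately have "real_of_int z > 0" using z by linarith
  hence "real_of_int z \<ge> 1" by simp
  thus ?thesis using z by linarith
qed

definition moser_factor :: "nat \<Rightarrow> nat \<Rightarrow> nat" where
  "moser_factor m i = [m - 1, m + 1, 2 * m - 1, 2 * m + 1, m + 2] ! i"

lemma sum_moser_factors:
  "(\<Sum>i<5. g (moser_factor m i)) =
     g (m - 1) + g (m + 1) + g (2 * m - 1) + g (2 * m + 1) + g (m + 2)"
  for g :: "nat \<Rightarrow> 'a :: comm_monoid_add"
  by (simp add: moser_factor_def eval_nat_numeral add.assoc)

lemma prod_moser_factors:
  "(\<Prod>i<5. moser_factor m i) = (m - 1) * (m + 1) * (2 * m - 1) * (2 * m + 1) * (m + 2)"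
  by (simp add: moser_factor_def eval_nat_numeral mult.assoc)

text \<open>
  Any two of the five numbers have an integer combination among \<open>1\<close>, \<open>2\<close>, \<open>3\<close>, \<open>5\<close>, so a larger prime
  divides at most one of them.  The prime \<open>3\<close> divides three of them if \<open>m\<close> is \<open>1\<close> modulo \<open>3\<close>, two if \<open>m\<close>
  is \<open>2\<close>, and none if \<open>m\<close> is \<open>0\<close>.
\<close>

lemma moser_factors_common_prime:
  assumes "odd m" "m > 2" "prime p"
  shows "(\<Sum>i<5. of_bool (p dvd moser_factor m i) :: nat) \<le>
           1 + of_bool (p = 2) + (if m mod 3 = 2 then 1 else 2) * of_bool (p = 3) + of_bool (p = 5)"
proof -
  note * = sum_moser_factors[of "\<lambda>n. of_bool (p dvd n) :: nat" m]
  consider "p = 2" | "p = 3" | "p = 5" | "p > 5"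
    using assms(3) prime_ge_2_nat[of p] by (cases "p = 4") (force, linarith)
  thus ?thesis
  proof cases
    case 1
    have "\<not>2 dvd 2 * m - 1" "\<not>2 dvd 2 * m + 1" "\<not>2 dvd m + 2" using assms by presburger+
    thus ?thesis unfolding * using 1 by simp
  next
    case 2
    have "m mod 3 = 0 \<Longrightarrow> \<not>3 dvd m - 1 \<and> \<not>3 dvd m + 1 \<and> \<not>3 dvd 2 * m - 1 \<and> \<not>3 dvd 2 * m + 1 \<and> \<not>3 dvd m + 2"
      "m mod 3 = 1 \<Longrightarrow> \<not>3 dvd m + 1 \<and> \<not>3 dvd 2 * m - 1"
      "m mod 3 = 2 \<Longrightarrow> \<not>3 dvd m - 1 \<and> \<not>3 dvd 2 * m + 1 \<and> \<not>3 dvd m + 2"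
      using assms(2) by presburger+
    moreover have "m mod 3 = 0 \<or> m mod 3 = 1 \<or> m mod 3 = 2" by presburger
    ultimately show ?thesis unfolding * using 2 by (elim disjE) simp_all
  next
    case 3
    have "m mod 5 = 0 \<Longrightarrow> \<not>5 dvd m - 1 \<and> \<not>5 dvd m + 1 \<and> \<not>5 dvd 2 * m - 1 \<and> \<not>5 dvd 2 * m + 1 \<and> \<not>5 dvd m + 2"
      "m mod 5 = 1 \<Longrightarrow> \<not>5 dvd m + 1 \<and> \<not>5 dvd 2 * m - 1 \<and> \<not>5 dvd 2 * m + 1 \<and> \<not>5 dvd m + 2"
      "m mod 5 = 2 \<Longrightarrow> \<not>5 dvd m - 1 \<and> \<not>5 dvd m + 1 \<and> \<not>5 dvd 2 * m - 1 \<and> \<not>5 dvd m + 2"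
      "m mod 5 = 3 \<Longrightarrow> \<not>5 dvd m - 1 \<and> \<not>5 dvd m + 1 \<and> \<not>5 dvd 2 * m + 1"
      "m mod 5 = 4 \<Longrightarrow> \<not>5 dvd m - 1 \<and> \<not>5 dvd 2 * m - 1 \<and> \<not>5 dvd 2 * m + 1 \<and> \<not>5 dvd m + 2"
      using assms(2) by presburger+
    moreover have "m mod 5 = 0 \<or> m mod 5 = 1 \<or> m mod 5 = 2 \<or> m mod 5 = 3 \<or> m mod 5 = 4" by presburger
    ultimately show ?thesis unfolding * using 3 by (elim disjE) simp_all
  next
    case 4
    have combine: "\<not>(int p dvd x \<and> int p dvd y)" if "a * x + b * y \<in> {1, 2, 3, 5}" for a b x y :: int
    proof
      assume "int p dvd x \<and> int p dvd y"
      hence "int p dvd a * x + b * y" by (intro dvd_add dvd_mult) auto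
      hence "int p \<le> a * x + b * y" using that by (intro zdvd_imp_le) auto
      thus False using that 4 by auto
    qed
    have iff: "p dvd m - 1 \<longleftrightarrow> int p dvd int m - 1" "p dvd m + 1 \<longleftrightarrow> int p dvd int m + 1"
      "p dvd 2 * m - 1 \<longleftrightarrow> int p dvd 2 * int m - 1" "p dvd 2 * m + 1 \<longleftrightarrow> int p dvd 2 * int m + 1"
      "p dvd m + 2 \<longleftrightarrow> int p dvd int m + 2"
      using assms(2) int_dvd_int_iff[of p "m - 1"] int_dvd_int_iff[of p "m + 1"]
        int_dvd_int_iff[of p "2 * m - 1"] int_dvd_int_iff[of p "2 * m + 1"] int_dvd_int_iff[of p "m + 2"]
      by (simp_all add: of_nat_diff add.commute)
    let ?M = "int m"
    show ?thesis
      unfolding * iff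
      using combine[of 1 "?M + 1" "-1" "?M - 1"] combine[of 2 "?M - 1" "-1" "2 * ?M - 1"]
        combine[of 1 "2 * ?M + 1" "-2" "?M - 1"] combine[of 1 "?M + 2" "-1" "?M - 1"]
        combine[of 2 "?M + 1" "-1" "2 * ?M - 1"] combine[of 2 "?M + 1" "-1" "2 * ?M + 1"]
        combine[of 1 "?M + 2" "-1" "?M + 1"] combine[of 1 "2 * ?M + 1" "-1" "2 * ?M - 1"]
        combine[of 2 "?M + 2" "-1" "2 * ?M - 1"] combine[of 2 "?M + 2" "-1" "2 * ?M + 1"]
        combine[of "-2" "?M - 1" "1" "2 * ?M - 1"]
      by (auto simp: algebra_simps)
  qed
qed

lemma sum_inverse_prime_factors_moser:
  assumes "odd m" "m > 2"
  shows "(\<Sum>i<5. \<Sum>p\<in>prime_factors (moser_factor m i). 1 / real p) \<le>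
           (\<Sum>p\<in>prime_factors (\<Prod>i<5. moser_factor m i). 1 / real p)
             + (if m mod 3 = 2 then 31 / 30 else 41 / 30)"
proof -
  define X where "X = (\<Prod>i<5. moser_factor m i)"
  have pos: "moser_factor m i > 0" if "i < 5" for i
    using that assms by (auto simp: moser_factor_def less_Suc_eq eval_nat_numeral)
  have X: "X > 0" unfolding X_def using pos by (intro prod_pos) auto
  have "(\<Sum>p\<in>prime_factors (moser_factor m i). 1 / real p) =
        (\<Sum>p\<in>prime_factors X. of_bool (p dvd moser_factor m i) / real p)" if "i < 5" for i
  proof (rule sum.mono_neutral_cong_left)
    have "moser_factor m i dvd X" unfolding X_def using that by (intro dvd_prodI) auto
    thus "prime_factors (moser_factor m i) \<subseteq> prime_factors X"
      using X by (intro dvd_prime_factors) auto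
  qed (use pos[OF that] in \<open>auto simp: in_prime_factors_iff\<close>)
  hence "(\<Sum>i<5. \<Sum>p\<in>prime_factors (moser_factor m i). 1 / real p) =
        (\<Sum>i<5. \<Sum>p\<in>prime_factors X. of_bool (p dvd moser_factor m i) / real p)"
    by (rule sum.cong[OF refl]) simp
  also have "\<dots> = (\<Sum>p\<in>prime_factors X. real (\<Sum>i<5. of_bool (p dvd moser_factor m i)) / real p)"
    by (subst sum.swap) (simp only: sum_divide_distrib of_nat_sum of_nat_of_bool)
  also have "\<dots> \<le> (\<Sum>p\<in>prime_factors X. real (1 + of_bool (p = 2) +
                    (if m mod 3 = 2 then 1 else 2) * of_bool (p = 3) + of_bool (p = 5)) / real p)"
    by (intro sum_mono divide_right_mono of_nat_mono moser_factors_common_prime assms)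
       (auto simp: in_prime_factors_iff)
  also have "\<dots> = (\<Sum>p\<in>prime_factors X. 1 / real p) + (\<Sum>p\<in>prime_factors X. if p = 2 then 1 / 2 else 0)
      + (\<Sum>p\<in>prime_factors X. if p = 3 then (if m mod 3 = 2 then 1 / 3 else 2 / 3) else 0)
      + (\<Sum>p\<in>prime_factors X. if p = 5 then 1 / 5 else 0)"
    unfolding sum.distrib [symmetric] by (intro sum.cong refl) auto
  also have "\<dots> \<le> (\<Sum>p\<in>prime_factors X. 1 / real p) + 1 / 2 + (if m mod 3 = 2 then 1 / 3 else 2 / 3) + 1 / 5"
    by (intro add_mono order.refl) (auto simp: sum.delta)
  finally show ?thesis by (simp add: X_def split: if_splits)
qed

lemma sum_ln_prime_factors_le:
  assumes "X > 0"
  shows "(\<Sum>p\<in>prime_factors X. ln (real p)) \<le> ln (real X)"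
proof -
  have "(\<Prod>p\<in>prime_factors X. p) \<le> (\<Prod>p\<in>prime_factors X. p ^ multiplicity p X)"
  proof (intro prod_mono conjI)
    fix p assume "p \<in> prime_factors X"
    hence "p > 0" "multiplicity p X > 0"
      using assms by (auto simp: prime_factors_multiplicity prime_gt_0_nat)
    thus "p \<le> p ^ multiplicity p X" by (intro self_le_power) auto
  qed auto
  also have "\<dots> = X" using assms by (simp add: prod_prime_factors)
  finally have le: "real (\<Prod>p\<in>prime_factors X. p) \<le> real X" by (rule of_nat_mono)
  have "(\<Sum>p\<in>prime_factors X. ln (real p)) = ln (real (\<Prod>p\<in>prime_factors X. p))"
    unfolding of_nat_prod by (subst ln_prod) (auto simp: in_prime_factors_iff prime_gt_0_nat)
  also have "\<dots> \<le> ln (real X)"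
    using le assms by (intro ln_mono) (auto simp: in_prime_factors_iff prime_gt_0_nat intro!: prod_pos)
  finally show ?thesis .
qed

text \<open>
  Without a special prime, the reciprocals of the primes in the product of the five numbers would
  add up to at least \<open>3.633...\<close> or \<open>3.966...\<close>, less \<open>9 / (m - 1)\<close>.  For \<open>m \<ge> 10 ^ 6\<close> this contradicts the bound
  \<open>3.629\<close> or \<open>3.9657\<close>; for smaller \<open>m\<close>, where \<open>m \<ge> 26\<close>, it contradicts the bound \<open>3\<close>.
\<close>

theorem exists_special_prime_divisor:
  assumes N: "24 dvd N" "N dvd int k" "k > 0"
    and sol: "erdos_moser_solution m k" "m > 0"
    and m: "m < 10 ^ E" "real E \<le> 10 ^ 11 \<or> m mod 3 = 2 \<and> real E \<le> 10 ^ 16"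
  shows "\<exists>p. special_prime_divisor N m k p"
proof (rule ccontr)
  assume none: "\<nexists>p. special_prime_divisor N m k p"
  have "24 dvd int k" using N(1,2) by (rule dvd_trans)
  hence "int 24 dvd int k" by simp
  hence k24: "24 dvd k" by (simp only: int_dvd_int_iff)
  have ev: "even k" and k6: "6 dvd k" using k24 by presburger+
  have evN: "even N" using N(1) by presburger
  have k: "power_sum k m = int m ^ k" using sol(1) N(3) by (rule solution_power_sum)
  have "k \<ge> 24" using k24 N(3) by (auto dest: dvd_imp_le)
  moreover have "m > k + 1" using power_sum_less[of k m] k N(3) sol(2) by (cases "m \<le> k + 1") auto
  ultimately have m26: "m \<ge> 26" by linarith
  have odd: "odd m" using k ev N(3) sol(2) by (rule odd_solution)
  have special: "(p - 1) dvd k" if "prime p" "p > 3" "p dvd m + 2" for p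
    using special_prime_divisorI[OF k ev N(2) evN that] none by blast
  have m2: "m > 2" using m26 by simp
  note int = solution_integrality[OF k k6 N(3) m2 special]
  define X where "X = (\<Prod>i<5. moser_factor m i)"
  let ?\<sigma> = "\<lambda>n. \<Sum>p\<in>prime_factors n. 1 / real p"
  (* the amounts by which the five sums may fall short of 1 *)
  define \<epsilon> where "\<epsilon> = 1 / real (m - 1) + 2 / real (m + 1) + 2 / real (2 * m - 1)
                     + 4 / real (2 * m + 1) + 3 / real (m + 2)"
  have "5 - \<epsilon> \<le> (\<Sum>i<5. ?\<sigma> (moser_factor m i))"
    unfolding sum_moser_factors[of ?\<sigma> m] \<epsilon>_def
    using integral_reciprocal_sum_ge_1[OF int(1)] integral_reciprocal_sum_ge_1[OF int(2)]
      integral_reciprocal_sum_ge_1[OF int(3)] integral_reciprocal_sum_ge_1[OF int(4)]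
      integral_reciprocal_sum_ge_1[OF int(5)] m2 by simp
  also have "\<dots> \<le> ?\<sigma> X + (if m mod 3 = 2 then 31 / 30 else 41 / 30)"
    unfolding X_def using odd m2 by (rule sum_inverse_prime_factors_moser)
  finally have lower: "5 - \<epsilon> \<le> ?\<sigma> X + (if m mod 3 = 2 then 31 / 30 else 41 / 30)" .
  have \<epsilon>: "\<epsilon> \<le> 9 / real (m - 1)"
  proof -
    have "2 / real (m + 1) \<le> 2 / real (m - 1)" "2 / real (2 * m - 1) \<le> 1 / real (m - 1)"
      "4 / real (2 * m + 1) \<le> 2 / real (m - 1)" "3 / real (m + 2) \<le> 3 / real (m - 1)"
      using m2 by (auto simp: field_simps of_nat_diff)
    thus ?thesis unfolding \<epsilon>_def by (simp add: add_divide_distrib [symmetric])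
  qed
  have X0: "X > 0" unfolding X_def prod_moser_factors using m2 by simp
  have lnX: "ln (real X) \<le> 3 * ln 2 + 5 * ln (real m)"
  proof -
    obtain l where l: "m = Suc l" using m2 by (cases m) auto
    have "X = ((m - 1) * (m + 1)) * ((2 * m - 1) * (2 * m + 1)) * (m + 2)"
      unfolding X_def prod_moser_factors by (simp only: mult.assoc)
    also have "\<dots> \<le> (m * m) * ((2 * m) * (2 * m)) * (2 * m)"
    proof (rule mult_le_mono[OF mult_le_mono])
      show "(m - 1) * (m + 1) \<le> m * m" "(2 * m - 1) * (2 * m + 1) \<le> (2 * m) * (2 * m)"
        by (simp_all add: l algebra_simps)
      show "m + 2 \<le> 2 * m" using m2 by simp
    qed
    also have "\<dots> = 2 ^ 3 * m ^ 5" by (simp add: numeral_eq_Suc algebra_simps)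
    finally have "real X \<le> real (2 ^ 3 * m ^ 5)" by (rule of_nat_mono)
    hence "ln (real X) \<le> ln (2 ^ 3 * real m ^ 5)" using X0 by (intro ln_mono) auto
    also have "\<dots> = 3 * ln 2 + 5 * ln (real m)"
      using m2 ln_realpow[of "2::real" 3] ln_realpow[of "real m" 5] by (simp add: ln_mult)
    finally show ?thesis .
  qed
  have upper: "(\<Sum>p\<in>prime_factors X. ln (real p)) \<le> 3 * ln 2 + 5 * ln (real m)"
    using sum_ln_prime_factors_le[OF X0] lnX by linarith
  have U: "finite (prime_factors X)" "\<And>p. p \<in> prime_factors X \<Longrightarrow> prime p" by auto
  have lnm: "ln (real m) \<le> real E * ln 10"
  proof -
    have "real m < 10 ^ E" using m(1) by (metis of_nat_less_iff of_nat_numeral of_nat_power)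
    hence "ln (real m) < ln (10 ^ E)" using m2 by (subst ln_less_cancel_iff) auto
    thus ?thesis by (simp add: ln_realpow)
  qed
  show False
  proof (cases "m < 10 ^ 6")
    case True
    have "ln (real m) \<le> ln (10 ^ 6)" using True m2 by (subst ln_le_cancel_iff) auto
    also have "\<dots> = 6 * ln (10::real)" using ln_realpow[of "10::real" 6] by simp
    finally have "?\<sigma> X < 3"
      using upper ln_10_le ln_2_le by (intro sum_inverse_primes_numeric_bounds(3)[OF U]) auto
    moreover have "9 / real (m - 1) \<le> 9 / 25" using m26 by (intro divide_left_mono) auto
    ultimately show False using lower \<epsilon> by (auto split: if_splits)
  next
    case False
    have "9 / real (m - 1) \<le> 9 / 999999" using False by (intro divide_left_mono) auto
    moreover have "?\<sigma> X < (if m mod 3 = 2 then 39657 / 10000 else 3629 / 1000)"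
    proof -
      have bound: "real E * ln 10 \<le> b * (23027 / 10000)" if "real E \<le> b" for b
        using that ln_10_le by (intro mult_mono) auto
      show ?thesis
      proof (cases "m mod 3 = 2")
        case True
        have "real E \<le> 10 ^ 16" using m(2) by auto
        hence "(\<Sum>p\<in>prime_factors X. ln (real p)) \<le> 12 * 10 ^ 16"
          using upper lnm bound[of "10 ^ 16"] ln_2_le by simp
        thus ?thesis using sum_inverse_primes_numeric_bounds(1)[OF U] True by simp
      next
        case False
        hence "real E \<le> 10 ^ 11" using m(2) by auto
        hence "(\<Sum>p\<in>prime_factors X. ln (real p)) \<le> 12 * 10 ^ 11"
          using upper lnm bound[of "10 ^ 11"] ln_2_le by simp
        thus ?thesis using sum_inverse_primes_numeric_bounds(2)[OF U] False by simp
      qed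
    qed
    ultimately show False using lower \<epsilon> by (auto split: if_splits)
  qed
qed

section \<open>The equation modulo 6079\<close>

text \<open>
  In \<open>i * (k choose i) = k * (k - 1 choose i - 1)\<close> the factor \<open>i\<close> can cancel at most \<open>i - 2\<close> factors
  \<open>p\<close> of \<open>k\<close>, because \<open>p \<ge> 3\<close>; the power \<open>m ^ i\<close> makes up for this and for one more factor.
\<close>

lemma prime_power_dvd_binomial_term:
  fixes p :: nat
  assumes p: "prime p" "p \<ge> 3" and i: "2 \<le> i" "i \<le> k"
    and a: "a \<ge> 1" "p ^ a dvd m" and e: "p ^ e dvd k"
  shows "p ^ Suc (a + e) dvd (k choose i) * m ^ i"
proof -
  define f where "f = multiplicity p i"
  have C: "k choose i > 0" using i by (simp add: zero_less_binomial)
  have "p ^ e dvd i * (k choose i)"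
    using e i times_binomial_minus1_eq[of i k] by simp
  hence "e \<le> multiplicity p (i * (k choose i))"
    using i C p by (intro multiplicity_geI) (auto simp: prime_gt_1_nat)
  also have "\<dots> = f + multiplicity p (k choose i)"
    unfolding f_def using p i C by (intro prime_elem_multiplicity_mult_distrib) auto
  finally have "p ^ (e - f) dvd k choose i"
    by (intro multiplicity_dvd') simp
  moreover have "p ^ (a * i) dvd m ^ i"
    using a(2) by (simp add: power_mult dvd_power_same)
  ultimately have "p ^ ((e - f) + a * i) dvd (k choose i) * m ^ i"
    unfolding power_add by (rule mult_dvd_mono)
  moreover have "Suc (a + e) \<le> (e - f) + a * i"
  proof -
    have "f + 2 \<le> i"
    proof (cases f)
      case (Suc f')
      have "Suc x + 2 \<le> 3 ^ Suc x" for x :: nat by (induction x) auto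
      hence "f + 2 \<le> 3 ^ f" using Suc by blast
      also have "\<dots> \<le> p ^ f" using p(2) by (intro power_mono) auto
      also have "\<dots> \<le> i"
        unfolding f_def using i by (intro dvd_imp_le multiplicity_dvd) auto
      finally show ?thesis .
    qed (use i in simp)
    moreover obtain i' where i': "i = Suc i'" using i by (cases i) auto
    moreover have "i' \<le> a * i'" using a by (cases a) auto
    ultimately show ?thesis unfolding i' mult_Suc_right by linarith
  qed
  ultimately show ?thesis by (meson dvd_trans le_imp_power_dvd)
qed

text \<open>
  If \<open>a\<close> and \<open>e\<close> are the exact exponents of \<open>p\<close> in \<open>m\<close> and \<open>k\<close>, the modulus exceeds the power of \<open>p\<close>
  in \<open>k * m\<close> by one factor \<open>p\<close>, which is the precision at which
  \<open>k * m * x ^ (k - 1)\<close> can be detected even when \<open>p\<close> divides \<open>k\<close>.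
\<close>

lemma shifted_power_cong:
  fixes x :: int
  assumes p: "prime p" "p \<ge> 3" and k: "k \<ge> 2"
    and a: "a \<ge> 1" "p ^ a dvd m" and e: "p ^ e dvd k"
  shows "[(x - int m) ^ k = x ^ k - int k * int m * x ^ (k - 1)] (mod int p ^ Suc (a + e))"
proof -
  have "(x - int m) ^ k = (\<Sum>i\<le>k. of_nat (k choose i) * (- int m) ^ i * x ^ (k - i))"
    using binomial_ring[of "- int m" x k] by (simp add: add.commute)
  also have "\<dots> = (\<Sum>i\<in>{..k} - {0, 1}. of_nat (k choose i) * (- int m) ^ i * x ^ (k - i))
                 + (x ^ k - int k * int m * x ^ (k - 1))"
    using k by (subst sum.subset_diff[of "{0, 1}"]) auto
  finally have eq: "(x - int m) ^ k - (x ^ k - int k * int m * x ^ (k - 1)) =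
      (\<Sum>i\<in>{..k} - {0, 1}. of_nat (k choose i) * (- int m) ^ i * x ^ (k - i))" by simp
  have "int p ^ Suc (a + e) dvd \<dots>"
  proof (intro dvd_sum)
    fix i assume i: "i \<in> {..k} - {0, 1}"
    hence "p ^ Suc (a + e) dvd (k choose i) * m ^ i"
      using p a e by (intro prime_power_dvd_binomial_term) auto
    hence "int (p ^ Suc (a + e)) dvd int ((k choose i) * m ^ i)" by (simp only: int_dvd_int_iff)
    hence "int p ^ Suc (a + e) dvd (-1) ^ i * (int (k choose i) * int m ^ i) * x ^ (k - i)"
      by (intro dvd_mult2[OF dvd_mult]) simp
    thus "int p ^ Suc (a + e) dvd of_nat (k choose i) * (- int m) ^ i * x ^ (k - i)"
      by (simp add: power_minus[of "int m"] mult_ac)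
  qed
  thus ?thesis unfolding cong_iff_dvd_diff eq .
qed

text \<open>
  Let \<open>A\<close> and \<open>B\<close> be the sums of \<open>j ^ k\<close> and \<open>j ^ (k - 1)\<close> over \<open>j \<le> h = (m - 1) / 2\<close>.  Pairing \<open>j\<close> with
  \<open>m - j\<close> gives \<open>S = 2 A - k m B\<close>, and pairing \<open>2 j\<close> with \<open>m - 2 j\<close> gives
  \<open>S = 2 ^ (k + 1) A - 2 ^ (k - 1) k m B\<close>, both modulo one factor \<open>p\<close> more than \<open>k m\<close> contains.
  Eliminating \<open>A\<close> expresses \<open>2 ^ (k - 1) k m B\<close> through \<open>S = m ^ k\<close>, which vanishes at this
  precision; so \<open>p\<close> divides \<open>B\<close>.
\<close>

lemma prime_dvd_solution:
  assumes k: "power_sum k m = int m ^ k" "even k" "k > 0"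
    and p: "prime p" "p \<ge> 3" "p dvd m" and m: "odd m"
  shows "int p dvd (\<Sum>j = 1..<(p + 1) div 2. int j ^ (k - 1))"
proof -
  define a where "a = multiplicity p m"
  define e where "e = multiplicity p k"
  define h where "h = (m - 1) div 2"
  define q where "q = int p ^ Suc (a + e)"
  define A where "A = (\<Sum>j = 1..h. int j ^ k)"
  define B where "B = (\<Sum>j = 1..h. int j ^ (k - 1))"
  have m0: "m > 0" and h: "m = 2 * h + 1" using m by (auto simp: h_def elim: oddE)
  have k2: "k \<ge> 2" using k(2,3) by presburger
  have a1: "a \<ge> 1" using p m0 by (simp add: a_def Suc_le_eq prime_multiplicity_gt_zero_iff)
  have pa: "p ^ a dvd m" and pe: "p ^ e dvd k" by (simp_all add: a_def e_def multiplicity_dvd)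
  note shift = shifted_power_cong[OF p(1,2) k2 a1 pa pe, folded q_def]
  have S: "power_sum k m = (\<Sum>j = 1..2 * h. int j ^ k)"
    unfolding power_sum_def h using k(3)
    by (intro sum.mono_neutral_cong_right) (auto simp: Suc_le_eq)
  \<comment> \<open>pairing \<open>j\<close> with \<open>m - j\<close>\<close>
  have "power_sum k m = A + (\<Sum>j = 1..h. (int j - int m) ^ k)"
  proof -
    have "(\<Sum>j = 1..2 * h. int j ^ k) = A + (\<Sum>j = h + 1..2 * h. int j ^ k)"
      unfolding A_def by (subst sum.union_disjoint [symmetric]) (auto intro!: sum.cong)
    also have "(\<Sum>j = h + 1..2 * h. int j ^ k) = (\<Sum>j = 1..h. (int j - int m) ^ k)"
    proof (rule sum.reindex_bij_witness[of _ "\<lambda>j. m - j" "\<lambda>j. m - j"])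
      fix j assume j: "j \<in> {h + 1..2 * h}"
      have "(int (m - j) - int m) ^ k = (- int j) ^ k" using j h by (simp add: of_nat_diff)
      thus "(int (m - j) - int m) ^ k = int j ^ k" using k(2) by simp
    qed (use h in auto)
    finally show ?thesis using S by simp
  qed
  also have "[\<dots> = A + (\<Sum>j = 1..h. int j ^ k - int k * int m * int j ^ (k - 1))] (mod q)"
    by (intro cong_add cong_refl cong_sum shift)
  also have "A + (\<Sum>j = 1..h. int j ^ k - int k * int m * int j ^ (k - 1)) = 2 * A - int k * int m * B"
    by (simp add: A_def B_def sum_subtractf sum_distrib_left)
  finally have 1: "[power_sum k m = 2 * A - int k * int m * B] (mod q)" .
  \<comment> \<open>pairing the even numbers \<open>2 * j\<close> with the odd numbers \<open>m - 2 * j\<close>\<close>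
  have "power_sum k m = (\<Sum>j = 1..h. int (2 * j) ^ k) + (\<Sum>j = 1..h. (int (2 * j) - int m) ^ k)"
  proof -
    have "(\<Sum>j = 1..2 * h. int j ^ k) = (\<Sum>j\<in>{1..2 * h} \<inter> {j. even j}. int j ^ k) +
            (\<Sum>j\<in>{1..2 * h} - {j. even j}. int j ^ k)"
      by (rule sum.Int_Diff) auto
    also have "(\<Sum>j\<in>{1..2 * h} \<inter> {j. even j}. int j ^ k) = (\<Sum>j = 1..h. int (2 * j) ^ k)"
      by (rule sum.reindex_bij_witness[of _ "\<lambda>j. 2 * j" "\<lambda>j. j div 2"]) auto
    also have "(\<Sum>j\<in>{1..2 * h} - {j. even j}. int j ^ k) = (\<Sum>j = 1..h. (int (2 * j) - int m) ^ k)"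
    proof (rule sum.reindex_bij_witness[of _ "\<lambda>j. m - 2 * j" "\<lambda>j. (m - j) div 2"])
      fix j assume j: "j \<in> {1..2 * h} - {j. even j}"
      hence "2 * ((m - j) div 2) = m - j" using m h by auto
      hence "(int (2 * ((m - j) div 2)) - int m) ^ k = (- int j) ^ k" using j h by (simp add: of_nat_diff)
      thus "(int (2 * ((m - j) div 2)) - int m) ^ k = int j ^ k" using k(2) by simp
    next
      fix j assume "j \<in> {1..2 * h} - {j. even j}"
      thus "m - 2 * ((m - j) div 2) = j" using m h by auto
      obtain b where b: "j = 2 * b + 1" using \<open>j \<in> _\<close> by (auto elim: oddE)
      have "m - j = 2 * (h - b)" "b < h" using \<open>j \<in> _\<close> h b by auto
      thus "(m - j) div 2 \<in> {1..h}" by simp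
    qed (use h in auto)
    finally show ?thesis using S by simp
  qed
  also have "[\<dots> = (\<Sum>j = 1..h. int (2 * j) ^ k)
      + (\<Sum>j = 1..h. int (2 * j) ^ k - int k * int m * int (2 * j) ^ (k - 1))] (mod q)"
    by (intro cong_add cong_refl cong_sum shift)
  also have "(\<Sum>j = 1..h. int (2 * j) ^ k)
      + (\<Sum>j = 1..h. int (2 * j) ^ k - int k * int m * int (2 * j) ^ (k - 1)) =
      2 ^ k * (2 * A) - int k * int m * (2 ^ (k - 1) * B)"
    by (simp add: A_def B_def sum_subtractf sum_distrib_left power_mult_distrib mult_ac)
  finally have 2: "[power_sum k m = 2 ^ k * (2 * A) - int k * int m * (2 ^ (k - 1) * B)] (mod q)" .
  have k': "(2::int) ^ k = 2 * 2 ^ (k - 1)" using k(3) by (cases k) auto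
  have "[2 ^ k * power_sum k m - power_sum k m =
      2 ^ k * (2 * A - int k * int m * B) - (2 ^ k * (2 * A) - int k * int m * (2 ^ (k - 1) * B))] (mod q)"
    by (intro cong_diff cong_scalar_left 1 2)
  also have "2 ^ k * (2 * A - int k * int m * B) - (2 ^ k * (2 * A) - int k * int m * (2 ^ (k - 1) * B)) =
      - (int k * int m * (2 ^ (k - 1) * B))"
    unfolding k' by (simp add: algebra_simps)
  finally have 3: "[2 ^ k * power_sum k m - power_sum k m = - (int k * int m * (2 ^ (k - 1) * B))] (mod q)" .
  have "q dvd int m ^ k"
  proof -
    have "Suc x + 2 \<le> 3 ^ Suc x" for x :: nat by (induction x) auto
    hence "e + 2 \<le> k" if "e > 0"
    proof -
      have "e + 2 \<le> 3 ^ e" using that \<open>\<And>x. Suc x + 2 \<le> 3 ^ Suc x\<close>[of "e - 1"] by simp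
      also have "\<dots> \<le> p ^ e" using p(2) by (intro power_mono) auto
      also have "\<dots> \<le> k" using pe k(3) by (intro dvd_imp_le)
      finally show ?thesis .
    qed
    hence ek: "e + 2 \<le> k" using k2 by (cases "e = 0") auto
    obtain k0 where k0: "k = Suc k0" using k2 by (cases k) auto
    have "k0 \<le> a * k0" using a1 by (cases a) auto
    hence "Suc (a + e) \<le> a * k" using ek unfolding k0 mult_Suc_right by linarith
    hence "p ^ Suc (a + e) dvd p ^ (a * k)" by (rule le_imp_power_dvd)
    also have "\<dots> dvd m ^ k" using pa by (simp add: power_mult dvd_power_same)
    finally have "int (p ^ Suc (a + e)) dvd int (m ^ k)" by (simp only: int_dvd_int_iff)
    thus ?thesis by (simp add: q_def)
  qed
  hence "q dvd 2 ^ k * power_sum k m - power_sum k m" unfolding k(1) by (intro dvd_diff dvd_mult)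
  hence q_dvd: "q dvd int k * int m * (2 ^ (k - 1) * B)" using 3 by (simp add: cong_dvd_iff)
  have pB: "int p dvd B"
  proof (rule ccontr)
    assume np: "\<not>int p dvd B"
    have "\<not>int p dvd int 2" using p(2) by (simp only: int_dvd_int_iff) (auto dest: dvd_imp_le)
    hence "\<not>int p dvd 2 ^ (k - 1)" using p(1) prime_dvd_power[of "int p" 2 "k - 1"] by auto
    hence "\<not>int p dvd 2 ^ (k - 1) * B" using np p(1) by (simp add: prime_dvd_mult_iff)
    hence cop: "coprime q (2 ^ (k - 1) * B)"
      unfolding q_def using p(1) prime_imp_coprime[of "int p" "2 ^ (k - 1) * B"]
      by (intro coprime_power_left_iff[THEN iffD2] disjI1) simp_all
    hence "q dvd int k * int m" using q_dvd by (simp add: coprime_dvd_mult_left_iff)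
    hence "int (p ^ Suc (a + e)) dvd int (k * m)" by (simp add: q_def)
    hence "p ^ Suc (a + e) dvd k * m" by (simp only: int_dvd_int_iff)
    hence "Suc (a + e) \<le> multiplicity p (k * m)"
      using m0 k(3) p by (intro multiplicity_geI) (auto simp: prime_gt_1_nat)
    also have "\<dots> = e + a"
      unfolding a_def e_def using p m0 k(3) by (intro prime_elem_multiplicity_mult_distrib) auto
    finally show False by simp
  qed
  \<comment> \<open>\<open>B\<close> consists of full residue systems modulo \<open>p\<close> and one half\<close>
  obtain w where w: "m = p * w" using p(3) by auto
  have podd: "odd p" and wodd: "odd w" using w m by auto
  obtain v where v: "w = 2 * v + 1" using wodd by (auto elim: oddE)
  obtain g where g: "p = 2 * g + 1" using podd by (auto elim: oddE)
  have hg: "h = p * v + g" using h w v g by (simp add: algebra_simps)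
  have k1: "k - 1 > 0" using k2 by simp
  have "B = (\<Sum>j<p * v + Suc g. int j ^ (k - 1))"
    unfolding B_def hg using k1 by (intro sum.mono_neutral_cong_left) (auto simp: Suc_le_eq)
  also have "\<dots> = power_sum (k - 1) (p * v) + (\<Sum>j<Suc g. int (p * v + j) ^ (k - 1))"
    unfolding power_sum_def lessThan_atLeast0
    using sum.atLeastLessThan_concat[of 0 "p * v" "p * v + Suc g" "\<lambda>j. int j ^ (k - 1)"]
      sum.shift_bounds_nat_ivl[of "\<lambda>j. int j ^ (k - 1)" 0 "p * v" "Suc g"]
    by (simp add: add.commute)
  also have "[\<dots> = 0 + (\<Sum>j<Suc g. int j ^ (k - 1))] (mod int p)"
  proof (intro cong_add cong_sum cong_pow)
    have "\<not>(p - 1) dvd k - 1"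
    proof
      assume "(p - 1) dvd k - 1"
      moreover have "even (p - 1)" using podd by simp
      ultimately have "even (k - 1)" by (rule dvd_trans[rotated])
      thus False using k(2) k1 by simp
    qed
    hence "int p dvd power_sum (k - 1) p" by (rule power_sum_prime_not_dvd[OF p(1)])
    hence "int p dvd int v * power_sum (k - 1) p" by simp
    thus "[power_sum (k - 1) (p * v) = 0] (mod int p)"
      using power_sum_mult_cong[of "k - 1" p v] cong_trans cong_0_iff by blast
    show "[int (p * v + j) = int j] (mod int p)" for j by (simp add: cong_iff_dvd_diff)
  qed
  also have "0 + (\<Sum>j<Suc g. int j ^ (k - 1)) = (\<Sum>j = 1..<(p + 1) div 2. int j ^ (k - 1))"
    unfolding add_0 using k1 g by (intro sum.mono_neutral_cong_right) (auto simp: Suc_le_eq)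
  finally show ?thesis using pB by (simp add: cong_dvd_iff)
qed

primrec halve :: "num \<Rightarrow> num" where
  "halve num.One = num.One"
| "halve (num.Bit0 n) = n"
| "halve (num.Bit1 n) = n"

text \<open>
  Division by \<open>2 ^ 22\<close> on the binary representation; a value that would vanish becomes \<open>1\<close>, which is harmless in
  the reduction below.
\<close>

definition drop_22_bits :: "num \<Rightarrow> num" where
  "drop_22_bits x = halve (halve (halve (halve (halve (halve (halve (halve (halve (halve (halve
     (halve (halve (halve (halve (halve (halve (halve (halve (halve (halve (halve x)))))))))))))))))))))"

definition top_bits :: "int \<Rightarrow> int" where
  "top_bits x = (if x \<le> 0 then 0 else numeral (drop_22_bits (num_of_nat (nat x))))"

lemma top_bits_code [code]:
  "top_bits 0 = 0"
  "top_bits (Int.Pos n) = Int.Pos (drop_22_bits n)"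
  "top_bits (Int.Neg n) = 0"
  by (simp_all add: top_bits_def num_of_nat_numeral_eq)

definition normalize_6079 :: "int \<Rightarrow> int" where
  "normalize_6079 x = (if x < 0 then x + 6079 else if x < 6079 then x else x - 6079)"

text \<open>
  Barrett reduction: \<open>690 / 2 ^ 22\<close> approximates \<open>1 / 6079\<close>, so one multiplication and a shift
  yield the quotient.  Any quotient gives the right residue class; the quality of the approximation
  keeps the results small.
\<close>

definition reduce_6079 :: "int \<Rightarrow> int" where
  "reduce_6079 x = (if x < 6079 then x else normalize_6079 (x - 6079 * top_bits (690 * x)))"

definition mult_6079 :: "int \<Rightarrow> int \<Rightarrow> int" where
  "mult_6079 x y = reduce_6079 (x * y)"

definition double_6079 :: "int \<Rightarrow> int" where
  "double_6079 x = mult_6079 x x"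

definition pow83_6079 :: "int \<Rightarrow> int" where
  "pow83_6079 x = mult_6079 x (double_6079 (mult_6079 x (double_6079 (double_6079 (double_6079
     (mult_6079 x (double_6079 (double_6079 x))))))))"

definition pow61_6079 :: "int \<Rightarrow> int" where
  "pow61_6079 x = mult_6079 x (double_6079 (double_6079 (mult_6079 x (double_6079
     (mult_6079 x (double_6079 (mult_6079 x (double_6079 x))))))))"

text \<open>
  In the state \<open>(i, S, X)\<close> of the scan, \<open>S\<close> is \<open>power_sum 5064 i\<close> and \<open>X\<close> the sum of \<open>j ^ 5063\<close> over
  \<open>j < i\<close>, both modulo \<open>6079\<close>; \<open>w\<close> is \<open>i ^ 5064\<close>.  The scan fails if \<open>i\<close> solves the equation or if
  \<open>S + 2 w\<close> vanishes, which would mean that \<open>6079 - i\<close> solves it.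
\<close>

definition scan_aux2 :: "int \<Rightarrow> int \<Rightarrow> int \<Rightarrow> int \<Rightarrow> (int \<times> int \<times> int) option" where
  "scan_aux2 i S X w =
     (if S \<noteq> w \<and> S + 2 * w \<noteq> 0 \<and> S + 2 * w \<noteq> 6079 \<and> S + 2 * w \<noteq> 12158 \<and> 0 \<le> w \<and> w < 6079
      then Some (i + 1, normalize_6079 (S + w), X) else None)"

definition scan_aux1 :: "int \<Rightarrow> int \<Rightarrow> int \<Rightarrow> int \<Rightarrow> (int \<times> int \<times> int) option" where
  "scan_aux1 i S X v = scan_aux2 i S (normalize_6079 (X + v)) (mult_6079 i v)"

fun scan_step :: "(int \<times> int \<times> int) option \<Rightarrow> (int \<times> int \<times> int) option" where
  "scan_step None = None"
| "scan_step (Some (i, S, X)) =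
     (if i \<le> 3039 then scan_aux1 i S X (pow61_6079 (pow83_6079 i)) else Some (i, S, X))"

text \<open>
  \<open>2 ^ d\<close> steps; doubling keeps the recursion shallow.  Steps beyond \<open>i = 3039\<close> do nothing.
\<close>

fun scan_steps :: "nat \<Rightarrow> (int \<times> int \<times> int) option \<Rightarrow> (int \<times> int \<times> int) option" where
  "scan_steps 0 s = scan_step s"
| "scan_steps (Suc d) s = scan_steps d (scan_steps d s)"

lemma scan_result: "scan_steps 12 (Some (1, 0, 0)) = Some (3040, 0, 1841)"
  by code_simp

lemma normalize_cong: "[normalize_6079 x = x] (mod 6079)"
  by (simp add: normalize_6079_def cong_iff_dvd_diff)

lemma reduce_cong: "[reduce_6079 x = x] (mod 6079)"
proof -
  have "[normalize_6079 (x - 6079 * q) = x] (mod 6079)" for q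
    by (rule cong_trans[OF normalize_cong]) (simp add: cong_iff_dvd_diff)
  thus ?thesis by (simp add: reduce_6079_def)
qed

lemma mult_6079_cong:
  assumes "[x = a ^ i] (mod 6079)" "[y = a ^ j] (mod 6079)"
  shows "[mult_6079 x y = a ^ (i + j)] (mod 6079)"
  unfolding mult_6079_def power_add using reduce_cong cong_mult[OF assms] cong_trans by blast

lemma double_6079_cong:
  "[x = a ^ i] (mod 6079) \<Longrightarrow> [double_6079 x = a ^ (i + i)] (mod 6079)"
  unfolding double_6079_def by (rule mult_6079_cong)

lemma pow61_pow83_cong: "[pow61_6079 (pow83_6079 x) = x ^ 5063] (mod 6079)"
proof -
  have 83: "[pow83_6079 x = x ^ 83] (mod 6079)" if "[x = x ^ 1] (mod 6079)"
  proof -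
    note a = mult_6079_cong[OF that] and d = double_6079_cong
    show ?thesis unfolding pow83_6079_def
      using a[OF d[OF a[OF d[OF d[OF d[OF a[OF d[OF d[OF that]]]]]]]]]
      by (simp only: arith_simps one_add_one one_plus_numeral numeral_plus_one add_num_simps)
  qed
  have 61: "[pow61_6079 y = x ^ 5063] (mod 6079)" if "[y = x ^ 83] (mod 6079)" for y
  proof -
    note a = mult_6079_cong[OF that] and d = double_6079_cong
    show ?thesis unfolding pow61_6079_def
      using a[OF d[OF d[OF a[OF d[OF a[OF d[OF a[OF d[OF that]]]]]]]]]
      by (simp only: arith_simps one_add_one one_plus_numeral numeral_plus_one add_num_simps)
  qed
  show ?thesis by (intro 61 83) simp
qed

definition scan_invariant :: "int \<times> int \<times> int \<Rightarrow> bool" where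
  "scan_invariant s \<longleftrightarrow> (case s of (i, S, X) \<Rightarrow>
     1 \<le> i \<and> 0 \<le> S \<and> S < 6079 \<and>
     [S = power_sum 5064 (nat i)] (mod 6079) \<and>
     [X = (\<Sum>j = 1..<nat i. int j ^ 5063)] (mod 6079) \<and>
     (\<forall>a\<in>{1..<nat i}. \<not>[power_sum 5064 a = int a ^ 5064] (mod 6079) \<and>
                     \<not>[power_sum 5064 a + 2 * int a ^ 5064 = 0] (mod 6079)))"

lemma scan_step_invariant:
  assumes "scan_invariant s" "scan_step (Some s) = Some s'"
  shows "scan_invariant s'"
proof -
  obtain i S X where s: "s = (i, S, X)" by (cases s) auto
  show ?thesis
  proof (cases "i \<le> 3039")
    case False
    thus ?thesis using assms s by simp
  next
    case True
    define v where "v = pow61_6079 (pow83_6079 i)"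
    define w where "w = mult_6079 i v"
    note inv = assms(1)[unfolded scan_invariant_def s prod.case]
    have s': "s' = (i + 1, normalize_6079 (S + w), normalize_6079 (X + v))"
      and w: "S \<noteq> w" "S + 2 * w \<noteq> 0" "S + 2 * w \<noteq> 6079" "S + 2 * w \<noteq> 12158" "0 \<le> w" "w < 6079"
      using assms(2) True unfolding s scan_step.simps scan_aux1_def scan_aux2_def v_def w_def
      by (auto split: if_splits)
    have i: "int (nat i) = i" "nat (i + 1) = Suc (nat i)" using inv by auto
    have v: "[v = i ^ 5063] (mod 6079)" unfolding v_def by (rule pow61_pow83_cong)
    have "[w = i ^ (1 + 5063)] (mod 6079)"
      unfolding w_def by (rule mult_6079_cong) (use v in auto)
    hence wi: "[w = i ^ 5064] (mod 6079)"
      by (simp only: one_plus_numeral add_num_simps)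
    have S: "[S = power_sum 5064 (nat i)] (mod 6079)" using inv by blast
    have 1: "\<not>[power_sum 5064 (nat i) = int (nat i) ^ 5064] (mod 6079)"
    proof
      assume "[power_sum 5064 (nat i) = int (nat i) ^ 5064] (mod 6079)"
      hence "[S = w] (mod 6079)" unfolding i using S wi by (meson cong_sym cong_trans)
      thus False using cong_less_imp_eq_int[of S 6079 w] inv w by blast
    qed
    have 2: "\<not>[power_sum 5064 (nat i) + 2 * int (nat i) ^ 5064 = 0] (mod 6079)"
    proof
      assume "[power_sum 5064 (nat i) + 2 * int (nat i) ^ 5064 = 0] (mod 6079)"
      moreover have "[S + 2 * w = power_sum 5064 (nat i) + 2 * int (nat i) ^ 5064] (mod 6079)"
        unfolding i by (intro cong_add cong_scalar_left S wi)
      ultimately have "6079 dvd S + 2 * w" using cong_trans cong_0_iff by blast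
      then obtain c where c: "S + 2 * w = 6079 * c" by auto
      have "0 \<le> S" "S < 6079" using inv by auto
      hence "-1 < c" "c < 3" using c w by auto
      hence "c = 0 \<or> c = 1 \<or> c = 2" by auto
      thus False using c w by auto
    qed
    have "{1..<nat (i + 1)} = insert (nat i) {1..<nat i}" using inv i(2) by auto
    moreover have "[normalize_6079 (S + w) = power_sum 5064 (nat (i + 1))] (mod 6079)"
      unfolding i(2) power_sum_Suc i(1) using normalize_cong cong_add[OF S wi] cong_trans by blast
    moreover have "[normalize_6079 (X + v) = (\<Sum>j = 1..<nat (i + 1). int j ^ 5063)] (mod 6079)"
    proof -
      have "[X = (\<Sum>j = 1..<nat i. int j ^ 5063)] (mod 6079)" using inv by blast
      hence "[X + v = (\<Sum>j = 1..<nat i. int j ^ 5063) + i ^ 5063] (mod 6079)"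
        using v by (rule cong_add)
      also have "(\<Sum>j = 1..<nat i. int j ^ 5063) + i ^ 5063 = (\<Sum>j = 1..<nat (i + 1). int j ^ 5063)"
        unfolding i(2) using inv i(1) by (subst sum.atLeastLessThan_Suc) auto
      finally show ?thesis using normalize_cong cong_trans by blast
    qed
    ultimately show ?thesis
      using 1 2 inv w unfolding scan_invariant_def s' prod.case
      by (auto simp: normalize_6079_def)
  qed
qed

lemma scan_invariant_preserved:
  "scan_invariant s \<Longrightarrow> scan_steps d (Some s) = Some s' \<Longrightarrow> scan_invariant s'"
proof (induction d arbitrary: s s')
  case (Suc d)
  obtain s1 where s1: "scan_steps d (Some s) = Some s1"
  proof (cases "scan_steps d (Some s)")
    case None
    have "scan_steps d None = None" by (induction d) auto
    thus ?thesis using Suc.prems(2) None by simp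
  qed auto
  hence "scan_steps d (Some s1) = Some s'" using Suc.prems(2) by simp
  thus ?case using Suc.IH[OF Suc.IH[OF Suc.prems(1) s1]] by blast
qed (use scan_step_invariant in auto)

lemma no_solution_exponent_5064:
  shows "\<not>int 6079 dvd (\<Sum>j = 1..<3040. int j ^ 5063)"
    and "a \<in> {1..<3040} \<Longrightarrow> \<not>[power_sum 5064 a = int a ^ 5064] (mod 6079)"
    and "a \<in> {1..<3040} \<Longrightarrow> \<not>[power_sum 5064 a + 2 * int a ^ 5064 = 0] (mod 6079)"
proof -
  have "scan_invariant (1, 0, 0)"
    by (simp add: scan_invariant_def power_sum_def)
  hence inv: "scan_invariant (3040, 0, 1841)"
    using scan_result by (rule scan_invariant_preserved)
  thus "a \<in> {1..<3040} \<Longrightarrow> \<not>[power_sum 5064 a = int a ^ 5064] (mod 6079)"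
    and "a \<in> {1..<3040} \<Longrightarrow> \<not>[power_sum 5064 a + 2 * int a ^ 5064 = 0] (mod 6079)"
    by (auto simp: scan_invariant_def)
  have "[1841 = (\<Sum>j = 1..<3040. int j ^ 5063)] (mod 6079)"
    using inv by (auto simp: scan_invariant_def)
  hence "6079 dvd (1841 :: int) \<longleftrightarrow> 6079 dvd (\<Sum>j = 1..<3040. int j ^ 5063)"
    by (rule cong_dvd_iff)
  thus "\<not>int 6079 dvd (\<Sum>j = 1..<3040. int j ^ 5063)" by simp
qed

section \<open>Special primes for the modulus N2\<close>

lemma prime_dvd_N2:
  assumes "prime q" "q \<le> 997"
  shows "int q dvd N2"
proof (cases "q \<ge> 23")
  case True
  have "q dvd (\<Prod>q | prime q \<and> 23 \<le> q \<and> q \<le> 997. q)"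
    using assms True by (intro dvd_prodI) auto
  hence "int q dvd int (\<Prod>q | prime q \<and> 23 \<le> q \<and> q \<le> 997. q)" by (simp only: int_dvd_int_iff)
  thus ?thesis unfolding N2_def by (rule dvd_mult)
next
  case False
  have "q \<in> {2, 3, 5, 7, 11, 13, 17, 19}"
  proof (rule ccontr)
    assume "q \<notin> {2, 3, 5, 7, 11, 13, 17, 19}"
    hence "q = 0 \<or> q = 1 \<or> q = 4 \<or> q = 6 \<or> q = 8 \<or> q = 9 \<or> q = 10 \<or> q = 12 \<or> q = 14 \<or> q = 15 \<or>
        q = 16 \<or> q = 18 \<or> q = 20 \<or> q = 21 \<or> q = 22"
      using False unfolding insert_iff empty_iff by presburger
    moreover have "\<not>prime (4::nat)" "\<not>prime (6::nat)" "\<not>prime (8::nat)" "\<not>prime (9::nat)"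
      "\<not>prime (10::nat)" "\<not>prime (12::nat)" "\<not>prime (14::nat)" "\<not>prime (15::nat)"
      "\<not>prime (16::nat)" "\<not>prime (18::nat)" "\<not>prime (20::nat)" "\<not>prime (21::nat)" "\<not>prime (22::nat)"
      by simp_all
    ultimately show False using assms(1) by auto
  qed
  hence "int q dvd 2^8 * 3^5 * 5^4 * 7^3 * 11^2 * 13^2 * 17^2 * 19^2" by auto
  thus ?thesis unfolding N2_def by (rule dvd_mult2)
qed

lemma six_dvd_N2: "6 dvd N2" and four_dvd_N2: "4 dvd N2"
  unfolding N2_def by (rule dvd_mult2, simp)+

lemma safe_prime_table:
  "list_all (\<lambda>q. q \<in> set [1013, 1019, 1031] \<or>
     list_ex (\<lambda>r. q mod r = 0 \<or> (2 * q + 1) mod r = 0) [2, 3, 5, 7, 11, 13, 17, 19, 23, 29, 31])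
     [998..1048 :: int]"
  by code_simp

text \<open>
  If \<open>2 q\<close> divides \<open>p - 1\<close> with \<open>q \<ge> 998\<close> and \<open>p < 2099\<close>, then \<open>p = 2 q + 1\<close>; this lists the
  possibilities for \<open>q\<close>.
\<close>

lemma safe_primes_between:
  fixes q :: nat
  assumes "998 \<le> q" "q \<le> 1048" "prime q" "prime (2 * q + 1)"
  shows "q \<in> {1013, 1019, 1031}"
proof (rule ccontr)
  assume q: "q \<notin> {1013, 1019, 1031}"
  have "int q \<in> set [998..1048]"
    using assms(1,2) by (simp only: set_upto atLeastAtMost_iff) simp
  hence "int q \<in> set [1013, 1019, 1031] \<or> list_ex (\<lambda>r. int q mod r = 0 \<or> (2 * int q + 1) mod r = 0)
           [2, 3, 5, 7, 11, 13, 17, 19, 23, 29, 31]"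
    using safe_prime_table unfolding list_all_iff by (rule bspec[rotated])
  moreover have "int q \<notin> set [1013, 1019, 1031]" using q by auto
  ultimately have "list_ex (\<lambda>r. int q mod r = 0 \<or> (2 * int q + 1) mod r = 0)
           [2, 3, 5, 7, 11, 13, 17, 19, 23, 29, 31]"
    by (simp only: simp_thms)
  then obtain r :: int where "r \<in> set [2, 3, 5, 7, 11, 13, 17, 19, 23, 29, 31]"
    and r_dvd: "int q mod r = 0 \<or> (2 * int q + 1) mod r = 0"
    unfolding list_ex_iff by (elim bexE)
  hence r: "r \<in> {2, 3, 5, 7, 11, 13, 17, 19, 23, 29, 31}" by simp
  have "r dvd int q \<or> r dvd 2 * int q + 1" using r_dvd by (auto simp: mod_eq_0_iff_dvd)
  moreover have r0: "int (nat r) = r" "nat r > 1" "nat r \<le> 31" using r by auto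
  ultimately have "int (nat r) dvd int q \<or> int (nat r) dvd int (2 * q + 1)"
    by (simp only: of_nat_add of_nat_mult of_nat_numeral of_nat_1)
  hence "nat r dvd q \<or> nat r dvd 2 * q + 1" by (simp only: int_dvd_int_iff)
  hence "nat r = q \<or> nat r = 2 * q + 1"
    using assms(3,4) r0 by (auto simp: prime_nat_iff)
  thus False using assms(1) r0 by linarith
qed

lemma ord_2_odd_if_2_is_square:
  fixes p x :: nat
  assumes "prime p" "p > 2" "p dvd x ^ 2 - 2" "x ^ 2 \<ge> 2"
  shows "ord p 2 dvd (p - 1) div 2"
proof -
  have "odd p" using assms prime_odd_nat by auto
  have cong: "[x ^ 2 = 2] (mod p)" using assms(3,4) by (simp add: cong_altdef_nat)
  have "\<not>p dvd x"
  proof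
    assume "p dvd x"
    hence "p dvd x ^ 2" by (simp add: power2_eq_square)
    hence "p dvd 2" using cong cong_dvd_iff by blast
    thus False using assms(2) by (auto dest: dvd_imp_le)
  qed
  hence "[x ^ (p - 1) = 1] (mod p)" using assms(1) by (rule fermat_theorem[rotated])
  moreover have "p - 1 = 2 * ((p - 1) div 2)" using \<open>odd p\<close> by simp
  ultimately have "[(x ^ 2) ^ ((p - 1) div 2) = 1] (mod p)" by (metis power_mult)
  moreover have "[(x ^ 2) ^ ((p - 1) div 2) = 2 ^ ((p - 1) div 2)] (mod p)" using cong by (rule cong_pow)
  ultimately have "[2 ^ ((p - 1) div 2) = 1] (mod p)" using cong_sym cong_trans by blast
  thus ?thesis by (simp only: ord_divides)
qed

text \<open>
  The order of \<open>2\<close> is \<open>2 u\<close> with all prime factors of \<open>u\<close> beyond \<open>997\<close>, so \<open>u\<close> is one of the three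
  primes in \<open>safe_primes_between\<close>.  Modulo \<open>2039\<close> and \<open>2063\<close> the number \<open>2\<close> is a square, namely of
  \<open>701\<close> and of \<open>631\<close>, and its order is odd.
\<close>

lemma small_special_prime_divisor_N2:
  assumes "special_prime_divisor N2 m k p" "p < 2099"
  shows "p = 2027 \<and> ord p 2 = 2026"
proof -
  have p: "prime p" "p > 3" and gcd: "gcd (int (ord p 2)) N2 = 2"
    using assms(1) by (auto simp: special_prime_divisor_def)
  define t where "t = ord p 2"
  have podd: "odd p" using p prime_odd_nat by auto
  have "t dvd p - 1"
  proof -
    have "\<not>p dvd 2" using p by (auto dest: dvd_imp_le)
    hence "[2 ^ (p - 1) = 1] (mod p)" using p(1) by (intro fermat_theorem)
    thus ?thesis by (simp only: t_def ord_divides)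
  qed
  have "int 2 dvd int t" using gcd unfolding t_def by (metis gcd_dvd1 of_nat_numeral)
  hence "2 dvd t" by (simp only: int_dvd_int_iff)
  then obtain u where u: "t = 2 * u" by auto
  have "u \<noteq> 1"
  proof
    assume "u = 1"
    hence "[2 ^ 2 = 1] (mod p)" unfolding ord_divides using u by (simp add: t_def)
    hence "p dvd 3" by (simp add: cong_altdef_nat)
    thus False using p by (auto dest: dvd_imp_le)
  qed
  then obtain q where q: "prime q" "q dvd u" using prime_factor_nat by blast
  have common: "d dvd 2" if "d dvd t" "int d dvd N2" for d
  proof -
    have "int d dvd gcd (int t) N2" using that by simp
    hence "int d dvd int 2" using gcd by (simp add: t_def)
    thus ?thesis by (simp only: int_dvd_int_iff)
  qed
  have q998: "q \<ge> 998"
  proof (rule ccontr)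
    assume "\<not>q \<ge> 998"
    hence "int q dvd N2" using q by (intro prime_dvd_N2) auto
    moreover have "q dvd t" using q u by simp
    ultimately have "q dvd 2" by (rule common[rotated])
    hence "q = 2" using q(1) by (simp add: primes_dvd_imp_eq)
    hence "4 dvd t" using q u by auto
    hence "4 dvd (2::nat)" using four_dvd_N2 by (intro common) auto
    thus False by simp
  qed
  have "2 * q dvd p - 1" using q u \<open>t dvd p - 1\<close> by (meson dvd_trans mult_dvd_mono dvd_refl)
  then obtain c where c: "p - 1 = 2 * q * c" by auto
  have "c = 1"
  proof -
    have "c \<noteq> 0"
    proof
      assume "c = 0"
      hence "p - 1 = 0" using c by (simp only: mult_0_right)
      thus False using p by simp
    qed
    moreover have "c < 2"
    proof (rule ccontr)
      assume "\<not>c < 2"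
      hence "2 * q * 2 \<le> 2 * q * c" by (intro mult_left_mono) auto
      thus False using c assms(2) q998 by linarith
    qed
    ultimately show ?thesis by simp
  qed
  hence pq: "p = 2 * q + 1" using c p by simp
  have "2 * u dvd 2 * q" using u \<open>t dvd p - 1\<close> pq by simp
  hence "u dvd q" by simp
  hence uq: "u = q" using q(2) by (simp add: dvd_antisym)
  have "q \<in> {1013, 1019, 1031}"
    using q998 q(1) p(1) pq assms(2) by (intro safe_primes_between) auto
  moreover have "q \<noteq> 1019"
  proof
    assume "q = 1019"
    hence p': "p = 2039" using pq by simp
    have "t dvd (p - 1) div 2"
      unfolding t_def by (rule ord_2_odd_if_2_is_square[OF p(1), of 701]) (simp_all add: p')
    also have "(p - 1) div 2 = 1019" by (simp add: p')
    finally have "2 dvd (1019 :: nat)" using \<open>2 dvd t\<close> by (rule dvd_trans[rotated])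
    thus False by simp
  qed
  moreover have "q \<noteq> 1031"
  proof
    assume "q = 1031"
    hence p': "p = 2063" using pq by simp
    have "t dvd (p - 1) div 2"
      unfolding t_def by (rule ord_2_odd_if_2_is_square[OF p(1), of 631]) (simp_all add: p')
    also have "(p - 1) div 2 = 1031" by (simp add: p')
    finally have "2 dvd (1031 :: nat)" using \<open>2 dvd t\<close> by (rule dvd_trans[rotated])
    thus False by simp
  qed
  ultimately have "q = 1013" by simp
  thus ?thesis using pq uq u by (simp add: t_def)
qed

lemma no_small_divisor_6079: "list_all (\<lambda>d. 6079 mod d \<noteq> 0) [2..77 :: int]"
  by code_simp

lemma prime_6079: "prime (6079 :: nat)"
  unfolding prime_divisor_sqrt
proof (intro conjI allI impI)
  fix d :: nat assume d: "d dvd 6079 \<and> d\<^sup>2 \<le> 6079"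
  show "d = 1"
  proof (rule ccontr)
    assume "d \<noteq> 1"
    have "d \<noteq> 0" using d by (intro notI) simp
    have "d\<^sup>2 < 78\<^sup>2" using d by (elim conjE) (rule le_less_trans, assumption, simp)
    hence "d < 78" by (rule power_less_imp_less_base) simp
    hence "int d \<in> set [2..77]"
      using \<open>d \<noteq> 0\<close> \<open>d \<noteq> 1\<close> by (simp only: set_upto atLeastAtMost_iff) linarith
    with no_small_divisor_6079 have "6079 mod int d \<noteq> 0"
      unfolding list_all_iff by (rule bspec)
    moreover have "int d dvd int 6079" using d by (simp only: int_dvd_int_iff)
    ultimately show False by (simp add: dvd_eq_mod_eq_0)
  qed
qed simp

lemma power_cong_exponent_6079:
  assumes "k mod 6078 = r" "r > 0"
  shows "[x ^ k = x ^ r] (mod int 6079)"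
proof (cases "int 6079 dvd x")
  case True
  have "k > 0" using assms by (cases "k = 0") auto
  hence "x dvd x ^ k" "x dvd x ^ r" using assms(2) by (blast intro: dvd_power)+
  hence "int 6079 dvd x ^ k" "int 6079 dvd x ^ r" using True by (blast intro: dvd_trans)+
  hence "int 6079 dvd x ^ k - x ^ r" by (rule dvd_diff)
  thus ?thesis unfolding cong_iff_dvd_diff .
next
  case False
  have "k = 6078 * (k div 6078) + r" using assms(1) by auto
  hence "x ^ k = x ^ (6078 * (k div 6078)) * x ^ r" by (metis power_add)
  also have "[\<dots> = 1 * x ^ r] (mod int 6079)"
    using False by (intro cong_mult power_eq_1_mod_prime[OF prime_6079] cong_refl) simp_all
  finally show ?thesis by (simp only: mult_1)
qed

text \<open>
  Only the residue \<open>a\<close> of \<open>m\<close> modulo \<open>6079\<close> matters.  If \<open>a = 0\<close>, \<open>prime_dvd_solution\<close> applies; if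
  \<open>0 < a < 3040\<close>, the scan excludes \<open>a\<close> directly; otherwise it excludes \<open>6079 - a\<close> by the second
  congruence.
\<close>

lemma exponent_not_5064_mod_6078:
  assumes k: "power_sum k m = int m ^ k" "even k" "k > 0" and m: "odd m"
  shows "k mod 6078 \<noteq> 5064"
proof
  assume mod: "k mod 6078 = 5064"
  define a where "a = m mod 6079"
  define w where "w = m div 6079"
  have ma: "m = 6079 * w + a" by (simp add: a_def w_def)
  have not_dvd: "\<not>(6079 - 1) dvd k" using mod by (simp add: dvd_eq_mod_eq_0)
  note pow = power_cong_exponent_6079[OF mod]
  have ps: "[power_sum k n = power_sum 5064 n] (mod int 6079)" for n
    unfolding power_sum_def by (intro cong_sum pow) simp
  have full: "[power_sum k (6079 * w) = 0] (mod int 6079)" for w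
  proof -
    have "int 6079 dvd int w * power_sum k 6079"
      using power_sum_prime_not_dvd[OF prime_6079 not_dvd] by simp
    thus ?thesis using power_sum_mult_cong[of k 6079 w] cong_trans cong_0_iff by blast
  qed
  have split: "power_sum k (n + n') = power_sum k n + (\<Sum>j<n'. int (n + j) ^ k)" for n n'
    unfolding power_sum_def lessThan_atLeast0
    using sum.atLeastLessThan_concat[of 0 n "n + n'" "\<lambda>j. int j ^ k"]
      sum.shift_bounds_nat_ivl[of "\<lambda>j. int j ^ k" 0 n n'] by (simp add: add.commute)
  show False
  proof (cases "a = 0")
    case True
    hence "6079 dvd m" using ma by simp
    hence "int 6079 dvd (\<Sum>j = 1..<(6079 + 1) div 2. int j ^ (k - 1))"
      using k m by (intro prime_dvd_solution prime_6079) auto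
    moreover have "[(\<Sum>j = 1..<(6079 + 1) div 2. int j ^ (k - 1)) = (\<Sum>j = 1..<3040. int j ^ 5063)] (mod int 6079)"
    proof -
      have "k = 5064 + 6078 * (k div 6078)" using mod mod_mult_div_eq[of k 6078] by simp
      hence "k - 1 = 5063 + 6078 * (k div 6078)" by linarith
      hence "(k - 1) mod 6078 = 5063" by (simp only: mod_mult_self2) simp
      moreover have "(6079 + 1) div 2 = (3040 :: nat)" by simp
      ultimately show ?thesis by (simp only:) (intro cong_sum power_cong_exponent_6079, simp_all)
    qed
    ultimately have "int 6079 dvd (\<Sum>j = 1..<3040. int j ^ 5063)" using cong_dvd_iff by blast
    thus False using no_solution_exponent_5064(1) by blast
  next
    case False
    have "[power_sum k m = 0 + power_sum k a] (mod int 6079)"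
      unfolding ma split[of "6079 * w" a] power_sum_def[of k a]
      by (intro cong_add full cong_sum cong_pow) (simp add: cong_iff_dvd_diff)
    moreover have "[int m ^ k = int a ^ k] (mod int 6079)"
      by (intro cong_pow) (simp add: ma cong_iff_dvd_diff)
    ultimately have "[power_sum k a = int a ^ k] (mod int 6079)"
      using k(1) by (metis add_0 cong_sym cong_trans)
    hence sol: "[power_sum 5064 a = int a ^ 5064] (mod int 6079)"
      using ps[of a] pow[of "int a"] by (meson cong_sym cong_trans zero_less_numeral)
    show False
    proof (cases "a < 3040")
      case True
      thus False using sol no_solution_exponent_5064(2)[of a] False by simp
    next
      case ge: False
      define b where "b = 6079 - a"
      have "a < 6079" by (simp add: a_def)
      hence ab: "a + b = 6079" and b: "b \<in> {1..<3040}" using ge by (auto simp: b_def)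
      \<comment> \<open>reflecting \<open>j\<close> to \<open>6079 - j\<close> turns a solution \<open>a\<close> into the second congruence for \<open>b\<close>\<close>
      have "(\<Sum>j<b. int (a + j) ^ k) = (\<Sum>j\<in>{1..b}. int (6079 - j) ^ k)"
      proof (rule sum.reindex_bij_witness[of _ "\<lambda>j. b - j" "\<lambda>j. b - j"])
        fix j assume "j \<in> {..<b}"
        hence "6079 - (b - j) = a + j" using ab by auto
        thus "int (6079 - (b - j)) ^ k = int (a + j) ^ k" by (simp only:)
      qed auto
      also have "[\<dots> = (\<Sum>j\<in>{1..b}. int j ^ k)] (mod int 6079)"
      proof (intro cong_sum)
        fix j assume "j \<in> {1..b}"
        hence "[int (6079 - j) = - int j] (mod int 6079)" using ab by (simp add: cong_iff_dvd_diff of_nat_diff)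
        hence "[int (6079 - j) ^ k = (- int j) ^ k] (mod int 6079)" by (rule cong_pow)
        thus "[int (6079 - j) ^ k = int j ^ k] (mod int 6079)" using k(2) by simp
      qed
      also have "(\<Sum>j\<in>{1..b}. int j ^ k) = power_sum k (Suc b)"
        unfolding power_sum_def using k(3) by (intro sum.mono_neutral_cong_left) auto
      finally have "[power_sum k a + (\<Sum>j<b. int (a + j) ^ k) = power_sum k a + power_sum k (Suc b)] (mod int 6079)"
        by (intro cong_add cong_refl)
      moreover have "[power_sum k a + (\<Sum>j<b. int (a + j) ^ k) = 0] (mod int 6079)"
        using full[of 1] split[of a b] ab by simp
      ultimately have "[power_sum k a + power_sum k (Suc b) = 0] (mod int 6079)"
        using cong_sym cong_trans by blast
      moreover have "[int b ^ k = int a ^ k] (mod int 6079)"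
      proof -
        have "int b - (- int a) = int 6079" using ab by linarith
        hence "[int b = - int a] (mod int 6079)" by (simp only: cong_iff_dvd_diff dvd_refl)
        hence "[int b ^ k = (- int a) ^ k] (mod int 6079)" by (rule cong_pow)
        thus ?thesis using k(2) by simp
      qed
      moreover note \<open>[power_sum k a = int a ^ k] (mod int 6079)\<close>
      ultimately have "int 6079 dvd power_sum k b + 2 * int b ^ k"
        unfolding power_sum_Suc cong_iff_dvd_diff by (smt (verit) dvd_add dvd_diff)
      moreover have "[power_sum k b + 2 * int b ^ k = power_sum 5064 b + 2 * int b ^ 5064] (mod int 6079)"
        by (intro cong_add cong_scalar_left ps pow) simp
      ultimately have "[power_sum 5064 b + 2 * int b ^ 5064 = 0] (mod int 6079)"
        using cong_dvd_iff cong_0_iff by blast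
      thus False using no_solution_exponent_5064(3)[OF b] by simp
    qed
  qed
qed

lemma special_prime_divisor_N2_ge:
  assumes sol: "power_sum k m = int m ^ k" "k > 0" "N2 dvd int k" "m > 0"
    and special: "special_prime_divisor N2 m k p"
  shows "p \<ge> 2099"
proof (rule ccontr)
  assume "\<not>p \<ge> 2099"
  hence "ord p 2 = 2026" using small_special_prime_divisor_N2[OF special] not_le by blast
  hence "[int k = int 2026 div 2 - 1] (mod int 2026)" using special by (simp only: special_prime_divisor_def)
  hence "[int k = 1012] (mod 2026)" by simp
  hence "2026 dvd int k - 1012" by (simp only: cong_iff_dvd_diff)
  moreover have "(1013::int) dvd 2026" by simp
  ultimately have "1013 dvd int k - 1012" by (rule dvd_trans[rotated])
  hence "1013 dvd int k - 1012 - 4 * 1013" by (rule dvd_diff) simp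
  moreover have "6 dvd int k" using six_dvd_N2 sol(3) by (rule dvd_trans)
  hence "int 6 dvd int k" by simp
  hence k6: "6 dvd k" by (simp only: int_dvd_int_iff)
  have "6 dvd int k - 6 * 844" using \<open>6 dvd int k\<close> by (rule dvd_diff) simp
  moreover have "coprime (1013::int) 6"
  proof (rule coprimeI)
    fix c :: int assume "c dvd 1013" "c dvd 6"
    hence "c dvd 169 * 6 - 1013" by (intro dvd_diff dvd_mult)
    thus "is_unit c" by simp
  qed
  ultimately have "1013 * 6 dvd int k - 5064" by (intro divides_mult) simp_all
  hence "int k mod 6078 = 5064 mod 6078" unfolding mod_eq_dvd_iff by simp
  hence "int (k mod 6078) = int 5064" by (simp add: zmod_int)
  hence "k mod 6078 = 5064" by (simp only: of_nat_eq_iff)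
  moreover have "even k" using k6 by (auto intro: dvd_trans)
  moreover from this have "odd m" using odd_solution[OF sol(1) _ sol(2,4)] by blast
  ultimately show False using exponent_not_5064_mod_6078 sol by blast
qed

theorem theorem6:
  fixes N :: int and m k :: nat
  assumes "[N = 0] (mod 24)"
    and "m > 0" and "k > 0"
    and "erdos_moser_solution m k"
    and "k \<ge> 2"
    and "N dvd int k"
  shows "(m < 10 ^ (10 ^ 11) \<longrightarrow> (\<exists>p. special_prime_divisor N m k p))
       \<and> ([m = 2] (mod 3) \<and> m < 10 ^ (10 ^ 16) \<longrightarrow> (\<exists>p. special_prime_divisor N m k p))
       \<and> (N = N2 \<and> (m < 10 ^ (10 ^ 11) \<or> [m = 2] (mod 3) \<and> m < 10 ^ (10 ^ 16)) \<longrightarrow>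
            (\<forall>p. special_prime_divisor N m k p \<longrightarrow> p \<ge> 2099))"
proof (intro conjI impI allI)
  have N: "24 dvd N" using assms(1) by (simp only: cong_0_iff)
  (* the exponent E of the bound 10 ^ E stays abstract, so that the huge power is never evaluated *)
  note exists = exists_special_prime_divisor[OF N assms(6,3,4,2)]
  show "\<exists>p. special_prime_divisor N m k p" if "m < 10 ^ (10 ^ 11)"
    using that by (rule exists) (rule disjI1, simp)
  show "\<exists>p. special_prime_divisor N m k p" if "[m = 2] (mod 3) \<and> m < 10 ^ (10 ^ 16)"
  proof -
    have "m mod 3 = 2" using conjunct1[OF that] by (simp add: unique_euclidean_semiring_class.cong_def)
    hence "real (10 ^ 16) \<le> 10 ^ 11 \<or> m mod 3 = 2 \<and> real (10 ^ 16) \<le> 10 ^ 16" by simp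
    with conjunct2[OF that] show ?thesis by (rule exists)
  qed
  fix p
  assume "N = N2 \<and> (m < 10 ^ (10 ^ 11) \<or> [m = 2] (mod 3) \<and> m < 10 ^ (10 ^ 16))"
  hence "N = N2" by (rule conjunct1)
  moreover assume "special_prime_divisor N m k p"
  ultimately show "p \<ge> 2099"
    using special_prime_divisor_N2_ge[OF solution_power_sum[OF assms(4,3)] assms(3)] assms(2,6) by blast
qed

end
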